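(* Let $p$ be a prime, $n\ge1$ an integer and $\alpha>0$, and let $\mathfrak{T}^\alpha$ be the Taibleson operator on $\mathbb{Q}_p^n$. The semigroup $\exp(-t\,\mathfrak{T}^\alpha)$ on $\mathbb{Q}_p^n$ admits a continuous heat kernel $p_\alpha(t,x,y)$ that satisfies the estimate $$p_\alpha(t,x,y)\simeq\frac{t}{\left(t^{1/\alpha}+\|x-y\|_p\right)^{n+\alpha}}$$ for all $t>0$ and $x,y\in\mathbb{Q}_p^n$, i.e. the ratio of the two sides is bounded above and below by positive constants independent of $t,x,y$. In particular, the semigroup $\exp(-t\,\mathfrak{T}^\alpha)$ is transient if and only if $\alpha<n$. In the transient case, the Green function satisfies the identity $$g_\alpha(x,y)=\frac{1-p^{-\alpha}}{1-p^{\alpha-n}}\,\frac1{\|x-y\|_p^{n-\alpha}}\qquad(x\neq y).$$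
   Context: On $\mathbb{Q}_p^n$ put $\|z\|_p=\max_i\|z_i\|_p$, and let $\mu_p^n$ be the product Haar measure with $\mu_p^n(\mathbb{Z}_p^n)=1$. Fourier transform: $\widehat f(\theta)=\int_{\mathbb{Q}_p^n}\langle x,\theta\rangle f(x)\,d\mu_p^n(x)$, $\langle x,\theta\rangle=\prod_{k=1}^n\exp(2\pi\sqrt{-1}\{x_k\theta_k\})$, where $\{\cdot\}$ is the $p$-adic fractional part. $\mathcal{V}_c$ is the space of compactly supported locally constant functions on $\mathbb{Q}_p^n$; the Fourier transform is a bijection of $\mathcal{V}_c$. The Taibleson operator is defined on $f\in\mathcal{V}_c$ by $\widehat{\mathfrak{T}^\alpha f}(\zeta)=\|\zeta\|_p^\alpha\,\widehat f(\zeta)$, $\zeta\in\mathbb{Q}_p^n$; it is essentially self-adjoint and non-negative definite in $L^2(\mathbb{Q}_p^n,\mu_p^n)$, and $\exp(-t\,\mathfrak{T}^\alpha)$ is the semigroup generated by its closure, which is a symmetric Markov semigroup. The heat kernel is its integral kernel with respect to $\mu_p^n$. The Green function is $g_\alpha(x,y)=\int_0^\infty p_\alpha(t,x,y)\,dt$. The semigroup is transient if $x\mapsto\int_0^\infty e^{-t\mathfrak{T}^\alpha}f(x)\,dt$ is bounded for every non-negative bounded Borel function $f$ with compact support. *)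

theory Defs
  imports "HOL-Analysis.Analysis" "Berlekamp_Zassenhaus.Finite_Field"
begin

section \<open>The field of p-adic numbers\<close>

text \<open>
  The field \<open>'p padic\<close> of $p$-adic numbers, where $p$ is the cardinality of the
  type \<open>'p :: prime_card\<close>, is the completion of the rationals for the $p$-adic absolute value,
  built from Cauchy sequences.
\<close>

definition rat_pabs :: "nat \<Rightarrow> rat \<Rightarrow> real" where
  "rat_pabs p r =
     (if r = 0 then 0
      else real p powi (int (multiplicity (int p) (snd (quotient_of r)))
                        - int (multiplicity (int p) (fst (quotient_of r)))))"

definition padic_cauchy :: "nat \<Rightarrow> (nat \<Rightarrow> rat) \<Rightarrow> bool" where
  "padic_cauchy p X \<longleftrightarrow> (\<forall>e>0. \<exists>N. \<forall>m\<ge>N. \<forall>n\<ge>N. rat_pabs p (X m - X n) < e)"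

definition padic_null :: "nat \<Rightarrow> (nat \<Rightarrow> rat) \<Rightarrow> bool" where
  "padic_null p X \<longleftrightarrow> (\<lambda>n. rat_pabs p (X n)) \<longlonglongrightarrow> 0"

definition padic_rel :: "nat \<Rightarrow> (nat \<Rightarrow> rat) \<Rightarrow> (nat \<Rightarrow> rat) \<Rightarrow> bool" where
  "padic_rel p X Y \<longleftrightarrow> padic_cauchy p X \<and> padic_cauchy p Y \<and> padic_null p (\<lambda>n. X n - Y n)"

context
  fixes p :: nat
  assumes p: "prime p"
begin

lemma pelem: "prime_elem (int p)"
  using p by (simp add: prime_imp_prime_elem)

lemma p_gt1: "real p > 1"
  using prime_gt_1_nat[OF p] by simp

lemma rat_pabs_frac:
  assumes "a \<noteq> 0" "b \<noteq> 0"
  shows "rat_pabs p (of_int a / of_int b)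
           = real p powi (int (multiplicity (int p) b) - int (multiplicity (int p) a))"
proof -
  obtain n d where q: "quotient_of (of_int a / of_int b) = (n, d)" by fastforce
  have d: "d > 0" using quotient_of_denom_pos[OF q] .
  have e: "of_int a / of_int b = (of_int n / of_int d :: rat)" using quotient_of_div[OF q] .
  have "(of_int a * of_int d :: rat) = of_int n * of_int b"
    using e assms d by (simp add: field_simps)
  hence eq: "a * d = n * b" by (metis of_int_eq_iff of_int_mult)
  have n: "n \<noteq> 0" using eq assms d by auto
  have "multiplicity (int p) a + multiplicity (int p) d = multiplicity (int p) n + multiplicity (int p) b"
    using arg_cong[OF eq, of "multiplicity (int p)"] assms d n
    by (simp add: prime_elem_multiplicity_mult_distrib[OF pelem])
  hence "int (multiplicity (int p) d) - int (multiplicity (int p) n)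
       = int (multiplicity (int p) b) - int (multiplicity (int p) a)" by linarith
  thus ?thesis using assms q by (simp add: rat_pabs_def)
qed

lemma rat_pabs_0 [simp]: "rat_pabs p 0 = 0"
  by (simp add: rat_pabs_def)

lemma rat_pabs_nonneg [simp]: "rat_pabs p r \<ge> 0"
  by (simp add: rat_pabs_def)

lemma rat_pabs_eq_0_iff [simp]: "rat_pabs p r = 0 \<longleftrightarrow> r = 0"
  using p_gt1 by (simp add: rat_pabs_def)

lemma rat_cases_frac: obtains a b where "b > 0" "(r::rat) = of_int a / of_int b"
  by (metis quotient_of_denom_pos quotient_of_div surj_pair)

lemma rat_pabs_mult: "rat_pabs p (r * s) = rat_pabs p r * rat_pabs p s"
proof (cases "r = 0 \<or> s = 0")
  case False
  obtain a b where r: "b > 0" "r = of_int a / of_int b" by (rule rat_cases_frac)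
  obtain c d where s: "d > 0" "s = of_int c / of_int d" by (rule rat_cases_frac)
  have nz: "a \<noteq> 0" "b \<noteq> 0" "c \<noteq> 0" "d \<noteq> 0" using False r s by auto
  have "r * s = of_int (a * c) / of_int (b * d)" by (simp add: r s)
  hence "rat_pabs p (r * s) = real p powi (int (multiplicity (int p) (b * d)) - int (multiplicity (int p) (a * c)))"
    using rat_pabs_frac[of "a * c" "b * d"] nz by simp
  also have "\<dots> = real p powi ((int (multiplicity (int p) b) - int (multiplicity (int p) a))
                    + (int (multiplicity (int p) d) - int (multiplicity (int p) c)))"
    using nz by (simp add: prime_elem_multiplicity_mult_distrib[OF pelem] algebra_simps)
  also have "\<dots> = rat_pabs p r * rat_pabs p s"
    using p_gt1 nz r s by (simp add: rat_pabs_frac power_int_add)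
  finally show ?thesis .
qed auto

lemma rat_pabs_of_int_le:
  assumes "int p ^ k dvd a"
  shows "rat_pabs p (of_int a) \<le> real p powi (- int k)"
proof (cases "a = 0")
  case False
  have "k \<le> multiplicity (int p) a"
    using assms False pelem by (intro multiplicity_geI) auto
  thus ?thesis using rat_pabs_frac[of a 1] False p_gt1 by (simp add: power_int_increasing)
qed simp

lemma rat_pabs_of_int:
  assumes "a \<noteq> 0"
  shows "rat_pabs p (of_int a) = real p powi (- int (multiplicity (int p) a))"
  using rat_pabs_frac[of a 1] assms by simp

lemma rat_pabs_1 [simp]: "rat_pabs p 1 = 1"
  using rat_pabs_of_int[of 1] by simp

lemma rat_pabs_of_int_add:
  "rat_pabs p (of_int (a + b)) \<le> max (rat_pabs p (of_int a)) (rat_pabs p (of_int b))"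
proof (cases "a = 0 \<or> b = 0")
  case False
  define k where "k = min (multiplicity (int p) a) (multiplicity (int p) b)"
  have "int p ^ k dvd a + b"
    by (intro dvd_add multiplicity_dvd') (simp_all add: k_def)
  from rat_pabs_of_int_le[OF this] show ?thesis
    using False by (auto simp: k_def rat_pabs_of_int min_def max_def split: if_splits)
qed auto

lemma rat_pabs_ultra: "rat_pabs p (r + s) \<le> max (rat_pabs p r) (rat_pabs p s)"
proof -
  obtain a b where r: "b > 0" "r = of_int a / of_int b" by (rule rat_cases_frac)
  obtain c d where s: "d > 0" "s = of_int c / of_int d" by (rule rat_cases_frac)
  define u where "u = (of_int (b * d) :: rat)"
  have u: "u \<noteq> 0" using r s by (simp add: u_def)
  have pos: "rat_pabs p u > 0" using u by (simp add: less_le)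
  have "rat_pabs p ((r + s) * u) \<le> max (rat_pabs p (r * u)) (rat_pabs p (s * u))"
  proof -
    have "r * u = of_int (a * d)" "s * u = of_int (c * b)" using r s by (simp_all add: u_def)
    moreover from this have "(r + s) * u = of_int (a * d + c * b)" by (simp add: algebra_simps)
    ultimately show ?thesis using rat_pabs_of_int_add by metis
  qed
  thus ?thesis using pos by (auto simp: rat_pabs_mult max_def split: if_splits)
qed

lemma rat_pabs_minus [simp]: "rat_pabs p (- r) = rat_pabs p r"
proof -
  have "rat_pabs p (-1) * rat_pabs p (-1) = 1"
    using rat_pabs_mult[of "-1" "-1"] by simp
  moreover have "rat_pabs p (-1) \<ge> 0" by simp
  ultimately have "rat_pabs p (-1) = 1" by (metis abs_of_nonneg abs_mult_self_eq power2_eq_1_iff power2_eq_square abs_1 abs_minus)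
  thus ?thesis using rat_pabs_mult[of "-1" r] by simp
qed

lemma rat_pabs_commute: "rat_pabs p (r - s) = rat_pabs p (s - r)"
  using rat_pabs_minus[of "r - s"] by simp

lemma rat_pabs_add_le: "rat_pabs p (r + s) \<le> rat_pabs p r + rat_pabs p s"
  using rat_pabs_ultra[of r s] rat_pabs_nonneg[of r] rat_pabs_nonneg[of s] by linarith

lemma rat_pabs_diff_abs: "\<bar>rat_pabs p r - rat_pabs p s\<bar> \<le> rat_pabs p (r - s)"
  using rat_pabs_add_le[of "r - s" s] rat_pabs_add_le[of "s - r" r] rat_pabs_commute[of r s]
  by (simp add: abs_le_iff)

lemma rat_pabs_inverse: "rat_pabs p (inverse r) = inverse (rat_pabs p r)"
proof (cases "r = 0")
  case False
  have "rat_pabs p r * rat_pabs p (inverse r) = 1"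
    using rat_pabs_mult[of r "inverse r"] False by simp
  thus ?thesis by (metis inverse_unique)
qed simp

subsection \<open>Cauchy and null sequences\<close>

lemma padic_cauchyD:
  "padic_cauchy p X \<Longrightarrow> e > 0 \<Longrightarrow> \<exists>N. \<forall>m\<ge>N. \<forall>n\<ge>N. rat_pabs p (X m - X n) < e"
  by (simp add: padic_cauchy_def)

lemma padic_cauchy_const [simp]: "padic_cauchy p (\<lambda>_. r)"
  by (simp add: padic_cauchy_def)

lemma padic_cauchy_minus: "padic_cauchy p X \<Longrightarrow> padic_cauchy p (\<lambda>n. - X n)"
  unfolding padic_cauchy_def by (simp add: rat_pabs_commute)

lemma padic_cauchy_add:
  assumes "padic_cauchy p X" "padic_cauchy p Y"
  shows "padic_cauchy p (\<lambda>n. X n + Y n)"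
  unfolding padic_cauchy_def
proof (intro allI impI)
  fix e :: real assume "e > 0"
  obtain M where M: "\<And>m n. m \<ge> M \<Longrightarrow> n \<ge> M \<Longrightarrow> rat_pabs p (X m - X n) < e"
    using padic_cauchyD[OF assms(1) \<open>e > 0\<close>] by blast
  obtain N where N: "\<And>m n. m \<ge> N \<Longrightarrow> n \<ge> N \<Longrightarrow> rat_pabs p (Y m - Y n) < e"
    using padic_cauchyD[OF assms(2) \<open>e > 0\<close>] by blast
  have "rat_pabs p (X m + Y m - (X n + Y n)) < e" if "m \<ge> max M N" "n \<ge> max M N" for m n
  proof -
    have "X m + Y m - (X n + Y n) = (X m - X n) + (Y m - Y n)" by simp
    thus ?thesis using rat_pabs_ultra[of "X m - X n" "Y m - Y n"] M[of m n] N[of m n] that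
      by (simp only:) auto
  qed
  thus "\<exists>N. \<forall>m\<ge>N. \<forall>n\<ge>N. rat_pabs p (X m + Y m - (X n + Y n)) < e" by blast
qed

lemma padic_cauchy_norm_convergent:
  assumes "padic_cauchy p X"
  shows "convergent (\<lambda>n. rat_pabs p (X n))"
proof (rule Cauchy_convergent, rule metric_CauchyI)
  fix e :: real assume "e > 0"
  obtain M where M: "\<And>m n. m \<ge> M \<Longrightarrow> n \<ge> M \<Longrightarrow> rat_pabs p (X m - X n) < e"
    using padic_cauchyD[OF assms(1) \<open>e > 0\<close>] by blast
  show "\<exists>M. \<forall>m\<ge>M. \<forall>n\<ge>M. dist (rat_pabs p (X m)) (rat_pabs p (X n)) < e"
    using M rat_pabs_diff_abs unfolding dist_real_def by (meson le_less_trans)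
qed

lemma padic_cauchy_bounded:
  assumes "padic_cauchy p X"
  shows "\<exists>B>0. \<forall>n. rat_pabs p (X n) \<le> B"
proof -
  have "Bseq (\<lambda>n. rat_pabs p (X n))"
    using padic_cauchy_norm_convergent[OF assms] convergent_imp_Bseq by blast
  thus ?thesis unfolding Bseq_def by auto
qed

lemma padic_null_add: "padic_null p X \<Longrightarrow> padic_null p Y \<Longrightarrow> padic_null p (\<lambda>n. X n + Y n)"
  unfolding padic_null_def
  by (rule tendsto_sandwich[OF _ _ tendsto_const, where h = "\<lambda>n. rat_pabs p (X n) + rat_pabs p (Y n)"])
     (auto simp: rat_pabs_add_le intro: tendsto_add_zero)

lemma padic_null_minus: "padic_null p X \<Longrightarrow> padic_null p (\<lambda>n. - X n)"
  by (simp add: padic_null_def)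

lemma padic_null_mult_bounded:
  assumes "\<forall>n. rat_pabs p (X n) \<le> B" "padic_null p Y"
  shows "padic_null p (\<lambda>n. X n * Y n)"
  unfolding padic_null_def
proof (rule tendsto_sandwich[OF _ _ tendsto_const, where h = "\<lambda>n. B * rat_pabs p (Y n)"])
  show "(\<lambda>n. B * rat_pabs p (Y n)) \<longlonglongrightarrow> 0"
    using assms(2) by (simp add: padic_null_def tendsto_mult_right_zero)
  show "\<forall>\<^sub>F n in sequentially. rat_pabs p (X n * Y n) \<le> B * rat_pabs p (Y n)"
    using assms(1) by (intro always_eventually) (simp add: rat_pabs_mult mult_right_mono)
qed auto

lemma padic_cauchy_mult:
  assumes "padic_cauchy p X" "padic_cauchy p Y"
  shows "padic_cauchy p (\<lambda>n. X n * Y n)"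
  unfolding padic_cauchy_def
proof (intro allI impI)
  fix e :: real assume e: "e > 0"
  obtain A where A: "A > 0" "\<And>n. rat_pabs p (X n) \<le> A" using padic_cauchy_bounded[OF assms(1)] by blast
  obtain B where B: "B > 0" "\<And>n. rat_pabs p (Y n) \<le> B" using padic_cauchy_bounded[OF assms(2)] by blast
  obtain M where M: "\<And>m n. m \<ge> M \<Longrightarrow> n \<ge> M \<Longrightarrow> rat_pabs p (X m - X n) < e / B"
    using padic_cauchyD[OF assms(1), of "e / B"] e B by auto
  obtain N where N: "\<And>m n. m \<ge> N \<Longrightarrow> n \<ge> N \<Longrightarrow> rat_pabs p (Y m - Y n) < e / A"
    using padic_cauchyD[OF assms(2), of "e / A"] e A by auto
  have "rat_pabs p (X m * Y m - X n * Y n) < e" if mn: "m \<ge> max M N" "n \<ge> max M N" for m n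
  proof -
    have eq: "X m * Y m - X n * Y n = X m * (Y m - Y n) + (X m - X n) * Y n" by (simp add: algebra_simps)
    have "rat_pabs p (X m * (Y m - Y n)) \<le> A * rat_pabs p (Y m - Y n)"
      using A by (simp add: rat_pabs_mult mult_right_mono)
    also have "\<dots> < e" using N[of m n] mn A by (simp add: field_simps)
    finally have 1: "rat_pabs p (X m * (Y m - Y n)) < e" .
    have "rat_pabs p ((X m - X n) * Y n) \<le> rat_pabs p (X m - X n) * B"
      using B by (simp add: rat_pabs_mult mult_left_mono)
    also have "\<dots> < e" using M[of m n] mn B by (simp add: field_simps)
    finally have 2: "rat_pabs p ((X m - X n) * Y n) < e" .
    show ?thesis
      unfolding eq using rat_pabs_ultra[of "X m * (Y m - Y n)" "(X m - X n) * Y n"] 1 2 by linarith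
  qed
  thus "\<exists>N. \<forall>m\<ge>N. \<forall>n\<ge>N. rat_pabs p (X m * Y m - X n * Y n) < e" by blast
qed

lemma padic_cauchy_not_null:
  assumes "padic_cauchy p X" "\<not> padic_null p X"
  shows "\<exists>b>0. \<exists>N. \<forall>n\<ge>N. rat_pabs p (X n) > b"
proof -
  obtain L where L: "(\<lambda>n. rat_pabs p (X n)) \<longlonglongrightarrow> L"
    using padic_cauchy_norm_convergent[OF assms(1)] convergent_def by blast
  have "L \<ge> 0" using LIMSEQ_le_const[OF L] by simp
  with assms(2) L have "L > 0" by (cases "L = 0") (auto simp: padic_null_def)
  hence "\<forall>\<^sub>F n in sequentially. rat_pabs p (X n) > L / 2"
    using order_tendstoD(1)[OF L, of "L / 2"] by simp
  thus ?thesis using \<open>L > 0\<close> unfolding eventually_sequentially by (intro exI[of _ "L / 2"]) auto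
qed

lemma rat_pabs_diff_inverse:
  assumes "b > 0" "rat_pabs p r > b" "c > 0" "rat_pabs p s > c"
  shows "rat_pabs p (inverse r - inverse s) \<le> rat_pabs p (r - s) / (b * c)"
proof -
  have nz: "r \<noteq> 0" "s \<noteq> 0" using assms by auto
  have "rat_pabs p (inverse r - inverse s) = rat_pabs p (r - s) / (rat_pabs p r * rat_pabs p s)"
    using nz by (simp add: inverse_diff_inverse rat_pabs_mult rat_pabs_inverse divide_inverse mult_ac)
  also have "\<dots> \<le> rat_pabs p (r - s) / (b * c)"
    using assms by (intro divide_left_mono mult_mono) (auto intro!: mult_pos_pos)
  finally show ?thesis .
qed

lemma padic_cauchy_inverse:
  assumes "padic_cauchy p X" "\<not> padic_null p X"
  shows "padic_cauchy p (\<lambda>n. inverse (X n))"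
  unfolding padic_cauchy_def
proof (intro allI impI)
  fix e :: real assume e: "e > 0"
  obtain b N where b: "b > 0" "\<And>n. n \<ge> N \<Longrightarrow> rat_pabs p (X n) > b"
    using padic_cauchy_not_null[OF assms] by blast
  obtain M where M: "\<And>m n. m \<ge> M \<Longrightarrow> n \<ge> M \<Longrightarrow> rat_pabs p (X m - X n) < e * (b * b)"
    using padic_cauchyD[OF assms(1), of "e * (b * b)"] e b by auto
  have "rat_pabs p (inverse (X m) - inverse (X n)) < e" if mn: "m \<ge> max M N" "n \<ge> max M N" for m n
  proof -
    have "rat_pabs p (inverse (X m) - inverse (X n)) \<le> rat_pabs p (X m - X n) / (b * b)"
      using b mn by (intro rat_pabs_diff_inverse) auto
    also have "\<dots> < e" using M[of m n] mn b by (simp add: divide_less_eq)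
    finally show ?thesis .
  qed
  thus "\<exists>N. \<forall>m\<ge>N. \<forall>n\<ge>N. rat_pabs p (inverse (X m) - inverse (X n)) < e" by blast
qed

lemma padic_null_diff_inverse:
  assumes "padic_cauchy p X" "\<not> padic_null p X" "padic_cauchy p Y" "\<not> padic_null p Y"
    and "padic_null p (\<lambda>n. X n - Y n)"
  shows "padic_null p (\<lambda>n. inverse (X n) - inverse (Y n))"
proof -
  obtain b M where b: "b > 0" "\<And>n. n \<ge> M \<Longrightarrow> rat_pabs p (X n) > b"
    using padic_cauchy_not_null[OF assms(1,2)] by blast
  obtain c N where c: "c > 0" "\<And>n. n \<ge> N \<Longrightarrow> rat_pabs p (Y n) > c"
    using padic_cauchy_not_null[OF assms(3,4)] by blast
  show ?thesis unfolding padic_null_def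
  proof (rule tendsto_sandwich[OF _ _ tendsto_const, where h = "\<lambda>n. rat_pabs p (X n - Y n) / (b * c)"])
    show "(\<lambda>n. rat_pabs p (X n - Y n) / (b * c)) \<longlonglongrightarrow> 0"
      using assms(5) by (simp add: padic_null_def tendsto_divide_zero)
    show "\<forall>\<^sub>F n in sequentially. rat_pabs p (inverse (X n) - inverse (Y n)) \<le> rat_pabs p (X n - Y n) / (b * c)"
      using eventually_ge_at_top[of M] eventually_ge_at_top[of N]
      by eventually_elim (use b c in \<open>auto intro!: rat_pabs_diff_inverse\<close>)
  qed auto
qed

lemma padic_rel_refl: "padic_cauchy p X \<Longrightarrow> padic_rel p X X"
  by (simp add: padic_rel_def padic_null_def)

lemma part_equivp_padic_rel: "part_equivp (padic_rel p)"
proof (rule part_equivpI)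
  show "\<exists>X. padic_rel p X X"
    by (rule exI[of _ "\<lambda>_. 0"]) (simp add: padic_rel_refl)
  show "symp (padic_rel p)"
    by (rule sympI) (auto simp: padic_rel_def padic_null_def rat_pabs_commute)
  show "transp (padic_rel p)"
  proof (rule transpI)
    fix X Y Z assume "padic_rel p X Y" "padic_rel p Y Z"
    thus "padic_rel p X Z"
      using padic_null_add[of "\<lambda>n. X n - Y n" "\<lambda>n. Y n - Z n"] by (simp add: padic_rel_def)
  qed
qed

lemma padic_rel_add:
  assumes "padic_rel p X X'" "padic_rel p Y Y'"
  shows "padic_rel p (\<lambda>n. X n + Y n) (\<lambda>n. X' n + Y' n)"
  using assms padic_null_add[of "\<lambda>n. X n - X' n" "\<lambda>n. Y n - Y' n"]
  by (simp add: padic_rel_def padic_cauchy_add add_diff_add)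

lemma padic_rel_minus:
  assumes "padic_rel p X X'"
  shows "padic_rel p (\<lambda>n. - X n) (\<lambda>n. - X' n)"
  using assms padic_null_minus[of "\<lambda>n. X n - X' n"]
  by (simp add: padic_rel_def padic_cauchy_minus padic_null_def rat_pabs_commute)

lemma padic_rel_mult:
  assumes "padic_rel p X X'" "padic_rel p Y Y'"
  shows "padic_rel p (\<lambda>n. X n * Y n) (\<lambda>n. X' n * Y' n)"
proof -
  obtain A where A: "\<forall>n. rat_pabs p (X n) \<le> A"
    using padic_cauchy_bounded assms(1) unfolding padic_rel_def by blast
  obtain B where B: "\<forall>n. rat_pabs p (Y' n) \<le> B"
    using padic_cauchy_bounded assms(2) unfolding padic_rel_def by blast
  have "padic_null p (\<lambda>n. X n * (Y n - Y' n) + Y' n * (X n - X' n))"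
    using assms A B by (intro padic_null_add padic_null_mult_bounded) (auto simp: padic_rel_def)
  moreover have "X n * (Y n - Y' n) + Y' n * (X n - X' n) = X n * Y n - X' n * Y' n" for n
    by (simp add: algebra_simps)
  ultimately show ?thesis using assms by (simp add: padic_rel_def padic_cauchy_mult)
qed

lemma padic_rel_null_iff:
  assumes "padic_rel p X Y"
  shows "padic_null p X \<longleftrightarrow> padic_null p Y"
proof -
  have 1: "padic_null p (\<lambda>n. X n - Y n)" using assms by (simp add: padic_rel_def)
  show ?thesis
    using padic_null_add[OF 1, of Y] padic_null_add[OF padic_null_minus[OF 1], of X] by auto
qed

lemma padic_rel_inverse:
  assumes "padic_rel p X Y"
  shows "padic_rel p (if padic_null p X then (\<lambda>n. 0) else (\<lambda>n. inverse (X n)))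
                     (if padic_null p Y then (\<lambda>n. 0) else (\<lambda>n. inverse (Y n)))"
  using assms padic_rel_null_iff[OF assms]
  by (auto simp: padic_rel_refl padic_rel_def padic_cauchy_inverse padic_null_diff_inverse)
     (auto simp: padic_null_def)

lemma padic_rel_lim:
  assumes "padic_rel p X Y"
  shows "lim (\<lambda>n. rat_pabs p (X n)) = lim (\<lambda>n. rat_pabs p (Y n))"
proof -
  obtain L where L: "(\<lambda>n. rat_pabs p (X n)) \<longlonglongrightarrow> L"
    using padic_cauchy_norm_convergent assms convergent_def unfolding padic_rel_def by blast
  have null: "(\<lambda>n. rat_pabs p (X n - Y n)) \<longlonglongrightarrow> 0"
    using assms by (simp add: padic_rel_def padic_null_def)
  have "(\<lambda>n. rat_pabs p (X n) - rat_pabs p (Y n)) \<longlonglongrightarrow> 0"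
    by (rule Lim_null_comparison[OF _ null]) (simp add: rat_pabs_diff_abs)
  from tendsto_diff[OF L this] have "(\<lambda>n. rat_pabs p (Y n)) \<longlonglongrightarrow> L" by simp
  thus ?thesis using L by (simp add: limI)
qed

end

typedef (overloaded) ('p::prime_card) padic =
  "{c. \<exists>X. padic_rel CARD('p) X X \<and> c = Collect (padic_rel CARD('p) X)}"
  morphisms padic_class Abs_padic
  using padic_rel_refl[OF prime_card padic_cauchy_const[OF prime_card]] by blast

definition padic_of_seq :: "(nat \<Rightarrow> rat) \<Rightarrow> 'p::prime_card padic" where
  "padic_of_seq X = Abs_padic (Collect (padic_rel CARD('p) X))"

definition seq_of_padic :: "'p::prime_card padic \<Rightarrow> nat \<Rightarrow> rat" where
  "seq_of_padic x = (SOME X. X \<in> padic_class x)"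

definition cr_padic :: "(nat \<Rightarrow> rat) \<Rightarrow> 'p::prime_card padic \<Rightarrow> bool" where
  "cr_padic = (\<lambda>X x. padic_rel CARD('p) X X \<and> padic_of_seq X = x)"

lemma Quotient_padic:
  "Quotient (padic_rel CARD('p::prime_card))
     (padic_of_seq :: _ \<Rightarrow> 'p padic) seq_of_padic cr_padic"
proof -
  interpret q: quot_type "padic_rel CARD('p)" "Abs_padic :: _ \<Rightarrow> 'p padic" padic_class
  proof
    show "part_equivp (padic_rel CARD('p))" by (rule part_equivp_padic_rel[OF prime_card])
    show "\<exists>X. padic_rel CARD('p) X X \<and> padic_class y = Collect (padic_rel CARD('p) X)"
      for y :: "'p padic"
      using padic_class[of y] by simp
    show "Abs_padic (padic_class x) = x" for x :: "'p padic" by (rule padic_class_inverse)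
    show "padic_class (Abs_padic c :: 'p padic) = c"
      if "\<exists>X. padic_rel CARD('p) X X \<and> c = Collect (padic_rel CARD('p) X)" for c
      using that by (intro Abs_padic_inverse) simp
    show "padic_class x = padic_class y \<longleftrightarrow> x = y" for x y :: "'p padic"
      by (rule padic_class_inject)
  qed
  have a: "q.abs = padic_of_seq" by (rule ext) (simp add: q.abs_def padic_of_seq_def)
  have r: "q.rep = seq_of_padic" by (rule ext) (simp add: q.rep_def seq_of_padic_def)
  have "Quotient3 (padic_rel CARD('p)) (padic_of_seq :: _ \<Rightarrow> 'p padic) seq_of_padic"
    using q.Quotient unfolding a r .
  thus ?thesis
    by (rule Quotient3_to_Quotient) (simp add: cr_padic_def)
qed

setup_lifting Quotient_padic

instantiation padic :: (prime_card) field
begin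

lift_definition zero_padic :: "'a padic" is "\<lambda>_. 0"
  by (simp add: padic_rel_refl prime_card)

lift_definition one_padic :: "'a padic" is "\<lambda>_. 1"
  by (simp add: padic_rel_refl prime_card)

lift_definition plus_padic :: "'a padic \<Rightarrow> 'a padic \<Rightarrow> 'a padic" is "\<lambda>X Y n. X n + Y n"
  by (rule padic_rel_add[OF prime_card])

lift_definition uminus_padic :: "'a padic \<Rightarrow> 'a padic" is "\<lambda>X n. - X n"
  by (rule padic_rel_minus[OF prime_card])

lift_definition times_padic :: "'a padic \<Rightarrow> 'a padic \<Rightarrow> 'a padic" is "\<lambda>X Y n. X n * Y n"
  by (rule padic_rel_mult[OF prime_card])

lift_definition inverse_padic :: "'a padic \<Rightarrow> 'a padic"
  is "\<lambda>X. if padic_null CARD('a) X then (\<lambda>n. 0) else (\<lambda>n. inverse (X n))"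
  by (rule padic_rel_inverse[OF prime_card])

definition minus_padic :: "'a padic \<Rightarrow> 'a padic \<Rightarrow> 'a padic" where
  "x - y = x + - y" for x y :: "'a padic"

definition divide_padic :: "'a padic \<Rightarrow> 'a padic \<Rightarrow> 'a padic" where
  "x div y = x * inverse y" for x y :: "'a padic"

instance
proof
  fix a b c :: "'a padic"
  note R = padic_rel_refl[OF prime_card[where ?'a = 'a]] and C = padic_rel_def
    and cs = padic_cauchy_add[OF prime_card[where ?'a = 'a]]
             padic_cauchy_mult[OF prime_card[where ?'a = 'a]]
             padic_cauchy_minus[OF prime_card[where ?'a = 'a]]
             padic_cauchy_const[OF prime_card[where ?'a = 'a]]
  show "a + b + c = a + (b + c)"
    by transfer (simp add: add.assoc, intro R cs, auto simp: C)
  show "a + b = b + a"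
    by transfer (simp add: add.commute, intro R cs, auto simp: C)
  show "0 + a = a" by transfer simp
  show "- a + a = 0" by transfer (simp add: R cs)
  show "a - b = a + - b" by (simp add: minus_padic_def)
  show "a * b * c = a * (b * c)"
    by transfer (simp add: mult.assoc, intro R cs, auto simp: C)
  show "a * b = b * a"
    by transfer (simp add: mult.commute, intro R cs, auto simp: C)
  show "1 * a = a" by transfer simp
  show "(a + b) * c = a * c + b * c"
    by transfer (simp add: distrib_right, intro R cs, auto simp: C)
  show "(0::'a padic) \<noteq> 1"
    by transfer (simp add: C padic_null_def rat_pabs_1[OF prime_card] rat_pabs_minus[OF prime_card] LIMSEQ_const_iff)
  show "a div b = a * inverse b" by (simp add: divide_padic_def)
  show "inverse (0::'a padic) = 0"
    by transfer (simp add: R cs padic_null_def rat_pabs_0[OF prime_card])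
  show "inverse a * a = 1" if "a \<noteq> 0"
    using that
  proof transfer
    fix X assume X: "padic_rel CARD('a) X X" and nz: "\<not> padic_rel CARD('a) X (\<lambda>_. 0)"
    have cX: "padic_cauchy CARD('a) X" using X by (simp add: C)
    have nn: "\<not> padic_null CARD('a) X" using nz cX by (simp add: C cs)
    obtain b N where b: "b > 0" "\<And>n. n \<ge> N \<Longrightarrow> rat_pabs CARD('a) (X n) > b"
      using padic_cauchy_not_null[OF prime_card cX nn] by blast
    have "X n \<noteq> 0" if "n \<ge> N" for n using b(1) b(2)[OF that] rat_pabs_0[OF prime_card[where ?'a = 'a]] by auto
    hence "\<forall>\<^sub>F n in sequentially. rat_pabs CARD('a) (inverse (X n) * X n - 1) = 0"
      unfolding eventually_sequentially
      by (intro exI[of _ N]) (simp add: rat_pabs_0[OF prime_card[where ?'a = 'a]])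
    hence "padic_null CARD('a) (\<lambda>n. inverse (X n) * X n - 1)"
      unfolding padic_null_def by (rule tendsto_eventually)
    thus "padic_rel CARD('a) (\<lambda>n. (if padic_null CARD('a) X then \<lambda>n. 0 else (\<lambda>n. inverse (X n))) n * X n) (\<lambda>_. 1)"
      using nn cX padic_cauchy_inverse[OF prime_card cX nn] by (simp add: C cs)
  qed
qed

end

lift_definition padic_norm :: "'p::prime_card padic \<Rightarrow> real"
  is "\<lambda>X. lim (\<lambda>n. rat_pabs CARD('p) (X n))"
  by (rule padic_rel_lim[OF prime_card])

lemma padic_rel_cauchy: "padic_rel p X X \<Longrightarrow> padic_cauchy p X"
  by (simp add: padic_rel_def)

lemma padic_tendsto_lim:
  fixes X :: "nat \<Rightarrow> rat"
  assumes "prime p" "padic_rel p X X"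
  shows "(\<lambda>n. rat_pabs p (X n)) \<longlonglongrightarrow> lim (\<lambda>n. rat_pabs p (X n))"
  using padic_cauchy_norm_convergent[OF assms(1)] assms(2) convergent_LIMSEQ_iff padic_rel_cauchy by blast

lemma padic_norm_0 [simp]: "padic_norm (0::'p::prime_card padic) = 0"
  by transfer (simp add: rat_pabs_0[OF prime_card])

lemma padic_norm_1 [simp]: "padic_norm (1::'p::prime_card padic) = 1"
  by transfer (simp add: rat_pabs_1[OF prime_card])

lemma padic_norm_nonneg [simp]: "padic_norm (x::'p::prime_card padic) \<ge> 0"
proof transfer
  fix X assume "padic_rel CARD('p) X X"
  from padic_tendsto_lim[OF prime_card this]
  show "0 \<le> lim (\<lambda>n. rat_pabs CARD('p) (X n))"
    by (rule LIMSEQ_le_const) (simp add: rat_pabs_nonneg[OF prime_card])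
qed

lemma padic_norm_eq_0_iff [simp]: "padic_norm (x::'p::prime_card padic) = 0 \<longleftrightarrow> x = 0"
proof transfer
  fix X assume X: "padic_rel CARD('p) X X"
  note L = padic_tendsto_lim[OF prime_card X]
  have "lim (\<lambda>n. rat_pabs CARD('p) (X n)) = 0 \<longleftrightarrow> (\<lambda>n. rat_pabs CARD('p) (X n)) \<longlonglongrightarrow> 0"
    using L limI by auto
  thus "lim (\<lambda>n. rat_pabs CARD('p) (X n)) = 0 \<longleftrightarrow> padic_rel CARD('p) X (\<lambda>_. 0)"
    using X by (simp add: padic_rel_def padic_null_def padic_cauchy_const[OF prime_card])
qed

lemma padic_norm_mult: "padic_norm (x * y) = padic_norm x * padic_norm (y::'p::prime_card padic)"
proof transfer
  fix X Y assume XY: "padic_rel CARD('p) X X" "padic_rel CARD('p) Y Y"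
  show "lim (\<lambda>n. rat_pabs CARD('p) (X n * Y n))
        = lim (\<lambda>n. rat_pabs CARD('p) (X n)) * lim (\<lambda>n. rat_pabs CARD('p) (Y n))"
    unfolding rat_pabs_mult[OF prime_card]
    by (intro limI tendsto_mult padic_tendsto_lim prime_card XY)
qed

lemma padic_norm_minus [simp]: "padic_norm (- x) = padic_norm (x::'p::prime_card padic)"
  by transfer (simp add: rat_pabs_minus[OF prime_card])

lemma padic_norm_ultrametric:
  "padic_norm (x + y) \<le> max (padic_norm x) (padic_norm (y::'p::prime_card padic))"
proof transfer
  fix X Y assume XY: "padic_rel CARD('p) X X" "padic_rel CARD('p) Y Y"
  show "lim (\<lambda>n. rat_pabs CARD('p) (X n + Y n))
        \<le> max (lim (\<lambda>n. rat_pabs CARD('p) (X n))) (lim (\<lambda>n. rat_pabs CARD('p) (Y n)))"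
    by (rule LIMSEQ_le[OF padic_tendsto_lim[OF prime_card padic_rel_add[OF prime_card XY]]
             tendsto_max[OF padic_tendsto_lim[OF prime_card XY(1)] padic_tendsto_lim[OF prime_card XY(2)]]])
       (auto simp: rat_pabs_ultra[OF prime_card])
qed

lemma of_int_padic: "(of_int k :: 'p::prime_card padic) = padic_of_seq (\<lambda>_. of_int k)"
proof -
  have zero: "(0 :: 'p padic) = padic_of_seq (\<lambda>_. 0)" and one: "(1 :: 'p padic) = padic_of_seq (\<lambda>_. 1)"
    by (simp_all add: zero_padic_def one_padic_def)
  have add: "padic_of_seq (\<lambda>_. r) + padic_of_seq (\<lambda>_. s) = (padic_of_seq (\<lambda>_. r + s) :: 'p padic)" for r s
    by (rule plus_padic.abs_eq) (simp_all add: padic_rel_refl padic_cauchy_const prime_card)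
  have minus: "- padic_of_seq (\<lambda>_. r) = (padic_of_seq (\<lambda>_. - r) :: 'p padic)" for r
    by (rule uminus_padic.abs_eq) (simp add: padic_rel_refl padic_cauchy_const prime_card)
  have nat: "(of_nat m :: 'p padic) = padic_of_seq (\<lambda>_. of_nat m)" for m
    by (induction m) (simp_all add: zero one add)
  show ?thesis by (cases k) (simp_all add: nat minus one add del: of_nat_Suc)
qed

lemma padic_norm_of_int: "padic_norm (of_int k :: 'p::prime_card padic) = rat_pabs CARD('p) (of_int k)"
  unfolding of_int_padic
  by (subst padic_norm.abs_eq) (simp_all add: padic_rel_refl padic_cauchy_const prime_card)

instance padic :: (prime_card) field_char_0
proof
  show "inj (of_nat :: nat \<Rightarrow> 'a padic)"
  proof (rule injI)
    fix m n assume "(of_nat m :: 'a padic) = of_nat n"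
    hence "(of_int (int m - int n) :: 'a padic) = 0" by simp
    hence "rat_pabs CARD('a) (of_int (int m - int n)) = 0"
      unfolding padic_norm_of_int[symmetric] by simp
    thus "m = n" by (simp add: rat_pabs_eq_0_iff[OF prime_card])
  qed
qed

instantiation padic :: (prime_card) metric_space
begin

definition dist_padic :: "'a padic \<Rightarrow> 'a padic \<Rightarrow> real" where
  "dist_padic x y = padic_norm (x - y)"

definition uniformity_padic :: "('a padic \<times> 'a padic) filter" where
  "uniformity_padic = (INF e\<in>{0<..}. principal {(x, y). dist x y < e})"

definition open_padic :: "'a padic set \<Rightarrow> bool" where
  "open_padic U \<longleftrightarrow> (\<forall>x\<in>U. eventually (\<lambda>(x', y). x' = x \<longrightarrow> y \<in> U) uniformity)"

instance
proof
  fix x y z :: "'a padic"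
  show "dist x y = 0 \<longleftrightarrow> x = y" by (simp add: dist_padic_def)
  have "padic_norm (x - y) \<le> max (padic_norm (x - z)) (padic_norm (z - y))"
    using padic_norm_ultrametric[of "x - z" "z - y"] by simp
  also have "\<dots> \<le> padic_norm (x - z) + padic_norm (y - z)"
    using padic_norm_minus[of "z - y"] by simp
  finally show "dist x y \<le> dist x z + dist y z" by (simp add: dist_padic_def)
qed (simp_all add: uniformity_padic_def open_padic_def)

end


section \<open>Analysis on the n-dimensional p-adic space\<close>

text \<open>
  Points of $\mathbb{Q}_p^n$ are functions \<open>'n \<Rightarrow> 'p padic\<close> on a finite index type with
  \<open>n = CARD('n)\<close>; their topology is the product topology.
\<close>

definition vnorm :: "('n::finite \<Rightarrow> 'p::prime_card padic) \<Rightarrow> real" where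
  "vnorm z = (MAX i. padic_norm (z i))"

definition haar :: "'p::prime_card padic measure" where
  "haar = (THE M. sets M = sets borel
             \<and> (\<forall>a. \<forall>A\<in>sets borel. emeasure M ((+) a ` A) = emeasure M A)
             \<and> emeasure M {x. padic_norm x \<le> 1} = 1)"

definition haarn :: "('n::finite \<Rightarrow> 'p::prime_card padic) measure" where
  "haarn = PiM UNIV (\<lambda>_. haar)"

text \<open>
  The fractional part is the unique element of $\mathbb{Z}[1/p] \cap [0,1)$ congruent to \<open>x\<close>
  modulo $\mathbb{Z}_p$, i.e. the part of the digit expansion of \<open>x\<close> with negative exponents.
\<close>

definition padic_frac :: "'p::prime_card padic \<Rightarrow> rat" where
  "padic_frac x = (THE r. 0 \<le> r \<and> r < 1 \<and> (\<exists>k. r * of_nat CARD('p) ^ k \<in> \<int>)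
                      \<and> padic_norm (x - of_rat r) \<le> 1)"

definition pairing :: "('n::finite \<Rightarrow> 'p::prime_card padic) \<Rightarrow> ('n \<Rightarrow> 'p padic) \<Rightarrow> complex" where
  "pairing x \<theta> = (\<Prod>k\<in>UNIV. exp (2 * complex_of_real pi * \<i> * of_rat (padic_frac (x k * \<theta> k))))"

definition fourier ::
  "(('n::finite \<Rightarrow> 'p::prime_card padic) \<Rightarrow> complex) \<Rightarrow> ('n \<Rightarrow> 'p padic) \<Rightarrow> complex" where
  "fourier f \<theta> = (LINT x|haarn. pairing x \<theta> * f x)"

definition test_functions :: "(('n::finite \<Rightarrow> 'p::prime_card padic) \<Rightarrow> complex) set" where
  "test_functions = {f. (\<forall>x. \<exists>U. open U \<and> x \<in> U \<and> f constant_on U)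
                        \<and> compact (closure {x. f x \<noteq> 0})}"


section \<open>Operators and semigroups on square-integrable functions\<close>

text \<open>
  Elements of $L^2$ are represented by functions; two of them are identified if they agree almost
  everywhere. Unbounded operators are given by their graphs, i.e. sets of pairs of functions.
\<close>

definition L2 :: "'a measure \<Rightarrow> ('a \<Rightarrow> complex) set" where
  "L2 M = {f. f \<in> borel_measurable M \<and> integrable M (\<lambda>x. (cmod (f x))\<^sup>2)}"

definition L2_norm :: "'a measure \<Rightarrow> ('a \<Rightarrow> complex) \<Rightarrow> real" where
  "L2_norm M f = sqrt (LINT x|M. (cmod (f x))\<^sup>2)"

definition closure_op ::
  "'a measure \<Rightarrow> (('a \<Rightarrow> complex) \<times> ('a \<Rightarrow> complex)) set \<Rightarrow> (('a \<Rightarrow> complex) \<times> ('a \<Rightarrow> complex)) set" where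
  "closure_op M T = {(f, g). f \<in> L2 M \<and> g \<in> L2 M \<and>
     (\<exists>u v. (\<forall>k::nat. (u k, v k) \<in> T)
        \<and> (\<lambda>k. L2_norm M (\<lambda>x. u k x - f x)) \<longlonglongrightarrow> 0
        \<and> (\<lambda>k. L2_norm M (\<lambda>x. v k x - g x)) \<longlonglongrightarrow> 0)}"

definition contraction_semigroup ::
  "'a measure \<Rightarrow> (real \<Rightarrow> ('a \<Rightarrow> complex) \<Rightarrow> ('a \<Rightarrow> complex)) \<Rightarrow> bool" where
  "contraction_semigroup M P \<longleftrightarrow>
     (\<forall>t\<ge>0. \<forall>f\<in>L2 M. P t f \<in> L2 M \<and> L2_norm M (P t f) \<le> L2_norm M f) \<and>
     (\<forall>t\<ge>0. \<forall>f\<in>L2 M. \<forall>g\<in>L2 M. \<forall>c. AE x in M. P t (\<lambda>y. f y + c * g y) x = P t f x + c * P t g x) \<and>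
     (\<forall>f\<in>L2 M. AE x in M. P 0 f x = f x) \<and>
     (\<forall>s\<ge>0. \<forall>t\<ge>0. \<forall>f\<in>L2 M. AE x in M. P (s + t) f x = P s (P t f) x) \<and>
     (\<forall>f\<in>L2 M. ((\<lambda>t. L2_norm M (\<lambda>x. P t f x - f x)) \<longlongrightarrow> 0) (at_right 0))"

definition generator ::
  "'a measure \<Rightarrow> (real \<Rightarrow> ('a \<Rightarrow> complex) \<Rightarrow> ('a \<Rightarrow> complex))
     \<Rightarrow> (('a \<Rightarrow> complex) \<times> ('a \<Rightarrow> complex)) set" where
  "generator M P = {(f, g). f \<in> L2 M \<and> g \<in> L2 M \<and>
     ((\<lambda>t. L2_norm M (\<lambda>x. (P t f x - f x) / of_real t - g x)) \<longlongrightarrow> 0) (at_right 0)}"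

text \<open>\<open>P\<close> is the semigroup $\exp(-t \overline{T})$, $t \ge 0$.\<close>

definition is_exp_semigroup ::
  "'a measure \<Rightarrow> (('a \<Rightarrow> complex) \<times> ('a \<Rightarrow> complex)) set
     \<Rightarrow> (real \<Rightarrow> ('a \<Rightarrow> complex) \<Rightarrow> ('a \<Rightarrow> complex)) \<Rightarrow> bool" where
  "is_exp_semigroup M T P \<longleftrightarrow>
     contraction_semigroup M P \<and> generator M P = {(f, \<lambda>x. - g x) | f g. (f, g) \<in> closure_op M T}"

text \<open>
  For a test function \<open>f\<close>, the function \<open>g\<close> with Fourier transform $\|\zeta\|_p^\alpha \hat f(\zeta)$
  is in general not compactly supported, but it is in $L^1 \cap L^2$; integrability makes
  \<open>fourier g\<close> meaningful and determines \<open>g\<close> almost everywhere.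
\<close>

definition taibleson ::
  "real \<Rightarrow> ((('n::finite \<Rightarrow> 'p::prime_card padic) \<Rightarrow> complex)
             \<times> (('n \<Rightarrow> 'p padic) \<Rightarrow> complex)) set" where
  "taibleson \<alpha> = {(f, g). f \<in> test_functions \<and> integrable haarn g \<and> g \<in> L2 haarn \<and>
     (\<forall>\<zeta>. fourier g \<zeta> = of_real (vnorm \<zeta> powr \<alpha>) * fourier f \<zeta>)}"


section \<open>Heat kernels\<close>

definition heat_kernel ::
  "'a measure \<Rightarrow> (real \<Rightarrow> ('a \<Rightarrow> complex) \<Rightarrow> ('a \<Rightarrow> complex)) \<Rightarrow> (real \<Rightarrow> 'a \<Rightarrow> 'a \<Rightarrow> real) \<Rightarrow> bool" where
  "heat_kernel M P p \<longleftrightarrow>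
     (\<forall>t>0. \<forall>f\<in>L2 M. AE x in M. integrable M (\<lambda>y. of_real (p t x y) * f y)
                               \<and> P t f x = (LINT y|M. of_real (p t x y) * f y))"

definition continuous_kernel :: "(real \<Rightarrow> 'a::topological_space \<Rightarrow> 'a \<Rightarrow> real) \<Rightarrow> bool" where
  "continuous_kernel p \<longleftrightarrow> continuous_on ({0<..} \<times> UNIV \<times> UNIV) (\<lambda>(t, x, y). p t x y)"

text \<open>
  The bounded functions \<open>f\<close> are acted on pointwise through the heat kernel \<open>p\<close>. The time integral
  may be infinite.
\<close>

definition transient ::
  "'a::topological_space measure \<Rightarrow> (real \<Rightarrow> 'a \<Rightarrow> 'a \<Rightarrow> real) \<Rightarrow> bool" where
  "transient M p \<longleftrightarrow>
     (\<forall>f::'a \<Rightarrow> real. f \<in> borel_measurable borel \<and> (\<forall>x. 0 \<le> f x) \<and> bounded (range f)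
          \<and> compact (closure {x. f x \<noteq> 0}) \<longrightarrow>
        (\<exists>C::real. \<forall>x. (\<integral>\<^sup>+t\<in>{0<..}. ennreal (LINT y|M. p t x y * f y) \<partial>lborel) \<le> ennreal C))"

definition green :: "(real \<Rightarrow> 'a \<Rightarrow> 'a \<Rightarrow> real) \<Rightarrow> 'a \<Rightarrow> 'a \<Rightarrow> ennreal" where
  "green p x y = (\<integral>\<^sup>+t\<in>{0<..}. ennreal (p t x y) \<partial>lborel)"

end

theory Submission
  imports Defs "HOL-Probability.Infinite_Product_Measure" "HOL-Library.Function_Algebras"
begin

text \<open>
  The Taibleson operator is diagonalised by the wavelets \<open>1\<^sub>B / \<mu> B - 1\<^sub>B' / \<mu> B'\<close>, where \<open>B \<subseteq> B'\<close>
  are concentric balls of consecutive radii \<open>p\<^sup>k\<close> and \<open>p\<^sup>k\<^sup>+\<^sup>1\<close>: the Fourier transform of such a function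
  is supported on the sphere \<open>\<parallel>\<zeta>\<parallel> = p\<^sup>-\<^sup>k\<close>, so the eigenvalue is \<open>p\<^sup>-\<^sup>k\<^sup>\<alpha>\<close>. Hence the semigroup multiplies
  it by \<open>exp (- t p\<^sup>-\<^sup>k\<^sup>\<alpha>)\<close>, and since the wavelets span a dense subspace of $L^2$ this determines the
  semigroup.

  Let \<open>N s\<close> be the largest power of \<open>p\<close> with \<open>(N s)\<^sup>\<alpha> \<le> s\<close>. As \<open>exp (- t \<lambda>)\<close> is the integral of
  \<open>t exp (- t s)\<close> over \<open>s \<ge> \<lambda>\<close>, the heat kernel is the mixture, with weights \<open>t exp (- t s) ds\<close>, of the
  uniform densities on the balls of radius \<open>1 / N s\<close> around \<open>x\<close>. The two-sided estimate follows from
  \<open>N s \<le> s\<^sup>1\<^sup>/\<^sup>\<alpha> < p * N s\<close>, and integrating over \<open>t\<close> first gives the Green function as the integral of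
  \<open>(N s)\<^sup>n / s\<^sup>2\<close> over \<open>N s \<le> 1 / \<parallel>x - y\<parallel>\<close>, a geometric series.
\<close>

section \<open>Topology of the p-adic numbers\<close>

text \<open>Averaging over balls of radius \<open>1 / N s\<close> is the spectral projection of the
  operator for the interval [0, s]: the Fourier transform of the uniform density on the ball around
  0 is the indicator of the ball of radius \<open>N s\<close>, where the norm to the power \<alpha>
  is at most s. The mixture formula for the kernel is thus the spectral formula for the semigroup.

  The semigroup is known only abstractly, through the contraction axioms and its generator. What can
  be computed is its action on wavelets. Passing to all of L2 combines two kinds of continuity:
  \<open>P t\<close> is a contraction defined up to null sets, while the kernel integral is
  continuous at each point. The functions on which both agree form a closed subspace. It contains
  ball densities because they are telescoping sums of wavelets: the densities on growing balls tend
  to 0 in L2.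

  Haar measure is a definite description, so its values become available only after existence and
  uniqueness; independent random digits supply existence.

  The critical order is n because the kernel at a fixed pair of points decays like
  \<open>t powr (- n / \<alpha>)\<close>, which is integrable at infinity exactly for \<alpha> <
  n.\<close>

lemma padic_norm_inverse: "padic_norm (inverse x) = inverse (padic_norm (x::'p::prime_card padic))"
proof (cases "x = 0")
  case False
  hence "padic_norm x * padic_norm (inverse x) = 1"
    by (simp flip: padic_norm_mult)
  thus ?thesis by (metis inverse_unique)
qed simp

lemma padic_norm_divide: "padic_norm (x / y) = padic_norm x / padic_norm (y::'p::prime_card padic)"
  by (simp add: divide_inverse padic_norm_mult padic_norm_inverse)

lemma padic_norm_of_rat: "padic_norm (of_rat r :: 'p::prime_card padic) = rat_pabs CARD('p) r"
proof -
  obtain a b where r: "b > 0" "r = of_int a / of_int b" by (rule rat_cases_frac[OF prime_card[where ?'a = 'p]])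
  have "rat_pabs CARD('p) r * rat_pabs CARD('p) (of_int b) = rat_pabs CARD('p) (of_int a)"
    using r by (simp flip: rat_pabs_mult[OF prime_card])
  moreover have "rat_pabs CARD('p) (of_int b) \<noteq> 0"
    using r by (simp add: rat_pabs_eq_0_iff[OF prime_card])
  moreover have "(of_rat r :: 'p padic) = of_int a / of_int b"
    using r by (simp add: of_rat_divide)
  ultimately show ?thesis
    by (simp add: padic_norm_divide padic_norm_of_int field_simps)
qed

lemma of_rat_padic: "(of_rat r :: 'p::prime_card padic) = padic_of_seq (\<lambda>_. r)"
proof -
  obtain a b where r: "b > 0" "r = of_int a / of_int b" by (rule rat_cases_frac[OF prime_card[where ?'a = 'p]])
  have "padic_of_seq (\<lambda>_. r) * padic_of_seq (\<lambda>_. of_int b) = (padic_of_seq (\<lambda>_. r * of_int b) :: 'p padic)"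
    by (rule times_padic.abs_eq) (simp_all add: padic_rel_refl padic_cauchy_const prime_card)
  moreover have "r * of_int b = of_int a" using r by simp
  ultimately have "padic_of_seq (\<lambda>_. r) * (of_int b :: 'p padic) = of_int a"
    by (simp add: of_int_padic)
  moreover have "(of_int b :: 'p padic) \<noteq> 0" using r by simp
  ultimately have "padic_of_seq (\<lambda>_. r) = (of_int a / of_int b :: 'p padic)"
    by (simp add: field_simps)
  thus ?thesis using r by (simp add: of_rat_divide)
qed

lemma padic_rep_cauchy:
  obtains X where "padic_rel CARD('p) X X" "(x :: 'p::prime_card padic) = padic_of_seq X"
  using Quotient_rep_reflp[OF Quotient_padic, of x] Quotient_abs_rep[OF Quotient_padic, of x] by metis

text \<open>The norm of a class is the limit of the norms along a representing sequence, and
  non-strict bounds survive limits. This transfers estimates on rational tails to the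
  completion.\<close>

lemma padic_norm_seq_diff_le:
  assumes "padic_rel CARD('p) X X" "\<And>n. n \<ge> N \<Longrightarrow> rat_pabs CARD('p) (X n - r) \<le> e"
  shows "padic_norm (padic_of_seq X - of_rat r :: 'p::prime_card padic) \<le> e"
proof -
  have rr: "padic_rel CARD('p) (\<lambda>_. - r) (\<lambda>_. - r)"
    by (simp add: padic_rel_refl padic_cauchy_const prime_card)
  have "padic_of_seq X + padic_of_seq (\<lambda>_. - r) = (padic_of_seq (\<lambda>n. X n + - r) :: 'p padic)"
    by (rule plus_padic.abs_eq) (use assms rr in auto)
  hence e: "padic_of_seq X - of_rat r = (padic_of_seq (\<lambda>n. X n - r) :: 'p padic)"
  proof -
    have "padic_of_seq X - of_rat r = (padic_of_seq X + of_rat (- r) :: 'p padic)"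
      by (simp add: of_rat_minus)
    thus ?thesis
      using \<open>padic_of_seq X + padic_of_seq (\<lambda>_. - r) = padic_of_seq (\<lambda>n. X n + - r)\<close>
      by (simp only: of_rat_padic add_uminus_conv_diff)
  qed
  have rel: "padic_rel CARD('p) (\<lambda>n. X n - r) (\<lambda>n. X n - r)"
    using padic_rel_add[OF prime_card assms(1) rr] by simp
  have "padic_norm (padic_of_seq (\<lambda>n. X n - r) :: 'p padic) = lim (\<lambda>n. rat_pabs CARD('p) (X n - r))"
    by (rule padic_norm.abs_eq[OF rel])
  also have "\<dots> \<le> e"
    by (rule LIMSEQ_le_const2[OF padic_tendsto_lim[OF prime_card rel]]) (use assms(2) in auto)
  finally show ?thesis unfolding e .
qed

lemma padic_rat_dense:
  assumes "e > 0"
  obtains r where "padic_norm (x - of_rat r :: 'p::prime_card padic) < e"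
proof -
  obtain X where X: "padic_rel CARD('p) X X" "x = padic_of_seq X" by (rule padic_rep_cauchy)
  \<comment> \<open>Half of \<open>e\<close>, since the passage to the limit preserves only the
    non-strict inequality.\<close>
  obtain N where N: "\<And>m n. m \<ge> N \<Longrightarrow> n \<ge> N \<Longrightarrow> rat_pabs CARD('p) (X m - X n) < e / 2"
    using padic_cauchyD[OF prime_card padic_rel_cauchy[OF X(1)], of "e / 2"] assms by auto
  have "padic_norm (x - of_rat (X N)) \<le> e / 2"
    unfolding X(2) by (rule padic_norm_seq_diff_le[OF X(1), of N]) (use N in \<open>auto intro: less_imp_le\<close>)
  hence "padic_norm (x - of_rat (X N)) < e" using assms by linarith
  thus ?thesis by (rule that)
qed

lemma padic_norm_minus_commute: "padic_norm (x - y) = padic_norm (y - x :: 'p::prime_card padic)"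
  using padic_norm_minus[of "x - y"] by simp

lemma padic_norm_ultrametric_diff:
  "padic_norm (x - y) \<le> max (padic_norm x) (padic_norm (y::'p::prime_card padic))"
  using padic_norm_ultrametric[of x "- y"] by simp

lemma padic_card_gt1: "real CARD('p::prime_card) > 1"
  using prime_gt_1_nat[OF prime_card[where ?'a = 'p]] by simp

text \<open>A rational closer to \<open>x\<close> than \<open>padic_norm x\<close> has the same norm
  by the ultrametric inequality, and norms of nonzero rationals are powers of p by
  definition.\<close>

lemma padic_norm_value:
  assumes "x \<noteq> (0::'p::prime_card padic)"
  obtains k where "padic_norm x = real CARD('p) powi k"
proof -
  have pos: "padic_norm x > 0" using assms by (simp add: less_le)
  obtain r where r: "padic_norm (x - of_rat r) < padic_norm x" using padic_rat_dense[OF pos] by blast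
  have "padic_norm (of_rat r :: 'p padic) = padic_norm x"
    using padic_norm_ultrametric[of "x - of_rat r" "of_rat r"]
          padic_norm_ultrametric_diff[of x "x - of_rat r"] r by simp
  moreover from this pos have "r \<noteq> 0" by auto
  ultimately show ?thesis using that by (simp add: padic_norm_of_rat rat_pabs_def) metis
qed

text \<open>Diagonal argument: the n-th term is replaced by a rational within 1 / (n + 1). The
  rationals form a Cauchy sequence for the p-adic absolute value, and its class is the
  limit.\<close>

instance padic :: (prime_card) complete_space
proof
  fix X :: "nat \<Rightarrow> 'a padic" assume X: "Cauchy X"
  have "\<exists>r. padic_norm (X n - of_rat r) < 1 / Suc n" for n
    by (rule padic_rat_dense[of "1 / Suc n" "X n"]) auto
  then obtain r where r: "\<And>n. padic_norm (X n - of_rat (r n)) < 1 / Suc n" by metis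
  have small: "\<exists>N. \<forall>n\<ge>N. padic_norm (X n - of_rat (r n)) < e" if "e > 0" for e
  proof -
    obtain N where "1 / Suc N < e" by (rule nat_approx_posE[OF \<open>e > 0\<close>])
    moreover have "1 / Suc n \<le> 1 / Suc N" if "n \<ge> N" for n using that by (simp add: field_simps)
    ultimately show ?thesis using r by (meson less_le_trans less_trans)
  qed
  have c: "padic_cauchy CARD('a) r"
    unfolding padic_cauchy_def
  proof (intro allI impI)
    fix e :: real assume e: "e > 0"
    obtain M where M: "\<And>m n. m \<ge> M \<Longrightarrow> n \<ge> M \<Longrightarrow> padic_norm (X m - X n) < e"
      using metric_CauchyD[OF X e] by (auto simp: dist_padic_def)
    obtain N where N: "\<And>n. n \<ge> N \<Longrightarrow> padic_norm (X n - of_rat (r n)) < e"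
      using small[OF e] by blast
    have "rat_pabs CARD('a) (r m - r n) < e" if "m \<ge> max M N" "n \<ge> max M N" for m n
    proof -
      have "of_rat (r m - r n) = (X n - of_rat (r n)) - (X m - of_rat (r m)) + (X m - X n)"
        by (simp add: of_rat_diff)
      hence "padic_norm (of_rat (r m - r n) :: 'a padic)
          \<le> max (padic_norm ((X n - of_rat (r n)) - (X m - of_rat (r m)))) (padic_norm (X m - X n))"
        using padic_norm_ultrametric by metis
      also have "\<dots> \<le> max (max (padic_norm (X n - of_rat (r n))) (padic_norm (X m - of_rat (r m)))) (padic_norm (X m - X n))"
        by (intro max.mono padic_norm_ultrametric_diff order_refl)
      finally show ?thesis using M[of m n] N[of n] N[of m] that by (simp add: padic_norm_of_rat)
    qed
    thus "\<exists>N. \<forall>m\<ge>N. \<forall>n\<ge>N. rat_pabs CARD('a) (r m - r n) < e" by blast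
  qed
  define x where "x = (padic_of_seq r :: 'a padic)"
  have "X \<longlonglongrightarrow> x"
  proof (rule metric_LIMSEQ_I)
    fix e :: real assume e: "e > 0"
    obtain M where M: "\<And>m n. m \<ge> M \<Longrightarrow> n \<ge> M \<Longrightarrow> rat_pabs CARD('a) (r m - r n) < e / 2"
      using padic_cauchyD[OF prime_card c, of "e / 2"] e by auto
    obtain N where N: "\<And>n. n \<ge> N \<Longrightarrow> padic_norm (X n - of_rat (r n)) < e"
      using small[OF e] by blast
    have "dist (X n) x < e" if n: "n \<ge> max M N" for n
    proof -
      have "padic_norm (x - of_rat (r n)) \<le> e / 2"
        unfolding x_def
        by (rule padic_norm_seq_diff_le[OF padic_rel_refl[OF prime_card c], of M])
           (use M n in \<open>auto intro: less_imp_le\<close>)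
      thus ?thesis
        using padic_norm_ultrametric_diff[of "X n - of_rat (r n)" "x - of_rat (r n)"] N[of n] n e
        by (auto simp: dist_padic_def)
    qed
    thus "\<exists>no. \<forall>n\<ge>no. dist (X n) x < e" by blast
  qed
  thus "convergent X" by (auto simp: convergent_def)
qed

instance padic :: (prime_card) second_countable_topology
proof
  let ?B = "(\<lambda>(r, m). ball (of_rat r :: 'a padic) (1 / Suc m)) ` (UNIV \<times> UNIV)"
  have "topological_basis ?B"
  proof (rule topological_basisI)
    fix U and x :: "'a padic" assume "open U" "x \<in> U"
    then obtain e where e: "e > 0" "ball x e \<subseteq> U" by (meson open_contains_ball)
    obtain m where m: "1 / Suc m < e / 2" using e nat_approx_posE[of "e / 2"] by auto
    obtain r where r: "padic_norm (x - of_rat r) < 1 / Suc m" using padic_rat_dense[of "1 / Suc m" x] by auto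
    have "x \<in> ball (of_rat r) (1 / Suc m)"
      using r by (simp add: dist_padic_def padic_norm_minus_commute)
    moreover have "ball (of_rat r) (1 / Suc m) \<subseteq> ball x e"
    proof
      fix y :: "'a padic" assume "y \<in> ball (of_rat r) (1 / Suc m)"
      hence "dist x y < 1 / Suc m + 1 / Suc m"
        using r by (intro dist_triangle_lt[of _ "of_rat r"] add_strict_mono)
                   (simp_all add: dist_commute flip: dist_padic_def)
      thus "y \<in> ball x e" using m by simp
    qed
    ultimately show "\<exists>B'\<in>?B. x \<in> B' \<and> B' \<subseteq> U" using e by blast
  qed auto
  moreover have "countable ?B" by auto
  ultimately show "\<exists>B::'a padic set set. countable B \<and> open = generate_topology B"
    using topological_basis_imp_subbasis by blast
qed

text \<open>A rational a / b near \<open>x\<close> in lowest terms has p not dividing b, so b is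
  invertible modulo p^k, and a times the inverse, reduced modulo p^k, is the required integer.
  Compactness, fractional parts, digits and the splitting of balls all rest on this.\<close>

lemma padic_int_approx:
  assumes "padic_norm (x :: 'p::prime_card padic) \<le> 1"
  obtains c :: nat where "c < CARD('p) ^ k" "padic_norm (x - of_nat c) \<le> real CARD('p) powi (- int k)"
proof -
  define p where "p = CARD('p)"
  have pr: "prime p" unfolding p_def by (rule prime_card)
  have p1: "real p > 1" using padic_card_gt1[where 'p='p] by (simp add: p_def)
  have pp: "real p powi (- int k) > 0" using p1 by simp
  obtain r where r: "padic_norm (x - of_rat r) < real p powi (- int k)" using padic_rat_dense[OF pp] .
  have pk1: "real p powi (- int k) \<le> 1" using p1 by (simp add: power_int_minus field_simps)
  have r1: "rat_pabs p r \<le> 1"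
    using padic_norm_ultrametric_diff[of x "x - of_rat r"] r assms pk1
    by (simp add: padic_norm_of_rat p_def)
  obtain a b where q: "quotient_of r = (a, b)" by fastforce
  have b: "b > 0" using quotient_of_denom_pos[OF q] .
  have e: "r = of_int a / of_int b" using quotient_of_div[OF q] .
  have cop: "coprime a b" using quotient_of_coprime[OF q] .
  have nb: "\<not> int p dvd b"
  proof
    assume d: "int p dvd b"
    hence "\<not> int p dvd a" using cop pr by (metis coprime_common_divisor not_prime_unit prime_nat_int_transfer)
    hence a0: "a \<noteq> 0" and ma: "multiplicity (int p) a = 0" by (auto simp: not_dvd_imp_multiplicity_0)
    have mb: "multiplicity (int p) b \<ge> 1"
      using d b pr by (intro multiplicity_geI) auto
    have "real p ^ multiplicity (int p) b \<le> 1"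
      using r1 rat_pabs_frac[OF pr a0, of b] b ma e by simp
    moreover have "real p ^ 1 \<le> real p ^ (multiplicity (int p) b)"
      using mb p1 by (intro power_increasing) auto
    ultimately show False using p1 unfolding power_one_right by linarith
  qed
  have copb: "coprime b (int p ^ k)"
    using nb pr by (metis coprime_commute coprime_power_left_iff prime_imp_coprime prime_nat_int_transfer)
  obtain u where u: "[b * u = 1] (mod int p ^ k)" using cong_solve_coprime_int[OF copb] by auto
  define c where "c = nat ((a * u) mod int p ^ k)"
  have pk: "int p ^ k > 0" using p1 by auto
  have ci: "int c = (a * u) mod int p ^ k" using pk by (simp add: c_def)
  have "c < p ^ k"
  proof -
    have "int c < int p ^ k" unfolding ci using pk by simp
    thus ?thesis by (metis of_nat_less_iff of_nat_power)
  qed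
  have "[b * int c = a] (mod int p ^ k)"
  proof -
    have "[b * int c = b * (a * u)] (mod int p ^ k)" unfolding ci by (intro cong_mult) (auto simp: cong_def)
    also have "b * (a * u) = a * (b * u)" by simp
    also have "[a * (b * u) = a * 1] (mod int p ^ k)" by (intro cong_mult u) auto
    finally show ?thesis by simp
  qed
  hence dv: "int p ^ k dvd a - b * int c" by (metis cong_iff_dvd_diff cong_sym)
  have "r - of_nat c = of_int (a - b * int c) / of_int b" using b by (simp add: e field_simps)
  moreover have nb1: "rat_pabs p (of_int b) = 1"
    using nb b by (subst rat_pabs_of_int[OF pr]) (auto simp: not_dvd_imp_multiplicity_0)
  ultimately have "rat_pabs p (r - of_nat c) = rat_pabs p (of_int (a - b * int c))"
    using rat_pabs_mult[OF pr, of "r - of_nat c" "of_int b"] b by simp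
  also have "\<dots> \<le> real p powi (- int k)" by (rule rat_pabs_of_int_le[OF pr dv])
  finally have "padic_norm (of_rat r - of_nat c :: 'p padic) \<le> real p powi (- int k)"
    using padic_norm_of_rat[of "r - of_nat c", where 'p='p] by (simp add: of_rat_diff p_def)
  hence "padic_norm (x - of_nat c) \<le> real p powi (- int k)"
    using padic_norm_ultrametric[of "x - of_rat r" "of_rat r - of_nat c"] r by simp
  thus ?thesis using that \<open>c < p ^ k\<close> unfolding p_def by blast
qed

text \<open>A closed subset of a complete space is complete, and the p^k residues of
  \<open>padic_int_approx\<close> are finite nets.\<close>

lemma padic_int_unit_ball_compact: "compact {x :: 'p::prime_card padic. padic_norm x \<le> 1}"
  unfolding compact_eq_totally_bounded
proof (intro conjI allI impI)
  have "{x :: 'p padic. padic_norm x \<le> 1} = cball 0 1" by (auto simp: dist_padic_def)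
  thus "complete {x :: 'p padic. padic_norm x \<le> 1}"
    by (simp add: complete_eq_closed)
  fix e :: real assume e: "e > 0"
  have "\<exists>k. inverse (real CARD('p)) ^ k < e"
    using padic_card_gt1[where 'p='p] e by (intro real_arch_pow_inv) (auto simp: inverse_less_1_iff)
  then obtain k where k: "inverse (real CARD('p)) ^ k < e" ..
  have "{x :: 'p padic. padic_norm x \<le> 1} \<subseteq> (\<Union>c\<in>of_nat ` {..<CARD('p) ^ k}. ball c e)"
  proof
    fix x :: "'p padic" assume "x \<in> {x. padic_norm x \<le> 1}"
    then obtain c where "c < CARD('p) ^ k" "padic_norm (x - of_nat c) \<le> real CARD('p) powi (- int k)"
      using padic_int_approx by blast
    thus "x \<in> (\<Union>c\<in>of_nat ` {..<CARD('p) ^ k}. ball c e)"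
      using k by (auto simp: dist_padic_def padic_norm_minus_commute power_int_minus power_inverse intro!: bexI[of _ c])
  qed
  thus "\<exists>k. finite k \<and> {x :: 'p padic. padic_norm x \<le> 1} \<subseteq> (\<Union>x\<in>k. ball x e)"
    by (intro exI[of _ "of_nat ` {..<CARD('p) ^ k}"]) auto
qed


section \<open>Ultrametric norms\<close>

text \<open>Common ground of the field and of the vector space over it. The condition
  \<open>open_iff\<close> ties the norm to a topology that is given independently, for vectors the
  product topology. Since nonzero norms are powers of \<open>b\<close>, balls are indexed by integer
  exponents.\<close>

locale ultranorm =
  fixes N :: "'a::{second_countable_topology, ab_group_add} \<Rightarrow> real" and b :: real
  assumes b_gt1: "b > 1"
    and N_ultra: "N (x + y) \<le> max (N x) (N y)"
    and N_minus: "N (- x) = N x"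
    and N_zero: "N 0 = 0"
    and N_value: "x \<noteq> 0 \<Longrightarrow> \<exists>k::int. N x = b powi k"
    and open_iff: "open U \<longleftrightarrow> (\<forall>x\<in>U. \<exists>k::int. \<forall>y. N (y - x) \<le> b powi k \<longrightarrow> y \<in> U)"
begin

definition uball :: "'a \<Rightarrow> int \<Rightarrow> 'a set" where
  "uball c k = {x. N (x - c) \<le> b powi k}"

lemma powi_pos [simp]: "b powi k > 0"
  using b_gt1 by simp

lemma powi_nonneg [simp]: "b powi k \<ge> 0"
  using b_gt1 by simp

lemma powi_le_iff: "b powi k \<le> b powi l \<longleftrightarrow> k \<le> l"
  using b_gt1 by (metis nle_le power_int_strict_increasing power_int_increasing less_imp_le linorder_not_less)

lemma N_nonneg: "N x \<ge> 0"
  using N_value[of x] N_zero by (cases "x = 0") auto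

lemma N_diff_ultra: "N (x - y) \<le> max (N x) (N y)"
  using N_ultra[of x "- y"] N_minus by simp

lemma N_commute: "N (x - y) = N (y - x)"
  using N_minus[of "x - y"] by simp

text \<open>Ultrametric triangles are isosceles. Hence the norm is locally constant away from
  0.\<close>

lemma N_eq_of_close:
  assumes "N (x - y) < N y"
  shows "N x = N y"
  using N_ultra[of "x - y" y] N_diff_ultra[of x "x - y"] assms by simp

text \<open>The value group is discrete: no norm lies strictly between consecutive powers of
  \<open>b\<close>.\<close>

lemma N_less_iff: "N x < b powi (k + 1) \<longleftrightarrow> N x \<le> b powi k"
proof (cases "x = 0")
  case False
  then obtain l where "N x = b powi l" using N_value by blast
  thus ?thesis using powi_le_iff[of l k] powi_le_iff[of "k + 1" l] by (auto simp: not_le[symmetric])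
qed (simp add: N_zero)

lemma mem_uball: "x \<in> uball c k \<longleftrightarrow> N (x - c) \<le> b powi k"
  by (simp add: uball_def)

lemma centre_in_uball [simp]: "c \<in> uball c k"
  by (simp add: mem_uball N_zero)

lemma uball_mono: "k \<le> l \<Longrightarrow> uball c k \<subseteq> uball c l"
  using powi_le_iff[of k l] by (auto simp: mem_uball)

lemma uball_subset:
  assumes "x \<in> uball c k"
  shows "uball c k \<subseteq> uball x k"
proof
  fix y assume "y \<in> uball c k"
  thus "y \<in> uball x k"
    using assms N_diff_ultra[of "y - c" "x - c"] by (simp add: mem_uball)
qed

lemma uball_commute: "x \<in> uball c k \<longleftrightarrow> c \<in> uball x k"
  by (simp add: mem_uball N_commute)

lemma uball_eq: "x \<in> uball c k \<Longrightarrow> uball x k = uball c k"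
  using uball_subset uball_commute by blast

lemma uball_nested:
  assumes "k \<le> l"
  shows "uball c k \<inter> uball d l = {} \<or> uball c k \<subseteq> uball d l"
proof (cases "uball c k \<inter> uball d l = {}")
  case False
  then obtain x where "x \<in> uball c k" "x \<in> uball d l" by blast
  thus ?thesis using uball_eq uball_mono[OF assms] by metis
qed simp

lemma uball_Int: "uball c k \<inter> uball d l \<in> {{}, uball c k, uball d l}"
  using uball_nested[of k l c d] uball_nested[of l k d c] by (cases "k \<le> l") auto

lemma open_uball: "open (uball c k)"
  unfolding open_iff using uball_eq by (metis mem_uball)

lemma closed_uball: "closed (uball c k)"
  unfolding closed_def open_iff
proof
  fix x assume x: "x \<in> - uball c k"
  have "uball x k \<inter> uball c k = {}"
    using x uball_eq[of _ x k] uball_eq[of _ c k] by (metis ComplD centre_in_uball disjoint_iff)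
  thus "\<exists>l. \<forall>y. N (y - x) \<le> b powi l \<longrightarrow> y \<in> - uball c k"
    by (intro exI[of _ k]) (auto simp: mem_uball[symmetric])
qed

lemma uball_in_borel [measurable]: "uball c k \<in> sets borel"
  using open_uball by simp

lemma countable_cover:
  obtains C where "countable C" "(\<Union>c\<in>C. uball c k) = UNIV"
proof -
  obtain F where F: "F \<subseteq> range (\<lambda>c. uball c k)" "countable F" "\<Union>F = \<Union>(range (\<lambda>c. uball c k))"
    by (rule Lindelof[of "range (\<lambda>c. uball c k)"]) (use open_uball in blast, rule that)
  obtain C where C: "countable C" "F = (\<lambda>c. uball c k) ` C"
    using F(1,2) by (metis countable_subset_image)
  have "x \<in> \<Union>(range (\<lambda>c. uball c k))" for x using centre_in_uball[of x k] by blast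
  hence "(\<Union>c\<in>C. uball c k) = UNIV" using F(3) unfolding C(2) by auto
  thus ?thesis using that C(1) by blast
qed

text \<open>Radii are capped at 1 so that a measure has to be compared only on small balls. A ball
  of radius at most 1 lies in a single coset of the unit ball, which makes the constructed Haar
  measure easy to evaluate there. The empty set is added for stability under intersection.\<close>

definition balls :: "'a set set" where
  "balls = insert {} {uball c k |c k. k \<le> 0}"

lemma Int_stable_balls: "Int_stable balls"
proof (rule Int_stableI)
  fix A B assume A: "A \<in> balls" and B: "B \<in> balls"
  show "A \<inter> B \<in> balls"
  proof (cases "A = {} \<or> B = {}")
    case False
    then obtain c k d l where "A = uball c k" "B = uball d l" "k \<le> 0" "l \<le> 0"
      using A B by (auto simp: balls_def)
    thus ?thesis using uball_Int[of c k d l] A B by (auto simp: balls_def)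
  qed (auto simp: balls_def)
qed

lemma small_uball:
  assumes "open U" "x \<in> U"
  obtains k where "k \<le> 0" "uball x k \<subseteq> U"
proof -
  obtain k where "\<forall>y. N (y - x) \<le> b powi k \<longrightarrow> y \<in> U" using assms open_iff[of U] by blast
  hence "uball x k \<subseteq> U" by (auto simp: mem_uball)
  hence "uball x (min k 0) \<subseteq> U" using uball_mono[of "min k 0" k x] by auto
  thus ?thesis using that[of "min k 0"] by simp
qed

lemma sets_borel_balls: "sets (borel :: 'a measure) = sigma_sets UNIV balls"
proof
  show "sigma_sets UNIV balls \<subseteq> sets (borel :: 'a measure)"
  proof -
    have "balls \<subseteq> sets (borel :: 'a measure)" using uball_in_borel by (auto simp: balls_def)
    thus ?thesis using sets.sigma_sets_subset[of balls "borel :: 'a measure"] by simp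
  qed
  have "open U \<Longrightarrow> U \<in> sigma_sets UNIV balls" for U
  proof -
    assume U: "open U"
    let ?F = "{B \<in> balls. B \<subseteq> U}"
    obtain F where F: "F \<subseteq> ?F" "countable F" "\<Union>F = \<Union>?F"
      by (rule Lindelof[of ?F]) (use open_uball in \<open>force simp: balls_def\<close>, rule that)
    have "\<Union>?F = U"
    proof
      show "U \<subseteq> \<Union>?F"
      proof
        fix x assume "x \<in> U"
        then obtain k where k: "k \<le> 0" "uball x k \<subseteq> U" using U small_uball by blast
        hence "uball x k \<in> ?F" by (auto simp: balls_def)
        thus "x \<in> \<Union>?F" by (intro UnionI[of "uball x k"]) auto
      qed
    qed auto
    hence "U = \<Union>F" using F by simp
    moreover have "\<Union>F \<in> sigma_sets UNIV balls"
      using F by (intro sigma_sets_UNION) auto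
    ultimately show ?thesis by simp
  qed
  thus "sets (borel :: 'a measure) \<subseteq> sigma_sets UNIV balls"
    unfolding borel_def by (subst sets_measure_of, simp, intro sigma_sets_mono) auto
qed

text \<open>Ultrametric balls are nested or disjoint, hence an intersection-stable generator of the
  Borel sets, and countably many unit balls of finite measure exhaust the space.\<close>

lemma measure_eq_balls:
  assumes "sets M = sets borel" "sets M' = sets borel"
    and eq: "\<And>c k. k \<le> 0 \<Longrightarrow> emeasure M (uball c k) = emeasure M' (uball c k)"
    and fin: "\<And>c. emeasure M (uball c 0) \<noteq> \<infinity>"
  shows "M = M'"
proof -
  obtain C where C: "countable C" "(\<Union>c\<in>C. uball c 0) = UNIV" by (rule countable_cover)
  show ?thesis
  proof (rule measure_eqI_generator_eq_countable[OF Int_stable_balls])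
    show "(\<lambda>c. uball c 0) ` C \<subseteq> balls" by (auto simp: balls_def)
    show "\<Union>((\<lambda>c. uball c 0) ` C) = UNIV" using C by simp
    show "emeasure M X = emeasure M' X" if "X \<in> balls" for X
      using that eq by (auto simp: balls_def)
  qed (use C assms sets_borel_balls in auto)
qed

lemma continuous_translate: "continuous_on UNIV (\<lambda>x::'a. x + a)"
  unfolding continuous_on_open_vimage[OF open_UNIV]
proof (intro allI impI)
  fix U :: "'a set" assume "open U"
  show "open ((\<lambda>x. x + a) -` U \<inter> UNIV)"
    unfolding open_iff
  proof
    fix x assume "x \<in> (\<lambda>x. x + a) -` U \<inter> UNIV"
    then obtain k where "\<forall>y. N (y - (x + a)) \<le> b powi k \<longrightarrow> y \<in> U"
      using \<open>open U\<close> open_iff[of U] by auto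
    hence "N (y - x) \<le> b powi k \<longrightarrow> y + a \<in> U" for y
      by (metis add_diff_cancel_right)
    thus "\<exists>k. \<forall>y. N (y - x) \<le> b powi k \<longrightarrow> y \<in> (\<lambda>x. x + a) -` U \<inter> UNIV" by auto
  qed
qed

lemma measurable_translate [measurable]: "(\<lambda>x::'a. x + a) \<in> borel_measurable borel"
  by (intro borel_measurable_continuous_onI continuous_translate)

lemma vimage_translate_uball: "(\<lambda>x. x + a) -` uball c k = uball (c - a) k"
  by (auto simp: mem_uball algebra_simps)

end

lemma powi_small:
  assumes "b > (1::real)" "e > 0"
  obtains k :: int where "b powi k < e"
proof -
  have "\<exists>k. inverse b ^ k < e"
    using assms by (intro real_arch_pow_inv) (auto simp: inverse_less_1_iff)
  then obtain k where "inverse b ^ k < e" ..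
  thus ?thesis using that[of "- int k"] by (simp add: power_int_minus power_inverse)
qed

interpretation padic: ultranorm "padic_norm :: 'p::prime_card padic \<Rightarrow> real" "real CARD('p)"
proof
  show "real CARD('p) > 1" by (rule padic_card_gt1)
  show "padic_norm (x + y) \<le> max (padic_norm x) (padic_norm y)" for x y :: "'p padic"
    by (rule padic_norm_ultrametric)
  show "\<exists>k. padic_norm x = real CARD('p) powi k" if "x \<noteq> 0" for x :: "'p padic"
    using padic_norm_value[OF that] by blast
  fix U :: "'p padic set"
  have "(\<exists>e>0. \<forall>y. padic_norm (y - x) < e \<longrightarrow> y \<in> U)
        \<longleftrightarrow> (\<exists>k::int. \<forall>y. padic_norm (y - x) \<le> real CARD('p) powi k \<longrightarrow> y \<in> U)" for x
  proof
    assume "\<exists>e>0. \<forall>y. padic_norm (y - x) < e \<longrightarrow> y \<in> U"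
    then obtain e where "e > 0" "\<forall>y. padic_norm (y - x) < e \<longrightarrow> y \<in> U" by blast
    moreover from this obtain k where "real CARD('p) powi k < e"
      using powi_small[OF padic_card_gt1] by blast
    ultimately show "\<exists>k::int. \<forall>y. padic_norm (y - x) \<le> real CARD('p) powi k \<longrightarrow> y \<in> U"
      by (meson le_less_trans)
  next
    assume "\<exists>k::int. \<forall>y. padic_norm (y - x) \<le> real CARD('p) powi k \<longrightarrow> y \<in> U"
    then obtain k :: int where "\<forall>y. padic_norm (y - x) \<le> real CARD('p) powi k \<longrightarrow> y \<in> U" by blast
    thus "\<exists>e>0. \<forall>y. padic_norm (y - x) < e \<longrightarrow> y \<in> U"
      using padic_card_gt1[where 'p='p] by (intro exI[of _ "real CARD('p) powi k"]) auto
  qed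
  thus "open U \<longleftrightarrow> (\<forall>x\<in>U. \<exists>k::int. \<forall>y. padic_norm (y - x) \<le> real CARD('p) powi k \<longrightarrow> y \<in> U)"
    by (simp add: open_dist dist_padic_def)
qed auto

section \<open>The maximum norm and the product topology\<close>

lemma vnorm_le_iff: "vnorm z \<le> r \<longleftrightarrow> (\<forall>i. padic_norm (z i) \<le> r)"
  by (simp add: vnorm_def)

lemma vnorm_attained: obtains i where "vnorm z = padic_norm (z i)"
proof -
  have "vnorm z \<in> range (\<lambda>i. padic_norm (z i))"
    unfolding vnorm_def by (intro Max_in) auto
  thus ?thesis using that by blast
qed

lemma padic_norm_le_vnorm: "padic_norm (z i) \<le> vnorm z"
  using vnorm_le_iff by blast

interpretation vec: ultranorm "vnorm :: ('n::finite \<Rightarrow> 'p::prime_card padic) \<Rightarrow> real" "real CARD('p)"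
proof
  show "real CARD('p) > 1" by (rule padic_card_gt1)
  show "vnorm (x + y) \<le> max (vnorm x) (vnorm y)" for x y :: "'n \<Rightarrow> 'p padic"
    unfolding vnorm_le_iff plus_fun_apply
    by (intro allI order_trans[OF padic_norm_ultrametric] max.mono padic_norm_le_vnorm)
  show "vnorm (- x) = vnorm x" for x :: "'n \<Rightarrow> 'p padic"
    by (simp add: vnorm_def)
  show "vnorm (0 :: 'n \<Rightarrow> 'p padic) = 0"
    by (simp add: vnorm_def)
  show "\<exists>k. vnorm x = real CARD('p) powi k" if "x \<noteq> 0" for x :: "'n \<Rightarrow> 'p padic"
  proof -
    obtain i where i: "vnorm x = padic_norm (x i)" by (rule vnorm_attained)
    obtain j where "x j \<noteq> 0" using \<open>x \<noteq> 0\<close> by (auto simp: fun_eq_iff)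
    hence "padic_norm (x i) \<noteq> 0"
      using padic_norm_le_vnorm[of x j] i by (metis antisym padic_norm_eq_0_iff padic_norm_nonneg)
    thus ?thesis unfolding i using padic_norm_value[of "x i"] by auto
  qed
  fix U :: "('n \<Rightarrow> 'p padic) set"
  have ball: "{y. vnorm (y - x) \<le> real CARD('p) powi k} = (\<Pi>\<^sub>E i\<in>UNIV. padic.uball (x i) k)"
    for x :: "'n \<Rightarrow> 'p padic" and k
    by (auto simp: vnorm_le_iff PiE_def padic.mem_uball Pi_iff)
  show "open U \<longleftrightarrow> (\<forall>x\<in>U. \<exists>k::int. \<forall>y. vnorm (y - x) \<le> real CARD('p) powi k \<longrightarrow> y \<in> U)"
  proof (intro iffI ballI)
    fix x assume "open U" "x \<in> U"
    hence "openin (product_topology (\<lambda>i. euclidean) UNIV) U" by (simp add: open_fun_def)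
    from product_topology_open_contains_basis[OF this \<open>x \<in> U\<close>]
    obtain X where X: "x \<in> (\<Pi>\<^sub>E i\<in>UNIV. X i)" "\<And>i. open (X i)" "(\<Pi>\<^sub>E i\<in>UNIV. X i) \<subseteq> U"
      by (auto simp flip: open_openin)
    have "\<exists>k. padic.uball (x i) k \<subseteq> X i" for i
      using padic.small_uball[OF X(2), of "x i" i] X(1) by (metis PiE_mem UNIV_I)
    then obtain k where k: "\<And>i. padic.uball (x i) (k i) \<subseteq> X i" by metis
    \<comment> \<open>The least exponent over the finitely many coordinates gives one radius that
      fits inside the whole box.\<close>
    define l where "l = Min (range k)"
    have "l \<le> k i" for i by (simp add: l_def)
    hence "(\<Pi>\<^sub>E i\<in>UNIV. padic.uball (x i) l) \<subseteq> (\<Pi>\<^sub>E i\<in>UNIV. X i)"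
      using k padic.uball_mono by (intro PiE_mono) blast
    hence "{y. vnorm (y - x) \<le> real CARD('p) powi l} \<subseteq> U"
      using X(3) unfolding ball[of x l] by (rule order_trans)
    thus "\<exists>k::int. \<forall>y. vnorm (y - x) \<le> real CARD('p) powi k \<longrightarrow> y \<in> U"
      by (intro exI[of _ l]) auto
  next
    assume *: "\<forall>x\<in>U. \<exists>k::int. \<forall>y. vnorm (y - x) \<le> real CARD('p) powi k \<longrightarrow> y \<in> U"
    show "open U"
    proof (subst open_subopen, intro ballI)
      fix x assume "x \<in> U"
      then obtain k :: int where "\<forall>y. vnorm (y - x) \<le> real CARD('p) powi k \<longrightarrow> y \<in> U" using * by blast
      moreover have "open (\<Pi>\<^sub>E i\<in>UNIV. padic.uball (x i) k)"
        by (intro open_PiE padic.open_uball) auto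
      ultimately show "\<exists>T. open T \<and> x \<in> T \<and> T \<subseteq> U"
        using ball[of x k] by (intro exI[of _ "\<Pi>\<^sub>E i\<in>UNIV. padic.uball (x i) k"]) auto
    qed
  qed
qed

lemma vec_uball_eq_PiE: "vec.uball c k = (\<Pi>\<^sub>E i\<in>UNIV. padic.uball (c i) k)"
  by (auto simp: vnorm_le_iff PiE_def padic.mem_uball vec.mem_uball Pi_iff)


section \<open>Haar measure\<close>

abbreviation pball :: "'p::prime_card padic \<Rightarrow> int \<Rightarrow> 'p padic set" where "pball \<equiv> padic.uball"

lemma padic_norm_of_card: "padic_norm (of_nat CARD('p) :: 'p::prime_card padic) = 1 / real CARD('p)"
proof -
  have "multiplicity (int CARD('p)) (int CARD('p)) = 1"
    using pelem[OF prime_card[where ?'a='p]] by (intro multiplicity_self) auto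
  thus ?thesis
    using padic_norm_of_int[of "int CARD('p)", where 'p='p] rat_pabs_of_int[OF prime_card[where ?'a='p], of "int CARD('p)"]
      padic_card_gt1[where 'p='p] by (simp add: power_int_minus field_simps)
qed

lemma padic_norm_of_card_power:
  "padic_norm (of_nat CARD('p) ^ k :: 'p::prime_card padic) = real CARD('p) powi (- int k)"
proof -
  have "padic_norm (of_nat CARD('p) ^ k :: 'p padic) = (1 / real CARD('p)) ^ k"
    by (induction k) (simp_all add: padic_norm_mult padic_norm_of_card)
  thus ?thesis by (simp add: power_int_minus power_one_over inverse_eq_divide)
qed

lemma ex_padic_norm_powi: obtains u :: "'p::prime_card padic" where "padic_norm u = real CARD('p) powi k"
proof (cases "k \<ge> 0")
  case True
  then obtain n where "k = int n" using nonneg_int_cases by blast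
  thus ?thesis using that[of "inverse (of_nat CARD('p) ^ n)"]
    by (simp only: padic_norm_inverse padic_norm_of_card_power power_int_minus inverse_inverse_eq)
next
  case False
  then obtain n where "k = - int n" by (metis int_cases2 of_nat_0_le_iff)
  thus ?thesis using that[of "of_nat CARD('p) ^ n"] by (simp only: padic_norm_of_card_power)
qed

text \<open>For integers, p-adic closeness is congruence modulo a power of p; the digit computations
  below are carried out with divisibility.\<close>

lemma padic_norm_int_le_iff:
  "padic_norm (of_int a :: 'p::prime_card padic) \<le> real CARD('p) powi (- int k) \<longleftrightarrow> int CARD('p) ^ k dvd a"
proof (cases "a = 0")
  case False
  have "padic_norm (of_int a :: 'p padic) \<le> real CARD('p) powi (- int k) \<longleftrightarrow> k \<le> multiplicity (int CARD('p)) a"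
    unfolding padic_norm_of_int rat_pabs_of_int[OF prime_card False] padic.powi_le_iff by simp
  also have "\<dots> \<longleftrightarrow> int CARD('p) ^ k dvd a"
    using False pelem[OF prime_card[where ?'a='p]] by (intro power_dvd_iff_le_multiplicity[symmetric]) auto
  finally show ?thesis .
qed simp

lemma padic_norm_of_int_le_1: "padic_norm (of_int a :: 'p::prime_card padic) \<le> 1"
  using padic_norm_int_le_iff[of a 0, where 'p='p] by simp

section \<open>Fractional parts as representatives of the cosets of the p-adic integers\<close>

definition frac_reps :: "nat \<Rightarrow> rat set" where
  "frac_reps p = {r. 0 \<le> r \<and> r < 1 \<and> (\<exists>k. r * of_nat p ^ k \<in> \<int>)}"

text \<open>Writing \<open>r\<close> = m / p^k, the bound on the absolute value forces p^k to divide
  m. So p is the only prime the denominator could contain, and it is excluded.\<close>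

lemma Ints_of_rat_pabs_le_1:
  assumes "prime p" "r * of_nat p ^ k \<in> \<int>" "rat_pabs p r \<le> 1"
  shows "r \<in> \<int>"
proof (cases "r = 0")
  case False
  obtain m where m: "r * of_nat p ^ k = of_int m" using assms(2) Ints_cases by blast
  have p0: "p > 0" using assms(1) prime_gt_0_nat by blast
  have m0: "m \<noteq> 0" using m False p0 by auto
  have "rat_pabs p (of_int m) = rat_pabs p r * rat_pabs p (of_int (int p ^ k))"
    unfolding m[symmetric] rat_pabs_mult[OF assms(1)] by simp
  also have "\<dots> \<le> 1 * real p powi (- int k)"
    using assms(3) by (intro mult_mono rat_pabs_of_int_le[OF assms(1)]) (auto simp: rat_pabs_nonneg[OF assms(1)])
  finally have "real p powi (- int (multiplicity (int p) m)) \<le> real p powi (- int k)"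
    using rat_pabs_of_int[OF assms(1) m0] by simp
  hence "k \<le> multiplicity (int p) m"
    using p_gt1[OF assms(1)] power_int_strict_increasing[of "- int k" "- int (multiplicity (int p) m)" "real p"]
    by (cases "k \<le> multiplicity (int p) m") auto
  then obtain c where "m = int p ^ k * c" by (meson dvd_def multiplicity_dvd')
  hence "r = of_int c" using m p0 by (simp add: field_simps)
  thus ?thesis by simp
qed simp

lemma Ints_unit_interval_eq_0: "(r::rat) \<in> \<int> \<Longrightarrow> - 1 < r \<Longrightarrow> r < 1 \<Longrightarrow> r = 0"
  by (auto elim!: Ints_cases)

lemma denom_power_diff:
  assumes "r * of_nat p ^ k \<in> \<int>" "s * of_nat p ^ l \<in> (\<int> :: rat set)"
  shows "(r - s) * of_nat p ^ (k + l) \<in> \<int>"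
proof -
  have "(r - s) * of_nat p ^ (k + l) = (r * of_nat p ^ k) * of_nat p ^ l - (s * of_nat p ^ l) * of_nat p ^ k"
    by (simp add: algebra_simps power_add)
  also have "\<dots> \<in> \<int>"
    by (rule Ints_diff[OF Ints_mult[OF assms(1)] Ints_mult[OF assms(2)]]) auto
  finally show ?thesis .
qed

text \<open>For existence, \<open>x\<close> is scaled by p^k into the unit ball, approximated there
  by an integer c, and c / p^k is reduced modulo 1. For uniqueness, the difference of two candidates
  is an integer by \<open>Ints_of_rat_pabs_le_1\<close> and lies strictly between -1 and 1.\<close>

lemma frac_reps_ex1: "\<exists>!r. r \<in> frac_reps CARD('p) \<and> padic_norm (x - of_rat r :: 'p::prime_card padic) \<le> 1"
proof -
  define p where "p = CARD('p)"
  have pr: "prime p" unfolding p_def by (rule prime_card)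
  have p1: "real p > 1" using padic_card_gt1[where 'p='p] by (simp add: p_def)
  have "\<exists>r. r \<in> frac_reps p \<and> padic_norm (x - of_rat r) \<le> 1"
  proof -
    obtain k where k: "padic_norm x \<le> real p ^ k"
      using real_arch_pow[OF p1, of "padic_norm x"] by (auto intro: less_imp_le)
    have pk: "padic_norm (of_nat p ^ k :: 'p padic) = 1 / real p ^ k"
      unfolding p_def padic_norm_of_card_power by (simp add: power_int_minus field_simps)
    have "padic_norm (x * of_nat p ^ k) \<le> 1" using k p1 by (simp add: padic_norm_mult pk field_simps)
    then obtain c where c: "padic_norm (x * of_nat p ^ k - of_nat c) \<le> real p powi (- int k)"
      using padic_int_approx[of "x * of_nat p ^ k" k] unfolding p_def by blast
    define r where "r = (of_nat c / of_nat p ^ k :: rat)"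
    have nz: "(of_nat p ^ k :: 'p padic) \<noteq> 0" using p1 by auto
    have "padic_norm (x - of_rat r) * padic_norm (of_nat p ^ k :: 'p padic) = padic_norm (x * of_nat p ^ k - of_nat c)"
      unfolding padic_norm_mult[symmetric] using nz
      by (simp add: r_def of_rat_divide of_rat_power algebra_simps)
    hence 1: "padic_norm (x - of_rat r) \<le> 1"
      using c p1 by (simp add: pk power_int_minus field_simps)
    \<comment> \<open>Removing the floor moves the representative into [0, 1) and changes it by an
      integer, whose p-adic norm is at most 1.\<close>
    define s where "s = r - of_int \<lfloor>r\<rfloor>"
    have "x - of_rat s = (x - of_rat r) + of_int \<lfloor>r\<rfloor>" by (simp add: s_def of_rat_diff)
    hence "padic_norm (x - of_rat s) \<le> max (padic_norm (x - of_rat r)) (padic_norm (of_int \<lfloor>r\<rfloor> :: 'p padic))"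
      using padic_norm_ultrametric by metis
    hence "padic_norm (x - of_rat s) \<le> 1"
      using padic_norm_of_int_le_1[of "\<lfloor>r\<rfloor>", where 'p='p] 1 by simp
    moreover have "s * of_nat p ^ k \<in> \<int>"
    proof -
      have "s * of_nat p ^ k = of_nat c - of_int \<lfloor>r\<rfloor> * of_nat p ^ k"
        using p1 by (simp add: s_def r_def algebra_simps)
      also have "\<dots> \<in> \<int>" by (intro Ints_diff Ints_mult) auto
      finally show ?thesis .
    qed
    moreover have "0 \<le> s" "s < 1" unfolding s_def by linarith+
    ultimately show ?thesis by (intro exI[of _ s]) (auto simp: frac_reps_def)
  qed
  moreover have "r = s" if rs: "r \<in> frac_reps p" "padic_norm (x - of_rat r) \<le> 1"
    "s \<in> frac_reps p" "padic_norm (x - of_rat s) \<le> 1" for r s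
  proof -
    obtain k l where "r * of_nat p ^ k \<in> \<int>" "s * of_nat p ^ l \<in> \<int>"
      using rs(1,3) unfolding frac_reps_def by blast
    from denom_power_diff[OF this] have "(r - s) * of_nat p ^ (k + l) \<in> \<int>" .
    moreover have "of_rat (r - s) = (x - of_rat s) - (x - of_rat r)" by (simp add: of_rat_diff)
    hence "rat_pabs p (r - s) \<le> 1"
      using padic_norm_ultrametric_diff[of "x - of_rat s" "x - of_rat r"] that
        padic_norm_of_rat[of "r - s", where 'p='p] by (simp add: p_def)
    ultimately have "r - s \<in> \<int>" using Ints_of_rat_pabs_le_1[OF pr] by blast
    thus ?thesis using Ints_unit_interval_eq_0[of "r - s"] that by (auto simp: frac_reps_def)
  qed
  ultimately show ?thesis unfolding p_def by blast
qed

lemma padic_frac_props: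
  shows "padic_frac x \<in> frac_reps CARD('p)" "padic_norm (x - of_rat (padic_frac x) :: 'p::prime_card padic) \<le> 1"
proof -
  have "padic_frac x = (THE r. r \<in> frac_reps CARD('p) \<and> padic_norm (x - of_rat r) \<le> 1)"
    unfolding padic_frac_def frac_reps_def by (simp add: conj_assoc)
  thus "padic_frac x \<in> frac_reps CARD('p)" "padic_norm (x - of_rat (padic_frac x)) \<le> 1"
    using theI'[OF frac_reps_ex1[of x]] by auto
qed

section \<open>Random digit expansions of p-adic integers\<close>

definition digit_space :: "nat \<Rightarrow> (nat \<Rightarrow> nat) measure" where
  "digit_space p = (\<Pi>\<^sub>M i\<in>UNIV. uniform_count_measure {..<p})"

definition digit_sum :: "nat \<Rightarrow> (nat \<Rightarrow> nat) \<Rightarrow> nat \<Rightarrow> nat" where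
  "digit_sum p d m = (\<Sum>i<m. d i * p ^ i)"

definition padic_of_digits :: "(nat \<Rightarrow> nat) \<Rightarrow> 'p::prime_card padic" where
  "padic_of_digits d = lim (\<lambda>m. of_nat (digit_sum CARD('p) d m))"

lemma digit_sum_cong_add: "\<exists>c. digit_sum p d (m + n) = digit_sum p d m + p ^ m * c"
proof (induction n)
  case (Suc n)
  then obtain c where "digit_sum p d (m + n) = digit_sum p d m + p ^ m * c" ..
  hence "digit_sum p d (m + Suc n) = digit_sum p d m + p ^ m * (c + d (m + n) * p ^ n)"
    by (simp add: digit_sum_def power_add algebra_simps)
  thus ?case ..
qed auto

lemma digit_sum_less:
  assumes "\<And>i. d i < p"
  shows "digit_sum p d m < p ^ m"
proof (induction m)
  case (Suc m)
  have "digit_sum p d (Suc m) < p ^ m + d m * p ^ m" using Suc by (simp add: digit_sum_def)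
  also have "\<dots> = Suc (d m) * p ^ m" by simp
  also have "\<dots> \<le> p * p ^ m" using assms[of m] by (intro mult_right_mono) auto
  finally show ?case by simp
qed (simp add: digit_sum_def)

text \<open>Reduction modulo p^m strips the top digit, so equality of the sums can be peeled off
  digit by digit.\<close>

lemma digit_sum_eq_iff:
  assumes "\<And>i. d i < p" "\<And>i. e i < p"
  shows "digit_sum p d m = digit_sum p e m \<longleftrightarrow> (\<forall>i<m. d i = e i)"
proof (induction m)
  case (Suc m)
  have "digit_sum p d (Suc m) = digit_sum p e (Suc m) \<longleftrightarrow> digit_sum p d m = digit_sum p e m \<and> d m = e m"
  proof
    assume eq: "digit_sum p d (Suc m) = digit_sum p e (Suc m)"
    have "digit_sum p d (Suc m) mod p ^ m = digit_sum p d m" if "\<And>i. d i < p" for d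
      using digit_sum_less[of d p m] that by (simp add: digit_sum_def)
    hence "digit_sum p d m = digit_sum p e m" using eq assms by metis
    moreover have "p > 0" using assms(1)[of 0] by simp
    ultimately show "digit_sum p d m = digit_sum p e m \<and> d m = e m" using eq by (simp add: digit_sum_def)
  qed (simp add: digit_sum_def)
  thus ?case using Suc by (auto simp: less_Suc_eq)
qed (simp add: digit_sum_def)

lemma digits_of_nat:
  assumes "p > 0"
  shows "digit_sum p (\<lambda>i. (c div p ^ i) mod p) m = c mod p ^ m"
proof (induction m)
  case (Suc m)
  thus ?case using mod_mult2_eq[of c "p ^ m" p] by (simp add: digit_sum_def mult.commute)
qed (simp add: digit_sum_def)

text \<open>Digits from position m on contribute a multiple of p^m. All later partial sums therefore
  stay in one closed ball, which yields convergence and also contains the limit.\<close>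

lemma padic_of_digits_approx:
  "padic_norm (padic_of_digits d - of_nat (digit_sum CARD('p) d m) :: 'p::prime_card padic) \<le> real CARD('p) powi (- int m)"
proof -
  let ?s = "\<lambda>m. of_nat (digit_sum CARD('p) d m) :: 'p padic"
  have close: "padic_norm (?s n - ?s m) \<le> real CARD('p) powi (- int m)" if "m \<le> n" for m n
  proof -
    obtain c where "digit_sum CARD('p) d n = digit_sum CARD('p) d m + CARD('p) ^ m * c"
      using digit_sum_cong_add[of "CARD('p)" d m "n - m"] \<open>m \<le> n\<close> by auto
    hence "?s n - ?s m = of_int (int CARD('p) ^ m * int c)" by simp
    thus ?thesis using padic_norm_int_le_iff[where 'p='p] by (metis dvd_triv_left)
  qed
  have "Cauchy ?s"
  proof (rule metric_CauchyI)
    fix e :: real assume "e > 0"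
    then obtain k :: int where k: "real CARD('p) powi k < e" using powi_small[OF padic_card_gt1] by blast
    define M where "M = nat (- k)"
    have small: "real CARD('p) powi (- int M) < e"
      using k le_less_trans[of "real CARD('p) powi (- int M)" "real CARD('p) powi k" e] by (simp add: padic.powi_le_iff M_def)
    have "dist (?s m) (?s n) < e" if "m \<ge> M" "n \<ge> M" for m n
      using padic_norm_ultrametric_diff[of "?s m - ?s M" "?s n - ?s M"] close[OF that(1)] close[OF that(2)] small
      by (simp add: dist_padic_def)
    thus "\<exists>M. \<forall>m\<ge>M. \<forall>n\<ge>M. dist (?s m) (?s n) < e" by blast
  qed
  hence lim: "?s \<longlonglongrightarrow> padic_of_digits d"
    unfolding padic_of_digits_def by (simp add: Cauchy_convergent_iff convergent_LIMSEQ_iff)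
  have "padic_of_digits d \<in> pball (?s m) (- int m)"
    by (rule Lim_in_closed_set[OF padic.closed_uball _ _ lim])
       (auto simp: padic.mem_uball eventually_sequentially intro!: exI[of _ m] close)
  thus ?thesis by (simp add: padic.mem_uball)
qed

text \<open>Any integer \<open>a\<close> in the ball may serve as its centre, and closeness to it is
  congruence modulo p^m, that is, agreement of the first m digits. Preimages of balls are thus
  cylinders.\<close>

lemma padic_of_digits_in_pball_iff:
  assumes "padic_norm (c - of_nat a) \<le> real CARD('p) powi (- int m)" "a < CARD('p) ^ m" "\<And>i. d i < CARD('p)"
  shows "padic_of_digits d \<in> pball (c :: 'p::prime_card padic) (- int m)
      \<longleftrightarrow> (\<forall>i<m. d i = (a div CARD('p) ^ i) mod CARD('p))"
proof -
  let ?p = "CARD('p)"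
  have p0: "?p > 0" using padic_card_gt1[where 'p='p] by simp
  have "pball c (- int m) = pball (of_nat a) (- int m)"
    by (rule padic.uball_eq[symmetric]) (use assms in \<open>simp add: padic.mem_uball padic.N_commute\<close>)
  moreover have "pball (padic_of_digits d) (- int m) = pball (of_nat (digit_sum ?p d m) :: 'p padic) (- int m)"
    by (rule padic.uball_eq) (use padic_of_digits_approx in \<open>simp add: padic.mem_uball\<close>)
  ultimately have "padic_of_digits d \<in> pball c (- int m)
      \<longleftrightarrow> of_nat a \<in> pball (of_nat (digit_sum ?p d m) :: 'p padic) (- int m)"
    by (metis padic.uball_commute)
  also have "\<dots> \<longleftrightarrow> int ?p ^ m dvd int a - int (digit_sum ?p d m)"
    unfolding padic.mem_uball padic_norm_int_le_iff[symmetric, where 'p='p] by simp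
  also have "\<dots> \<longleftrightarrow> a mod ?p ^ m = digit_sum ?p d m mod ?p ^ m"
    by (metis mod_eq_dvd_iff of_nat_eq_iff of_nat_mod of_nat_power)
  also have "\<dots> \<longleftrightarrow> digit_sum ?p d m = digit_sum ?p (\<lambda>i. (a div ?p ^ i) mod ?p) m"
    using digit_sum_less[of d ?p m] assms by (auto simp: digits_of_nat[OF p0])
  also have "\<dots> \<longleftrightarrow> (\<forall>i<m. d i = (a div ?p ^ i) mod ?p)"
    using assms(3) p0 by (intro digit_sum_eq_iff) auto
  finally show ?thesis .
qed


lemma space_digit_space: "space (digit_space p) = {d. \<forall>i. d i < p}"
  by (auto simp: digit_space_def space_PiM space_uniform_count_measure PiE_def Pi_iff)

lemma prob_space_digit_space: "p > 0 \<Longrightarrow> prob_space (digit_space p)"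
  unfolding digit_space_def
  by (intro prob_space_PiM prob_space_uniform_count_measure) auto

lemma emeasure_digit_cylinder:
  assumes "p > 0" "\<And>i. e i < p"
  shows "{d \<in> space (digit_space p). \<forall>i<m. d i = e i} \<in> sets (digit_space p)" (is "?A \<in> _")
    and "emeasure (digit_space p) {d \<in> space (digit_space p). \<forall>i<m. d i = e i} = ennreal (real p powi (- int m))"
proof -
  interpret product_prob_space "\<lambda>_::nat. uniform_count_measure {..<p}" UNIV
    using assms by (intro product_prob_spaceI prob_space_uniform_count_measure) auto
  have A: "?A = prod_emb UNIV (\<lambda>_. uniform_count_measure {..<p}) {..<m} (\<Pi>\<^sub>E i\<in>{..<m}. {e i})"
    unfolding space_digit_space
    by (auto simp: prod_emb_def space_uniform_count_measure PiE_def Pi_iff restrict_def extensional_def)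
  show "?A \<in> sets (digit_space p)"
    unfolding A unfolding digit_space_def
    by (intro sets_PiM_I) (auto simp: assms sets_uniform_count_measure)
  have "emeasure (digit_space p) ?A = (\<Prod>i<m. emeasure (uniform_count_measure {..<p}) {e i})"
    unfolding A unfolding digit_space_def
    by (intro emeasure_PiM_emb) (auto simp: assms sets_uniform_count_measure)
  also have "\<dots> = (\<Prod>i<m. ennreal (1 / real p))"
    by (intro prod.cong refl) (simp add: emeasure_uniform_count_measure assms)
  also have "\<dots> = ennreal (real p powi (- int m))"
    using assms(1) by (simp add: ennreal_power power_int_minus power_one_over inverse_eq_divide)
  finally show "emeasure (digit_space p) ?A = ennreal (real p powi (- int m))" .
qed

lemma padic_norm_padic_of_digits: "padic_norm (padic_of_digits d :: 'p::prime_card padic) \<le> 1"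
  using padic_of_digits_approx[of d 0, where 'p='p] by (simp add: digit_sum_def)

lemma padic_of_digits_preimage:
  fixes c :: "'p::prime_card padic" and m :: nat
  defines "A \<equiv> {d \<in> space (digit_space CARD('p)). padic_of_digits d \<in> pball c (- int m)}"
  shows "A \<in> sets (digit_space CARD('p))"
    and "emeasure (digit_space CARD('p)) A
          = (if padic_norm c \<le> 1 then ennreal (real CARD('p) powi (- int m)) else 0)"
proof -
  have p0: "CARD('p) > 0" using padic_card_gt1[where 'p='p] by simp
  have "A \<in> sets (digit_space CARD('p)) \<and> emeasure (digit_space CARD('p)) A
          = (if padic_norm c \<le> 1 then ennreal (real CARD('p) powi (- int m)) else 0)"
  proof (cases "padic_norm c \<le> 1")
    case True
    then obtain a where a: "a < CARD('p) ^ m" "padic_norm (c - of_nat a) \<le> real CARD('p) powi (- int m)"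
      by (rule padic_int_approx)
    have A: "A = {d \<in> space (digit_space CARD('p)). \<forall>i<m. d i = (a div CARD('p) ^ i) mod CARD('p)}"
      unfolding A_def space_digit_space
      using padic_of_digits_in_pball_iff[OF a(2,1)] by (intro Collect_cong conj_cong) auto
    have digits: "(a div CARD('p) ^ i) mod CARD('p) < CARD('p)" for i using p0 by simp
    show ?thesis
      unfolding A if_P[OF True]
      by (intro conjI emeasure_digit_cylinder[OF p0, of "\<lambda>i. (a div CARD('p) ^ i) mod CARD('p)" m] digits)
  next
    case False
    have "padic_of_digits d \<notin> pball c (- int m)" for d
    proof
      assume "padic_of_digits d \<in> pball c (- int m)"
      hence "padic_norm (padic_of_digits d - c) \<le> 1"
        using padic.uball_mono[of "- int m" 0 c] by (auto simp: padic.mem_uball)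
      thus False
        using padic_norm_ultrametric_diff[of "padic_of_digits d" "padic_of_digits d - c"]
          padic_norm_padic_of_digits[of d, where 'p='p] False by simp
    qed
    hence "A = {}" unfolding A_def by auto
    thus ?thesis using False by simp
  qed
  thus "A \<in> sets (digit_space CARD('p))" "emeasure (digit_space CARD('p)) A
          = (if padic_norm c \<le> 1 then ennreal (real CARD('p) powi (- int m)) else 0)" by auto
qed

lemma measurable_padic_of_digits:
  "padic_of_digits \<in> digit_space CARD('p) \<rightarrow>\<^sub>M (borel :: 'p::prime_card padic measure)"
proof (rule measurable_sigma_sets[OF padic.sets_borel_balls])
  fix B :: "'p padic set" assume "B \<in> padic.balls"
  then consider "B = {}" | c k where "k \<le> 0" "B = pball c k" by (auto simp: padic.balls_def)
  thus "padic_of_digits -` B \<inter> space (digit_space CARD('p)) \<in> sets (digit_space CARD('p))"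
  proof cases
    case 2
    then obtain m where "k = - int m" by (metis int_cases4 le_minus_iff minus_zero minus_minus nonneg_int_cases neg_le_0_iff_le)
    thus ?thesis using padic_of_digits_preimage(1)[of c m] 2 by (simp add: vimage_def Int_def conj_commute)
  qed simp
qed auto

text \<open>
  A Haar-random point of $\mathbb{Q}_p$: a coset representative of $\mathbb{Q}_p / \mathbb{Z}_p$, counted
  with weight one, plus a $p$-adic integer with independent uniform digits.
\<close>

definition haar_construction :: "'p::prime_card padic measure" where
  "haar_construction = distr (count_space (frac_reps CARD('p)) \<Otimes>\<^sub>M digit_space CARD('p)) borel
     (\<lambda>(r, d). padic_of_digits d + of_rat r)"

text \<open>The ball lies in one coset of the unit ball, so only the representative
  \<open>r0\<close> of its centre contributes; on that coset the ball is a digit cylinder.\<close>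

lemma emeasure_haar_construction:
  assumes "k \<le> 0"
  shows "emeasure haar_construction (pball c k :: 'p::prime_card padic set) = ennreal (real CARD('p) powi k)"
proof -
  let ?R = "frac_reps CARD('p)" and ?D = "digit_space CARD('p)"
  let ?f = "\<lambda>(r, d). padic_of_digits d + of_rat r :: 'p padic"
  interpret D: prob_space ?D
    using padic_card_gt1[where 'p='p] by (intro prob_space_digit_space) simp
  obtain m where k: "k = - int m" using assms by (metis minus_equation_iff neg_0_le_iff_le nonneg_int_cases)
  have [measurable]: "?f \<in> count_space ?R \<Otimes>\<^sub>M ?D \<rightarrow>\<^sub>M borel"
  proof (rule measurable_pair_measure_countable1)
    show "countable ?R" by auto
    show "(\<lambda>y. ?f (r, y)) \<in> ?D \<rightarrow>\<^sub>M borel" for r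
      using measurable_compose[OF measurable_padic_of_digits padic.measurable_translate] by simp
  qed
  obtain r0 where r0: "r0 \<in> ?R" "padic_norm (c - of_rat r0) \<le> 1"
    and uniq: "\<And>r. r \<in> ?R \<Longrightarrow> padic_norm (c - of_rat r) \<le> 1 \<Longrightarrow> r = r0"
    using frac_reps_ex1[of c] by blast
  have "emeasure haar_construction (pball c k) = emeasure (count_space ?R \<Otimes>\<^sub>M ?D) (?f -` pball c k \<inter> space (count_space ?R \<Otimes>\<^sub>M ?D))"
    unfolding haar_construction_def by (rule emeasure_distr) auto
  also have "\<dots> = (\<integral>\<^sup>+r. emeasure ?D (Pair r -` (?f -` pball c k \<inter> space (count_space ?R \<Otimes>\<^sub>M ?D))) \<partial>count_space ?R)"
    by (rule D.emeasure_pair_measure_alt) measurable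
  also have "\<dots> = (\<integral>\<^sup>+r. ennreal (real CARD('p) powi k) * indicator {r0} r \<partial>count_space ?R)"
  proof (rule nn_integral_cong)
    fix r assume r: "r \<in> space (count_space ?R)"
    have "Pair r -` (?f -` pball c k \<inter> space (count_space ?R \<Otimes>\<^sub>M ?D))
        = {d \<in> space ?D. padic_of_digits d \<in> pball (c - of_rat r) k}"
      using r by (auto simp: space_pair_measure padic.mem_uball algebra_simps)
    moreover have "padic_norm (c - of_rat r) \<le> 1 \<longleftrightarrow> r = r0" using r r0(2) uniq[of r] by auto
    ultimately show "emeasure ?D (Pair r -` (?f -` pball c k \<inter> space (count_space ?R \<Otimes>\<^sub>M ?D)))
        = ennreal (real CARD('p) powi k) * indicator {r0} r"
      using padic_of_digits_preimage(2)[of "c - of_rat r" m] by (simp add: k indicator_def)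
  qed
  also have "\<dots> = ennreal (real CARD('p) powi k)"
    using r0 by (simp add: nn_integral_cmult_indicator)
  finally show ?thesis .
qed

section \<open>Existence and uniqueness of Haar measure\<close>

definition is_haar :: "'p::prime_card padic measure \<Rightarrow> bool" where
  "is_haar M \<longleftrightarrow> sets M = sets borel \<and> (\<forall>a. \<forall>A\<in>sets borel. emeasure M ((+) a ` A) = emeasure M A)
     \<and> emeasure M {x. padic_norm x \<le> 1} = 1"

lemma image_translate: "(+) a ` A = (\<lambda>x. x + (- a)) -` A" for a :: "'a::ab_group_add"
proof (intro Set.set_eqI iffI)
  fix x assume "x \<in> (\<lambda>x. x + (- a)) -` A"
  thus "x \<in> (+) a ` A" by (intro image_eqI[of _ _ "x - a"]) auto
qed auto

lemma translate_image_pball: "(+) a ` pball c k = pball (a + c) k"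
  unfolding image_translate padic.vimage_translate_uball by (simp add: add.commute)

text \<open>A ball of radius p^(k + 1) is the disjoint union of p translates of the ball of radius
  p^k. Invariance turns this into a factor p, and induction in both directions starts from the
  normalised unit ball.\<close>

lemma is_haar_emeasure_pball:
  fixes M :: "'p::prime_card padic measure"
  assumes "is_haar M"
  shows "emeasure M (pball c k) = ennreal (real CARD('p) powi k)"
proof -
  let ?p = "CARD('p)"
  have p1: "real ?p > 1" by (rule padic_card_gt1)
  note M = assms[unfolded is_haar_def]
  have inv: "emeasure M (pball c k) = emeasure M (pball 0 k)" for c k
    using M translate_image_pball[of c 0 k] padic.uball_in_borel[of 0 k] by (metis add.right_neutral)
  have step: "emeasure M (pball 0 (k + 1)) = of_nat ?p * emeasure M (pball 0 k)" for k
  proof -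
    \<comment> \<open>The centres of the p smaller balls are the multiples \<open>j * u\<close> with
      j < p; dividing by \<open>u\<close> reduces the covering to residues modulo p.\<close>
    obtain u :: "'p padic" where u: "padic_norm u = real ?p powi (k + 1)" by (rule ex_padic_norm_powi)
    have u0: "u \<noteq> 0" using u p1 by auto
    have pu: "real ?p powi (k + 1) = real ?p * real ?p powi k" using p1 by (simp add: power_int_add)
    have eq: "pball 0 (k + 1) = (\<Union>j\<in>{..<?p}. pball (of_nat j * u) k)"
    proof
      show "pball 0 (k + 1) \<subseteq> (\<Union>j\<in>{..<?p}. pball (of_nat j * u) k)"
      proof
        fix x :: "'p padic" assume "x \<in> pball 0 (k + 1)"
        hence "padic_norm (x / u) \<le> 1" using u p1 by (simp add: padic.mem_uball padic_norm_divide)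
        then obtain j where j: "j < ?p" "padic_norm (x / u - of_nat j) \<le> real ?p powi (- 1)"
          using padic_int_approx[of "x / u" 1] by auto
        have "x - of_nat j * u = (x / u - of_nat j) * u" using u0 by (simp add: field_simps)
        hence "padic_norm (x - of_nat j * u) \<le> real ?p powi (- 1) * real ?p powi (k + 1)"
          using j(2) by (simp add: padic_norm_mult u mult_right_mono del: power_int_minus)
        also have "\<dots> = real ?p powi k" using p1 by (simp add: power_int_minus pu)
        finally show "x \<in> (\<Union>j\<in>{..<?p}. pball (of_nat j * u) k)" using j(1) by (auto simp: padic.mem_uball)
      qed
      show "(\<Union>j\<in>{..<?p}. pball (of_nat j * u) k) \<subseteq> pball 0 (k + 1)"
      proof clarify
        fix j x assume x: "x \<in> pball (of_nat j * u) k"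
        have "of_nat j * u \<in> pball 0 (k + 1)"
          using padic_norm_of_int_le_1[of "int j", where 'p='p] p1
          by (simp add: padic.mem_uball padic_norm_mult u)
        thus "x \<in> pball 0 (k + 1)" using x padic.uball_eq padic.uball_mono[of k "k + 1"] by fastforce
      qed
    qed
    have disj: "disjoint_family_on (\<lambda>j. pball (of_nat j * u) k) {..<?p}"
      unfolding disjoint_family_on_def
    proof (intro ballI impI, rule ccontr)
      fix i j assume ij: "i \<in> {..<?p}" "j \<in> {..<?p}" "i \<noteq> j"
        and ne: "pball (of_nat i * u) k \<inter> pball (of_nat j * u) k \<noteq> {}"
      from ne obtain x where "x \<in> pball (of_nat i * u) k" "x \<in> pball (of_nat j * u) k" by blast
      \<comment> \<open>If two of the small balls meet, each centre lies in the other ball. After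
        cancelling the norm of \<open>u\<close> this says that p divides i - j, impossible for
        distinct residues.\<close>
      hence "of_nat i * u \<in> pball (of_nat j * u) k" by (metis padic.uball_eq padic.centre_in_uball)
      hence "padic_norm (of_int (int i - int j) * u) \<le> real ?p powi k"
        by (simp add: padic.mem_uball algebra_simps)
      hence "padic_norm (of_int (int i - int j) :: 'p padic) * real ?p \<le> 1"
        using p1 unfolding padic_norm_mult u pu by simp
      hence "padic_norm (of_int (int i - int j) :: 'p padic) \<le> real ?p powi (- int 1)"
        using p1 by (simp add: field_simps power_int_minus)
      hence "int ?p dvd int i - int j" unfolding padic_norm_int_le_iff by simp
      hence "\<bar>int ?p\<bar> \<le> \<bar>int i - int j\<bar>" using ij(3) by (intro dvd_imp_le_int) auto
      thus False using ij by auto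
    qed
    have "emeasure M (pball 0 (k + 1)) = (\<Sum>j<?p. emeasure M (pball (of_nat j * u) k))"
      unfolding eq using M by (intro sum_emeasure[symmetric] disj) auto
    also have "\<dots> = of_nat ?p * emeasure M (pball 0 k)" by (subst inv) simp
    finally show ?thesis .
  qed
  have "emeasure M (pball 0 k) = ennreal (real ?p powi k)"
  proof (induction k rule: int_induct[where k = 0])
    case base
    show ?case using M by (simp add: padic.uball_def)
  next
    case (step1 i)
    have "emeasure M (pball 0 (i + 1)) = ennreal (real ?p) * ennreal (real ?p powi i)"
      unfolding step step1 ennreal_of_nat_eq_real_of_nat ..
    also have "\<dots> = ennreal (real ?p powi (i + 1))"
      using p1 by (simp add: power_int_add mult.commute flip: ennreal_mult)
    finally show ?case .
  next
    case (step2 i)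
    have "ennreal (real ?p) * emeasure M (pball 0 (i - 1)) = emeasure M (pball 0 i)"
      using step[of "i - 1"] by (simp add: ennreal_of_nat_eq_real_of_nat)
    also have "\<dots> = ennreal (real ?p) * ennreal (real ?p powi (i - 1))"
      unfolding step2(2) using p1 by (simp add: power_int_diff flip: ennreal_mult)
    finally show ?case using p1 by (simp add: ennreal_mult_cancel_left)
  qed
  thus ?thesis by (subst inv)
qed

lemma is_haar_unique: "is_haar M \<Longrightarrow> is_haar M' \<Longrightarrow> M = M'"
  by (rule padic.measure_eq_balls) (auto simp: is_haar_emeasure_pball is_haar_def)

text \<open>Translation permutes the balls of a given radius, so the translated measure has the same
  values on small balls and \<open>measure_eq_balls\<close> identifies it with the original.\<close>

lemma is_haar_construction: "is_haar haar_construction"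
  unfolding is_haar_def
proof (intro conjI allI ballI)
  let ?H = "haar_construction :: 'a padic measure"
  show sets: "sets ?H = sets borel" by (simp add: haar_construction_def)
  show "emeasure ?H {x. padic_norm x \<le> 1} = 1"
    using emeasure_haar_construction[of 0 "0::'a padic"] by (simp add: padic.uball_def)
  fix a and A :: "'a padic set" assume A: "A \<in> sets borel"
  have meas: "(\<lambda>x. x + (- a)) \<in> ?H \<rightarrow>\<^sub>M borel"
    using padic.measurable_translate measurable_cong_sets[OF sets refl] by blast
  have "distr ?H borel (\<lambda>x. x + (- a)) = ?H"
  proof (rule padic.measure_eq_balls)
    have "emeasure (distr ?H borel (\<lambda>x. x + (- a))) (pball c k) = ennreal (real CARD('a) powi k)" if "k \<le> 0" for c k
      unfolding emeasure_distr[OF meas padic.uball_in_borel] padic.vimage_translate_uball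
      using that by (simp add: emeasure_haar_construction sets_eq_imp_space_eq[OF sets])
    thus "\<And>c k. k \<le> 0 \<Longrightarrow> emeasure (distr ?H borel (\<lambda>x. x + (- a))) (pball c k) = emeasure ?H (pball c k)"
      and "\<And>c. emeasure (distr ?H borel (\<lambda>x. x + (- a))) (pball c 0) \<noteq> \<infinity>"
      by (simp_all add: emeasure_haar_construction)
  qed (simp_all add: sets)
  hence "emeasure ?H A = emeasure (distr ?H borel (\<lambda>x. x + (- a))) A" by simp
  also have "\<dots> = emeasure ?H ((\<lambda>x. x + (- a)) -` A)"
    using A by (subst emeasure_distr[OF meas]) (simp_all add: sets_eq_imp_space_eq[OF sets])
  also have "(\<lambda>x. x + (- a)) -` A = (+) a ` A" by (rule image_translate[symmetric])
  finally show "emeasure ?H ((+) a ` A) = emeasure ?H A" by simp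
qed

lemma is_haar_haar: "is_haar haar"
proof -
  have "haar = (THE M. is_haar M)" by (simp add: haar_def is_haar_def)
  thus ?thesis using theI[of is_haar, OF is_haar_construction] is_haar_unique[OF _ is_haar_construction] by metis
qed

lemma sets_haar [simp, measurable_cong]: "sets haar = sets borel"
  by (rule conjunct1[OF is_haar_haar[unfolded is_haar_def]])

lemma emeasure_haar_pball:
  "emeasure haar (pball c k :: 'p::prime_card padic set) = ennreal (real CARD('p) powi k)"
  by (rule is_haar_emeasure_pball[OF is_haar_haar])

lemma sigma_finite_haar: "sigma_finite_measure (haar :: 'p::prime_card padic measure)"
proof
  obtain C :: "'p padic set" where "countable C" "(\<Union>c\<in>C. pball c 0) = UNIV" by (rule padic.countable_cover)
  thus "\<exists>A::'p padic set set. countable A \<and> A \<subseteq> sets haar \<and> \<Union>A = space haar \<and> (\<forall>a\<in>A. emeasure haar a \<noteq> \<infinity>)"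
    by (intro exI[of _ "(\<lambda>c. pball c 0) ` C"])
       (auto simp: emeasure_haar_pball sets_eq_imp_space_eq[OF sets_haar])
qed

section \<open>Haar measure in dimension n\<close>

abbreviation vball :: "('n::finite \<Rightarrow> 'p::prime_card padic) \<Rightarrow> int \<Rightarrow> ('n \<Rightarrow> 'p padic) set" where "vball \<equiv> vec.uball"

lemma sets_haarn [simp, measurable_cong]: "sets (haarn :: ('n::finite \<Rightarrow> 'p::prime_card padic) measure) = sets borel"
proof -
  have "sets (haarn :: ('n \<Rightarrow> 'p padic) measure) = sets (\<Pi>\<^sub>M i\<in>UNIV. borel)"
    unfolding haarn_def by (intro sets_PiM_cong) auto
  thus ?thesis by (simp add: sets_PiM_equal_borel)
qed

lemma space_haarn [simp]: "space haarn = UNIV"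
  using sets_eq_imp_space_eq[OF sets_haarn] by simp

lemma emeasure_haarn_vball:
  "emeasure haarn (vball c k :: ('n::finite \<Rightarrow> 'p::prime_card padic) set) = ennreal ((real CARD('p) powi k) ^ CARD('n))"
proof -
  interpret product_sigma_finite "\<lambda>_::'n. haar :: 'p padic measure"
    by (simp add: product_sigma_finite_def sigma_finite_haar)
  have "emeasure haarn (vball c k) = (\<Prod>i\<in>(UNIV :: 'n set). emeasure haar (pball (c i) k))"
    unfolding haarn_def vec_uball_eq_PiE by (intro emeasure_PiM) auto
  also have "\<dots> = ennreal ((real CARD('p) powi k) ^ CARD('n))"
    by (simp add: emeasure_haar_pball ennreal_power)
  finally show ?thesis .
qed

lemma sigma_finite_haarn: "sigma_finite_measure (haarn :: ('n::finite \<Rightarrow> 'p::prime_card padic) measure)"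
proof
  obtain C :: "('n \<Rightarrow> 'p padic) set" where "countable C" "(\<Union>c\<in>C. vball c 0) = UNIV" by (rule vec.countable_cover)
  thus "\<exists>A::('n \<Rightarrow> 'p padic) set set. countable A \<and> A \<subseteq> sets haarn \<and> \<Union>A = space haarn \<and> (\<forall>a\<in>A. emeasure haarn a \<noteq> \<infinity>)"
    by (intro exI[of _ "(\<lambda>c. vball c 0) ` C"]) (auto simp: emeasure_haarn_vball)
qed

lemma distr_haarn_translate: "distr haarn borel (\<lambda>x. x + a) = (haarn :: ('n::finite \<Rightarrow> 'p::prime_card padic) measure)"
proof (rule vec.measure_eq_balls)
  have "emeasure (distr haarn borel (\<lambda>x. x + a)) (vball c k) = ennreal ((real CARD('p) powi k) ^ CARD('n))" for c :: "'n \<Rightarrow> 'p padic" and k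
    by (subst emeasure_distr) (simp_all add: vec.vimage_translate_uball emeasure_haarn_vball)
  thus "\<And>c k. k \<le> 0 \<Longrightarrow> emeasure (distr haarn borel (\<lambda>x. x + a)) (vball c k) = emeasure haarn (vball c k :: ('n \<Rightarrow> 'p padic) set)"
    and "\<And>c::'n \<Rightarrow> 'p padic. emeasure (distr haarn borel (\<lambda>x. x + a)) (vball c 0) \<noteq> \<infinity>"
    by (simp_all add: emeasure_haarn_vball)
qed simp_all


section \<open>Characters and wavelets\<close>

definition add_char :: "'p::prime_card padic \<Rightarrow> complex" where
  "add_char x = exp (2 * complex_of_real pi * \<i> * of_rat (padic_frac x))"

lemma pairing_eq: "pairing x \<theta> = (\<Prod>k\<in>UNIV. add_char (x k * \<theta> k))"
  by (simp add: pairing_def add_char_def)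

lemma exp_2pi_of_int: "exp (2 * complex_of_real pi * \<i> * of_int m) = 1"
  using exp_integer_2pi[of "of_int m"] by (simp add: mult_ac)

text \<open>Fractional parts are additive up to an element with p-power denominator and p-adic norm
  at most 1, hence up to an integer, which the exponential ignores.\<close>

lemma add_char_add: "add_char (x + y) = add_char x * add_char (y :: 'p::prime_card padic)"
proof -
  let ?a = "padic_frac x" and ?b = "padic_frac y" and ?c = "padic_frac (x + y)"
  have r: "padic_frac z \<in> frac_reps CARD('p)" for z :: "'p padic" by (rule padic_frac_props)
  obtain k l m where k: "?a * of_nat CARD('p) ^ k \<in> \<int>" "?b * of_nat CARD('p) ^ l \<in> \<int>" "?c * of_nat CARD('p) ^ m \<in> \<int>"
    using r[of x] r[of y] r[of "x + y"] unfolding frac_reps_def by blast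
  have "(?c - ?a - ?b) * of_nat CARD('p) ^ (m + k + l) \<in> \<int>"
    by (intro denom_power_diff k)
  moreover have "rat_pabs CARD('p) (?c - ?a - ?b) \<le> 1"
  proof -
    have "(of_rat (?c - ?a - ?b) :: 'p padic) = (x - of_rat ?a) + (y - of_rat ?b) - (x + y - of_rat ?c)"
      by (simp add: of_rat_diff)
    hence "padic_norm (of_rat (?c - ?a - ?b) :: 'p padic) \<le>
        max (padic_norm ((x - of_rat ?a) + (y - of_rat ?b))) (padic_norm (x + y - of_rat ?c))"
      using padic_norm_ultrametric_diff by metis
    also have "\<dots> \<le> 1"
      using padic_frac_props(2)[of x] padic_frac_props(2)[of y] padic_frac_props(2)[of "x + y"]
        padic_norm_ultrametric[of "x - of_rat ?a" "y - of_rat ?b"] by simp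
    finally show ?thesis by (simp add: padic_norm_of_rat)
  qed
  ultimately have "?c - ?a - ?b \<in> \<int>" by (rule Ints_of_rat_pabs_le_1[OF prime_card])
  then obtain j where "?c - ?a - ?b = of_int j" by (auto elim: Ints_cases)
  hence "?c = ?a + ?b + of_int j" by simp
  hence "(of_rat ?c :: complex) = of_rat ?a + of_rat ?b + of_int j" by (simp add: of_rat_add)
  thus ?thesis
    by (simp add: add_char_def distrib_left exp_add exp_2pi_of_int)
qed

lemma add_char_eq_1: "padic_norm x \<le> 1 \<Longrightarrow> add_char x = 1"
proof -
  assume "padic_norm x \<le> 1"
  moreover have "0 \<in> frac_reps CARD('a)" by (auto simp: frac_reps_def)
  ultimately have "padic_frac x = 0"
    using frac_reps_ex1[of x] padic_frac_props[of x] by (metis diff_zero of_rat_0)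
  thus ?thesis by (simp add: add_char_def)
qed

text \<open>The exponential is 1 only at integers, and the only integer in [0, 1) is 0; but
  fractional part 0 would put \<open>x\<close> in the unit ball.\<close>

lemma add_char_ne_1:
  assumes "padic_norm (x :: 'p::prime_card padic) > 1"
  shows "add_char x \<noteq> 1"
proof
  assume *: "add_char x = 1"
  obtain a b where r: "b > 0" "padic_frac x = of_int a / of_int b" by (rule rat_cases_frac[OF prime_card[where ?'a = 'p]])
  have "exp (complex_of_real (2 * pi * (real_of_int a / real_of_int b)) * \<i>) = 1"
    using * by (simp add: add_char_def r of_rat_divide mult_ac)
  then obtain n :: int where "2 * pi * (real_of_int a / real_of_int b) = of_int (2 * n) * pi"
    by (auto simp: exp_eq_1)
  hence "(2 * pi) * real_of_int a = (2 * pi) * real_of_int (n * b)" using r by (simp add: field_simps)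
  hence "real_of_int a = real_of_int (n * b)" using pi_gt_zero by simp
  hence "a = n * b" by linarith
  hence "padic_frac x = of_int n" using r by simp
  moreover have "0 \<le> padic_frac x" "padic_frac x < 1"
    using padic_frac_props(1)[of x] by (auto simp: frac_reps_def)
  ultimately have "padic_frac x = 0" by simp
  thus False using padic_frac_props(2)[of x] assms by simp
qed

lemma pairing_add: "pairing (x + z) \<theta> = pairing x \<theta> * pairing z \<theta>"
  by (simp add: pairing_eq distrib_right add_char_add prod.distrib)

lemma pairing_eq_1:
  assumes "vnorm z * vnorm \<theta> \<le> 1"
  shows "pairing z \<theta> = 1"
  unfolding pairing_eq
proof (intro prod.neutral ballI add_char_eq_1)
  fix k
  have "padic_norm (z k * \<theta> k) \<le> vnorm z * vnorm \<theta>"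
    unfolding padic_norm_mult by (intro mult_mono padic_norm_le_vnorm vec.N_nonneg padic_norm_nonneg)
  thus "padic_norm (z k * \<theta> k) \<le> 1" using assms by simp
qed

text \<open>The vector \<open>z\<close> is concentrated in a coordinate where \<theta> attains its
  norm. The product there is too large to be an integer, so the character detects it.\<close>

lemma ex_pairing_ne_1:
  fixes \<theta> :: "'n::finite \<Rightarrow> 'p::prime_card padic"
  assumes "real CARD('p) powi k * vnorm \<theta> > 1"
  obtains z where "z \<in> vball 0 k" "pairing z \<theta> \<noteq> 1"
proof -
  obtain i where i: "vnorm \<theta> = padic_norm (\<theta> i)" by (rule vnorm_attained)
  obtain u :: "'p padic" where u: "padic_norm u = real CARD('p) powi k" by (rule ex_padic_norm_powi)
  define z where "z = (\<lambda>j. if j = i then u else 0)"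
  have "z \<in> vball 0 k" by (auto simp: vec.mem_uball vnorm_le_iff z_def u)
  moreover have "pairing z \<theta> = add_char (u * \<theta> i)"
  proof -
    have "pairing z \<theta> = (\<Prod>j\<in>UNIV. if j = i then add_char (u * \<theta> i) else 1)"
      unfolding pairing_eq by (intro prod.cong) (auto simp: z_def add_char_eq_1)
    thus ?thesis by simp
  qed
  moreover have "add_char (u * \<theta> i) \<noteq> 1"
    by (rule add_char_ne_1) (use assms i u in \<open>simp add: padic_norm_mult\<close>)
  ultimately show ?thesis using that by metis
qed

lemma (in ultranorm) continuous_locally_constant:
  assumes "\<And>x. \<exists>k. \<forall>y. N (y - x) \<le> b powi k \<longrightarrow> f y = f x"
  shows "continuous_on UNIV (f :: 'a \<Rightarrow> 'c::topological_space)"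
  unfolding continuous_on_open_vimage[OF open_UNIV]
proof (intro allI impI)
  fix U :: "'c set"
  show "open (f -` U \<inter> UNIV)"
    unfolding open_iff
  proof
    fix x assume "x \<in> f -` U \<inter> UNIV"
    moreover obtain k where "\<forall>y. N (y - x) \<le> b powi k \<longrightarrow> f y = f x" using assms by blast
    ultimately show "\<exists>k. \<forall>y. N (y - x) \<le> b powi k \<longrightarrow> y \<in> f -` U \<inter> UNIV" by (intro exI[of _ k]) auto
  qed
qed

lemma measurable_pairing [measurable]:
  "(\<lambda>x. pairing x \<theta>) \<in> borel_measurable (borel :: ('n::finite \<Rightarrow> 'p::prime_card padic) measure)"
proof (intro borel_measurable_continuous_onI vec.continuous_locally_constant)
  fix x :: "'n \<Rightarrow> 'p padic"
  \<comment> \<open>The summand 1 also covers \<theta> = 0; on balls of this radius the pairing with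
    \<theta> is constant by \<open>pairing_eq_1\<close>.\<close>
  obtain k :: int where k: "real CARD('p) powi k < inverse (vnorm \<theta> + 1)"
    using powi_small[OF padic_card_gt1[where 'p='p], of "inverse (vnorm \<theta> + 1)"] vec.N_nonneg[of \<theta>] by auto
  have "pairing y \<theta> = pairing x \<theta>" if "vnorm (y - x) \<le> real CARD('p) powi k" for y
  proof -
    have "vnorm (y - x) * vnorm \<theta> \<le> inverse (vnorm \<theta> + 1) * (vnorm \<theta> + 1)"
      using that k vec.N_nonneg[of \<theta>] vec.N_nonneg[of "y - x"] by (intro mult_mono) auto
    also have "\<dots> = 1" using vec.N_nonneg[of \<theta>] by simp
    finally have "pairing (y - x) \<theta> = 1" by (rule pairing_eq_1)
    thus ?thesis using pairing_add[of x "y - x" \<theta>] by simp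
  qed
  thus "\<exists>k. \<forall>y. vnorm (y - x) \<le> real CARD('p) powi k \<longrightarrow> pairing y \<theta> = pairing x \<theta>" by blast
qed

lemma integral_haarn_translate:
  fixes f :: "('n::finite \<Rightarrow> 'p::prime_card padic) \<Rightarrow> complex"
  assumes "f \<in> borel_measurable borel"
  shows "(LINT x|haarn. f (x + a)) = (LINT x|haarn. f x)"
proof -
  have "(LINT x|distr haarn borel (\<lambda>x. x + a). f x) = (LINT x|haarn. f (x + a))"
    by (rule integral_distr) (use assms in auto)
  thus ?thesis by (simp add: distr_haarn_translate)
qed

section \<open>Ball densities, wavelets and their Fourier transforms\<close>

definition ball_avg :: "('n::finite \<Rightarrow> 'p::prime_card padic) \<Rightarrow> int \<Rightarrow> ('n \<Rightarrow> 'p padic) \<Rightarrow> real" where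
  "ball_avg c k x = indicator (vball c k) x / (real CARD('p) powi k) ^ CARD('n)"

definition wavelet :: "('n::finite \<Rightarrow> 'p::prime_card padic) \<Rightarrow> int \<Rightarrow> ('n \<Rightarrow> 'p padic) \<Rightarrow> complex" where
  "wavelet c k x = of_real (ball_avg c k x - ball_avg c (k + 1) x)"

lemma measure_haarn_vball:
  "measure haarn (vball c k :: ('n::finite \<Rightarrow> 'p::prime_card padic) set) = (real CARD('p) powi k) ^ CARD('n)"
  by (simp add: measure_def emeasure_haarn_vball)

lemma integrable_indicator_vball [simp]: "integrable haarn (indicator (vball c k) :: _ \<Rightarrow> real)"
  by (rule integrable_real_indicator) (auto simp: emeasure_haarn_vball)

lemma integrable_ball_avg [simp]: "integrable haarn (ball_avg c k)"
  unfolding ball_avg_def by (intro integrable_divide integrable_indicator_vball)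

lemma integral_ball_avg [simp]: "(LINT x|haarn. ball_avg c k (x :: 'n::finite \<Rightarrow> 'p::prime_card padic)) = 1"
  using padic_card_gt1[where 'p='p] by (simp add: ball_avg_def measure_haarn_vball)

lemma measurable_ball_avg [measurable]: "ball_avg c k \<in> borel_measurable borel"
  unfolding ball_avg_def by measurable

lemma measurable_wavelet [measurable]: "wavelet c k \<in> borel_measurable borel"
  unfolding wavelet_def by measurable

lemma integrable_wavelet [simp]: "integrable haarn (wavelet c k)"
  unfolding wavelet_def by (intro integrable_of_real Bochner_Integration.integrable_diff integrable_ball_avg)

lemma integral_wavelet [simp]: "(LINT x|haarn. wavelet c k x) = 0"
  unfolding wavelet_def by simp

lemma ball_avg_locally_constant:
  assumes "k \<le> l" "vnorm (y - x) \<le> real CARD('p) powi k"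
  shows "ball_avg c l y = ball_avg c l (x :: 'n::finite \<Rightarrow> 'p::prime_card padic)"
proof -
  have "y \<in> vball x l" using assms vec.uball_mono[OF assms(1), of x] unfolding vec.mem_uball[symmetric] by blast
  hence "y \<in> vball c l \<longleftrightarrow> x \<in> vball c l"
    using vec.uball_eq by (metis vec.uball_commute)
  thus ?thesis by (simp add: ball_avg_def indicator_def)
qed

lemma wavelet_locally_constant:
  assumes "vnorm (y - x) \<le> real CARD('p) powi k"
  shows "wavelet c k y = wavelet c k (x :: 'n::finite \<Rightarrow> 'p::prime_card padic)"
  using ball_avg_locally_constant[OF order_refl assms] ball_avg_locally_constant[OF _ assms, of "k + 1"]
  by (simp add: wavelet_def)

lemma wavelet_outside: "x \<notin> vball c (k + 1) \<Longrightarrow> wavelet c k x = 0"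
  using vec.uball_mono[of k "k + 1" c] by (auto simp: wavelet_def ball_avg_def indicator_def)

text \<open>The ball is the image of the compact unit ball under a Lipschitz affine map whose factor
  has norm p^k.\<close>

lemma compact_pball: "compact (pball c k :: 'p::prime_card padic set)"
proof -
  obtain u :: "'p padic" where u: "padic_norm u = real CARD('p) powi k" by (rule ex_padic_norm_powi)
  have u0: "u \<noteq> 0" using u padic_card_gt1[where 'p='p] by auto
  have "dist (c + u * x) (c + u * y) \<le> padic_norm u * dist x y" for x y
    by (simp add: dist_padic_def padic_norm_mult flip: right_diff_distrib)
  hence "continuous_on UNIV (\<lambda>x. c + u * x)"
    by (intro lipschitz_on_continuous_on[of "padic_norm u"] lipschitz_onI) auto
  hence "compact ((\<lambda>x. c + u * x) ` {x. padic_norm x \<le> 1})"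
    by (intro compact_continuous_image padic_int_unit_ball_compact) (auto intro: continuous_on_subset)
  also have "(\<lambda>x. c + u * x) ` {x. padic_norm x \<le> 1} = pball c k"
  proof (intro equalityI subsetI)
    fix y assume "y \<in> pball c k"
    hence "padic_norm ((y - c) / u) \<le> 1" using u padic_card_gt1[where 'p='p]
      by (simp add: padic.mem_uball padic_norm_divide)
    moreover have "y = c + u * ((y - c) / u)" using u0 by simp
    ultimately show "y \<in> (\<lambda>x. c + u * x) ` {x. padic_norm x \<le> 1}" by blast
  qed (auto simp: padic.mem_uball padic_norm_mult u mult_left_le)
  finally show ?thesis .
qed

lemma compact_vball: "compact (vball c k)"
proof -
  have "compactin (product_topology (\<lambda>i. euclidean) UNIV) (\<Pi>\<^sub>E i\<in>UNIV. pball (c i) k)"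
    by (subst compactin_PiE) (auto simp: compact_pball)
  thus ?thesis by (simp add: vec_uball_eq_PiE euclidean_product_topology)
qed

lemma wavelet_test_function: "wavelet c k \<in> test_functions"
  unfolding test_functions_def
proof (intro CollectI conjI allI)
  fix x
  show "\<exists>U. open U \<and> x \<in> U \<and> wavelet c k constant_on U"
    unfolding constant_on_def
    by (intro exI[of _ "vball x k"] conjI exI[of _ "wavelet c k x"] ballI vec.open_uball)
       (auto simp: vec.mem_uball intro!: wavelet_locally_constant)
  have "closure {x. wavelet c k x \<noteq> 0} \<subseteq> vball c (k + 1)"
    by (intro closure_minimal vec.closed_uball) (use wavelet_outside in auto)
  thus "compact (closure {x. wavelet c k x \<noteq> 0})"
    using compact_vball closed_closure by (metis compact_Int_closed inf.absorb_iff2)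
qed

text \<open>At low frequency the character is constant on the larger ball, and the wavelet has mean
  zero. At high frequency some shift within the smaller radius preserves the wavelet but multiplies
  the integral by a character value other than 1.\<close>

lemma fourier_wavelet:
  fixes \<zeta> :: "'n::finite \<Rightarrow> 'p::prime_card padic"
  assumes "vnorm \<zeta> \<noteq> real CARD('p) powi (- k)"
  shows "fourier (wavelet c k) \<zeta> = 0"
proof -
  let ?p = "real CARD('p)"
  have p1: "?p > 1" by (rule padic_card_gt1)
  show ?thesis
  proof (cases "vnorm \<zeta> \<le> ?p powi (- k - 1)")
    case True
    have "pairing x \<zeta> * wavelet c k x = pairing c \<zeta> * wavelet c k x" for x
    proof (cases "x \<in> vball c (k + 1)")
      case x: True
      have "vnorm (x - c) * vnorm \<zeta> \<le> ?p powi (k + 1) * ?p powi (- k - 1)"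
        using x True vec.N_nonneg by (intro mult_mono) (auto simp: vec.mem_uball)
      also have "\<dots> = 1" using p1 by (simp flip: power_int_add)
      finally have "pairing (x - c) \<zeta> = 1" by (rule pairing_eq_1)
      thus ?thesis using pairing_add[of c "x - c" \<zeta>] by simp
    qed (simp add: wavelet_outside)
    hence "fourier (wavelet c k) \<zeta> = (LINT x|haarn. pairing c \<zeta> * wavelet c k x)"
      unfolding fourier_def by (intro Bochner_Integration.integral_cong refl)
    thus ?thesis by simp
  next
    case False
    \<comment> \<open>Norms skip the gap between p^(-k - 1) and p^(-k), so excluding both low
      frequencies and the sphere itself leaves only strictly larger norms.\<close>
    hence "\<not> vnorm \<zeta> < ?p powi (- k)" using vec.N_less_iff[of \<zeta> "- k - 1"] by simp
    hence "vnorm \<zeta> > ?p powi (- k)" using assms by simp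
    hence "?p powi k * vnorm \<zeta> > ?p powi k * ?p powi (- k)" using p1 by (intro mult_strict_left_mono) auto
    also have "?p powi k * ?p powi (- k) = 1" using p1 by (simp flip: power_int_add)
    finally obtain z where z: "z \<in> vball 0 k" "pairing z \<zeta> \<noteq> 1" by (rule ex_pairing_ne_1)
    have "fourier (wavelet c k) \<zeta> = (LINT x|haarn. pairing (x + z) \<zeta> * wavelet c k (x + z))"
      unfolding fourier_def by (rule integral_haarn_translate[symmetric]) measurable
    also have "\<dots> = (LINT x|haarn. pairing z \<zeta> * (pairing x \<zeta> * wavelet c k x))"
    proof (intro Bochner_Integration.integral_cong refl)
      fix x
      have "wavelet c k (x + z) = wavelet c k x"
        using z(1) by (intro wavelet_locally_constant) (simp add: vec.mem_uball)
      thus "pairing (x + z) \<zeta> * wavelet c k (x + z) = pairing z \<zeta> * (pairing x \<zeta> * wavelet c k x)"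
        by (simp add: pairing_add)
    qed
    also have "\<dots> = pairing z \<zeta> * fourier (wavelet c k) \<zeta>"
      by (simp add: fourier_def)
    finally show ?thesis using z(2) by simp
  qed
qed

lemma ball_avg_square:
  "(cmod (complex_of_real (ball_avg (c :: 'n::finite \<Rightarrow> 'p::prime_card padic) k x)))\<^sup>2
    = ball_avg c k x / (real CARD('p) powi k) ^ CARD('n)"
  unfolding norm_of_real power2_abs by (simp add: ball_avg_def power2_eq_square indicator_def)

lemma ball_avg_L2: "(\<lambda>x. complex_of_real (ball_avg c k x)) \<in> L2 haarn"
  by (simp add: L2_def ball_avg_square del: norm_of_real)

lemma L2_norm_ball_avg:
  fixes c :: "'n::finite \<Rightarrow> 'p::prime_card padic"
  shows "L2_norm haarn (\<lambda>x. complex_of_real (ball_avg c k x)) = sqrt (1 / (real CARD('p) powi k) ^ CARD('n))"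
  by (simp add: L2_norm_def ball_avg_square del: norm_of_real)


section \<open>Square-integrable functions and contraction semigroups\<close>

lemma L2_measurable: "f \<in> L2 M \<Longrightarrow> f \<in> borel_measurable M"
  by (simp add: L2_def)

lemma L2_integrable: "f \<in> L2 M \<Longrightarrow> integrable M (\<lambda>x. (cmod (f x))\<^sup>2)"
  by (simp add: L2_def)

lemma L2_norm_nonneg [simp]: "L2_norm M f \<ge> 0"
  by (simp add: L2_norm_def)

lemma L2_norm_square: "(L2_norm M f)\<^sup>2 = (LINT x|M. (cmod (f x))\<^sup>2)"
  by (simp add: L2_norm_def)

lemma L2_norm_cong_AE:
  assumes "f \<in> borel_measurable M" "g \<in> borel_measurable M" "AE x in M. f x = g x"
  shows "L2_norm M f = L2_norm M g"
proof -
  have "(LINT x|M. (cmod (f x))\<^sup>2) = (LINT x|M. (cmod (g x))\<^sup>2)"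
    using assms by (intro integral_cong_AE) auto
  thus ?thesis by (simp add: L2_norm_def)
qed

lemma L2_scale: "f \<in> L2 M \<Longrightarrow> (\<lambda>x. c * f x) \<in> L2 M"
  by (auto simp: L2_def norm_mult power_mult_distrib)

lemma L2_norm_scale: "L2_norm M (\<lambda>x. c * f x) = cmod c * L2_norm M f"
  by (simp add: L2_norm_def norm_mult power_mult_distrib real_sqrt_mult)

lemma L2_zero: "(\<lambda>x. 0) \<in> L2 M"
  by (simp add: L2_def)

text \<open>Optimising over \<open>a\<close> and \<open>b\<close> after integration replaces the Cauchy--Schwarz inequality.\<close>

lemma cmod_add_square_le:
  assumes "a > 0" "b > 0"
  shows "(cmod (u + v))\<^sup>2 \<le> (1 + b / a) * (cmod u)\<^sup>2 + (1 + a / b) * (cmod v)\<^sup>2"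
proof -
  have "0 \<le> (b * cmod u - a * cmod v)\<^sup>2 / (a * b)" using assms by simp
  also have "\<dots> = b / a * (cmod u)\<^sup>2 + a / b * (cmod v)\<^sup>2 - 2 * cmod u * cmod v"
    using assms by (simp add: field_simps power2_eq_square)
  finally have "2 * cmod u * cmod v \<le> b / a * (cmod u)\<^sup>2 + a / b * (cmod v)\<^sup>2" by simp
  moreover have "(cmod (u + v))\<^sup>2 \<le> (cmod u + cmod v)\<^sup>2"
    by (intro power_mono norm_triangle_ineq) auto
  ultimately show ?thesis by (simp add: power2_sum algebra_simps)
qed

lemma L2_add:
  assumes "f \<in> L2 M" "g \<in> L2 M"
  shows "(\<lambda>x. f x + g x) \<in> L2 M"
proof -
  note [measurable] = assms[THEN L2_measurable]
  have "integrable M (\<lambda>x. (cmod (f x + g x))\<^sup>2)"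
  proof (rule Bochner_Integration.integrable_bound)
    show "integrable M (\<lambda>x. 2 * (cmod (f x))\<^sup>2 + 2 * (cmod (g x))\<^sup>2)"
      using assms by (auto simp: L2_def)
    show "AE x in M. norm ((cmod (f x + g x))\<^sup>2) \<le> norm (2 * (cmod (f x))\<^sup>2 + 2 * (cmod (g x))\<^sup>2)"
      using cmod_add_square_le[of 1 1] by auto
  qed measurable
  thus ?thesis by (simp add: L2_def)
qed

lemma L2_diff: "f \<in> L2 M \<Longrightarrow> g \<in> L2 M \<Longrightarrow> (\<lambda>x. f x - g x) \<in> L2 M"
  using L2_add[of f M "\<lambda>x. - 1 * g x"] L2_scale[of g M "- 1"] by simp

lemma L2_norm_triangle:
  assumes "f \<in> L2 M" "g \<in> L2 M"
  shows "L2_norm M (\<lambda>x. f x + g x) \<le> L2_norm M f + L2_norm M g"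
proof (rule field_le_epsilon)
  fix e :: real assume e: "e > 0"
  \<comment> \<open>The extra \<open>e / 2\<close> keeps both numbers positive even for vanishing
    norms; with these weights the bound collapses to \<open>(a + b)\<^sup>2\<close>.\<close>
  define a b where "a = L2_norm M f + e / 2" and "b = L2_norm M g + e / 2"
  have ab: "a > 0" "b > 0" using e by (simp_all add: a_def b_def add_nonneg_pos)
  have "(L2_norm M (\<lambda>x. f x + g x))\<^sup>2 \<le> (LINT x|M. (1 + b / a) * (cmod (f x))\<^sup>2 + (1 + a / b) * (cmod (g x))\<^sup>2)"
    unfolding L2_norm_square using assms L2_add[OF assms] ab
    by (intro integral_mono cmod_add_square_le) (auto simp: L2_def)
  also have "\<dots> = (1 + b / a) * (L2_norm M f)\<^sup>2 + (1 + a / b) * (L2_norm M g)\<^sup>2"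
    using assms by (simp add: L2_norm_square L2_def)
  also have "\<dots> \<le> (1 + b / a) * a\<^sup>2 + (1 + a / b) * b\<^sup>2"
    using ab e by (intro add_mono mult_left_mono power_mono) (auto simp: a_def b_def)
  also have "\<dots> = (a + b)\<^sup>2" using ab by (simp add: field_simps power2_eq_square)
  finally have "L2_norm M (\<lambda>x. f x + g x) \<le> a + b"
    by (rule power2_le_imp_le) (use ab in simp)
  thus "L2_norm M (\<lambda>x. f x + g x) \<le> L2_norm M f + L2_norm M g + e" by (simp add: a_def b_def)
qed

lemma L2_norm_eq_0D:
  assumes "f \<in> L2 M" "L2_norm M f = 0"
  shows "AE x in M. f x = 0"
proof -
  have "(LINT x|M. (cmod (f x))\<^sup>2) = 0" using assms(2) L2_norm_square[of M f] by simp
  hence "AE x in M. (cmod (f x))\<^sup>2 = 0"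
    using integral_nonneg_eq_0_iff_AE[OF L2_integrable[OF assms(1)]] by simp
  thus ?thesis by simp
qed

text \<open>The limit itself serves as majorant: the squared differences are at most
  \<open>(C + 1)\<^sup>2\<close> times the squared modulus of \<open>f\<close>.\<close>

lemma L2_norm_dominated_convergence:
  assumes "\<And>k. u k \<in> borel_measurable M" "f \<in> L2 M" "\<And>x. x \<in> space M \<Longrightarrow> (\<lambda>k. u k x) \<longlonglongrightarrow> f x"
    and "\<And>k x. x \<in> space M \<Longrightarrow> cmod (u k x) \<le> C * cmod (f x)" and "C \<ge> 0"
  shows "u k \<in> L2 M" "(\<lambda>k. L2_norm M (\<lambda>x. u k x - f x)) \<longlonglongrightarrow> 0"
proof -
  note [measurable] = assms(1) assms(2)[THEN L2_measurable]
  show "u k \<in> L2 M"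
    unfolding L2_def
  proof (intro CollectI conjI assms(1), rule Bochner_Integration.integrable_bound)
    show "integrable M (\<lambda>x. C\<^sup>2 * (cmod (f x))\<^sup>2)" using assms(2) by (simp add: L2_def)
    show "AE x in M. norm ((cmod (u k x))\<^sup>2) \<le> norm (C\<^sup>2 * (cmod (f x))\<^sup>2)"
      using assms(4) by (intro AE_I2) (simp flip: power_mult_distrib add: power_mono)
  qed measurable
  have "(\<lambda>k. LINT x|M. (cmod (u k x - f x))\<^sup>2) \<longlonglongrightarrow> (LINT x|M. 0)"
  proof (rule integral_dominated_convergence)
    show "integrable M (\<lambda>x. (C + 1)\<^sup>2 * (cmod (f x))\<^sup>2)" using assms(2) by (simp add: L2_def)
    show "AE x in M. (\<lambda>k. (cmod (u k x - f x))\<^sup>2) \<longlonglongrightarrow> 0"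
      using assms(3) by (intro AE_I2) (auto intro!: tendsto_eq_intros)
    fix k
    have "cmod (u k x - f x) \<le> (C + 1) * cmod (f x)" if "x \<in> space M" for x
      using norm_triangle_ineq4[of "u k x" "f x"] assms(4)[OF that, of k] by (simp add: algebra_simps)
    thus "AE x in M. norm ((cmod (u k x - f x))\<^sup>2) \<le> (C + 1)\<^sup>2 * (cmod (f x))\<^sup>2"
      by (intro AE_I2) (simp flip: power_mult_distrib add: power_mono)
  qed measurable
  thus "(\<lambda>k. L2_norm M (\<lambda>x. u k x - f x)) \<longlonglongrightarrow> 0"
    unfolding L2_norm_def using tendsto_real_sqrt by fastforce
qed

text \<open>
  For an eigenfunction \<open>h\<close> the error \<open>\<phi> t = L2_norm (P t h - exp (- \<mu> t) h)\<close> is subadditive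
  and \<open>\<phi> s / s\<close> vanishes as \<open>s\<close> tends to \<open>0\<close>; hence \<open>\<phi> t \<le> n * \<phi> (t / n)\<close> forces \<open>\<phi> = 0\<close>.
\<close>

lemma semigroup_eigenfunction:
  assumes sg: "contraction_semigroup M P" and h: "h \<in> L2 M" and lam: "\<mu> \<ge> 0"
    and gen: "(h, \<lambda>x. - (of_real \<mu> * h x)) \<in> generator M P" and t: "t > 0"
  shows "AE x in M. P t h x = of_real (exp (- \<mu> * t)) * h x"
proof -
  let ?e = "\<lambda>t. complex_of_real (exp (- \<mu> * t))"
  define \<phi> where "\<phi> t = L2_norm M (\<lambda>x. P t h x - ?e t * h x)" for t
  note S = sg[unfolded contraction_semigroup_def]
  have P_L2: "P t f \<in> L2 M" if "t \<ge> 0" "f \<in> L2 M" for t f using S that by blast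
  have contr: "L2_norm M (P t f) \<le> L2_norm M f" if "t \<ge> 0" "f \<in> L2 M" for t f using S that by blast
  have lin: "AE x in M. P t (\<lambda>y. f y + c * g y) x = P t f x + c * P t g x"
    if "t \<ge> 0" "f \<in> L2 M" "g \<in> L2 M" for t f g c using S that by blast
  have err: "(\<lambda>x. P t h x - ?e t * h x) \<in> L2 M" if "t \<ge> 0" for t
    using that h by (intro L2_diff L2_scale P_L2)
  have subadd: "\<phi> (s + t) \<le> \<phi> s + \<phi> t" if st: "s \<ge> 0" "t \<ge> 0" for s t
  proof -
    \<comment> \<open>The error at time s + t splits into \<open>P s\<close> applied to the error at
      time t, plus the scalar decay over t times the error at time s. Contractivity bounds the
      first, and a nonnegative \<mu> bounds the second.\<close>
    define g where "g = (\<lambda>x. P t h x + (- ?e t) * h x)"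
    have g: "g \<in> L2 M" using err[OF st(2)] by (simp add: g_def)
    have "AE x in M. P (s + t) h x = P s (P t h) x" using S st h by blast
    moreover have "AE x in M. P s g x = P s (P t h) x + (- ?e t) * P s h x"
      unfolding g_def using st h by (intro lin P_L2)
    ultimately have "AE x in M. P (s + t) h x - ?e (s + t) * h x = P s g x + ?e t * (P s h x - ?e s * h x)"
    proof eventually_elim
      case (elim x)
      have "?e (s + t) = ?e t * ?e s"
        unfolding of_real_mult[symmetric] mult_exp_exp by (simp add: algebra_simps)
      thus ?case using elim by (simp add: algebra_simps)
    qed
    hence "\<phi> (s + t) = L2_norm M (\<lambda>x. P s g x + ?e t * (P s h x - ?e s * h x))"
      unfolding \<phi>_def using st h g
      by (intro L2_norm_cong_AE L2_measurable err L2_add L2_scale P_L2) auto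
    also have "\<dots> \<le> L2_norm M (P s g) + L2_norm M (\<lambda>x. ?e t * (P s h x - ?e s * h x))"
      using st g by (intro L2_norm_triangle L2_scale err P_L2)
    also have "\<dots> \<le> \<phi> t + \<phi> s"
    proof (intro add_mono)
      show "L2_norm M (P s g) \<le> \<phi> t" using contr[OF st(1) g] by (simp add: g_def \<phi>_def)
      have "cmod (?e t) \<le> 1" using lam st by simp
      hence "cmod (?e t) * \<phi> s \<le> \<phi> s" by (intro mult_left_le_one_le) (auto simp: \<phi>_def)
      thus "L2_norm M (\<lambda>x. ?e t * (P s h x - ?e s * h x)) \<le> \<phi> s"
        unfolding L2_norm_scale \<phi>_def .
    qed
    finally show ?thesis by simp
  qed
  have phi0: "\<phi> 0 = 0"
  proof -
    have "AE x in M. P 0 h x - ?e 0 * h x = 0" using S h by auto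
    hence "\<phi> 0 = L2_norm M (\<lambda>x. 0)"
      unfolding \<phi>_def by (intro L2_norm_cong_AE L2_measurable err L2_zero) auto
    thus ?thesis by (simp add: L2_norm_def)
  qed
  have mult: "\<phi> (real n * s) \<le> real n * \<phi> s" if "s \<ge> 0" for n s
  proof (induction n)
    case (Suc n)
    thus ?case using subadd[of "real n * s" s] that by (simp add: algebra_simps)
  qed (simp add: phi0)
  have lim: "((\<lambda>s. \<phi> s / s) \<longlongrightarrow> 0) (at_right 0)"
  proof (rule tendsto_sandwich[OF _ _ tendsto_const])
    \<comment> \<open>\<open>?A\<close> is the error of the difference quotient of the semigroup,
      which the generator makes small; \<open>?B\<close> is the corresponding error for the scalar
      exponential.\<close>
    let ?A = "\<lambda>s. L2_norm M (\<lambda>x. (P s h x - h x) / of_real s - (- (of_real \<mu> * h x)))"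
    let ?B = "\<lambda>s. cmod (of_real ((1 - exp (- \<mu> * s)) / s - \<mu>)) * L2_norm M h"
    have "((\<lambda>s. (1 - exp (- \<mu> * s)) / s) \<longlongrightarrow> \<mu>) (at_right 0)"
    proof -
      have "((\<lambda>s. 1 - exp (- \<mu> * s)) has_real_derivative \<mu>) (at 0 within {0<..})"
        by (auto intro!: derivative_eq_intros)
      thus ?thesis by (simp add: has_field_derivative_iff)
    qed
    hence "(?B \<longlongrightarrow> cmod (of_real (\<mu> - \<mu>)) * L2_norm M h) (at_right 0)"
      by (intro tendsto_intros)
    moreover have "(?A \<longlongrightarrow> 0) (at_right 0)" using gen by (simp add: generator_def)
    ultimately show "((\<lambda>s. ?A s + ?B s) \<longlongrightarrow> 0) (at_right 0)"
      using tendsto_add by fastforce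
    show "\<forall>\<^sub>F s in at_right 0. \<phi> s / s \<le> ?A s + ?B s"
      using eventually_at_right_less[of 0]
    proof eventually_elim
      case (elim s)
      have 1: "(\<lambda>x. (P s h x - h x) / of_real s - (- (of_real \<mu> * h x))) \<in> L2 M"
        using L2_add[OF L2_scale[OF L2_diff[OF P_L2[OF less_imp_le[OF elim] h] h], of "1 / of_real s"] L2_scale[OF h, of "of_real \<mu>"]]
        by simp
      have "\<phi> s / s = L2_norm M (\<lambda>x. (1 / of_real s) * (P s h x - ?e s * h x))"
        using elim unfolding L2_norm_scale by (simp add: \<phi>_def norm_divide)
      also have "(\<lambda>x. (1 / of_real s) * (P s h x - ?e s * h x)) =
          (\<lambda>x. ((P s h x - h x) / of_real s - (- (of_real \<mu> * h x)))
             + of_real ((1 - exp (- \<mu> * s)) / s - \<mu>) * h x)"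
        using elim by (intro ext) (simp add: field_simps)
      also have "L2_norm M \<dots> \<le> ?A s + ?B s"
        unfolding L2_norm_scale[symmetric] by (intro L2_norm_triangle 1 L2_scale h)
      finally show ?case .
    qed
    show "\<forall>\<^sub>F s in at_right 0. 0 \<le> \<phi> s / s"
      using eventually_at_right_less[of 0] by eventually_elim (simp add: \<phi>_def)
  qed
  have seq: "filterlim (\<lambda>n. t / real (Suc n)) (at_right 0) sequentially"
    using t LIMSEQ_Suc[OF lim_const_over_n[of t]] unfolding filterlim_at
    by (auto intro!: always_eventually)
  have scaled: "(\<lambda>n. t * (\<phi> (t / real (Suc n)) / (t / real (Suc n)))) \<longlonglongrightarrow> t * 0"
    using filterlim_compose[OF lim seq] by (intro tendsto_intros)
  have bound: "\<phi> t \<le> t * (\<phi> (t / real (Suc n)) / (t / real (Suc n)))" for n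
    using mult[of "t / real (Suc n)" "Suc n"] t by (simp add: field_simps del: of_nat_Suc)
  have "\<phi> t \<le> t * 0" by (rule LIMSEQ_le_const[OF scaled]) (use bound in blast)
  hence "\<phi> t \<le> 0" by simp
  hence "\<phi> t = 0" using L2_norm_nonneg by (simp add: \<phi>_def antisym)
  from L2_norm_eq_0D[OF err this[unfolded \<phi>_def]] t show ?thesis by simp
qed

section \<open>The closed subspace on which an operator is given by a kernel\<close>

definition kernel_domain ::
  "'a measure \<Rightarrow> (('a \<Rightarrow> complex) \<Rightarrow> ('a \<Rightarrow> complex)) \<Rightarrow> ('a \<Rightarrow> 'a \<Rightarrow> real) \<Rightarrow> ('a \<Rightarrow> complex) set" where
  "kernel_domain M T K = {f \<in> L2 M. AE x in M. T f x = (LINT y|M. of_real (K x y) * f y)}"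

text \<open>\<open>T\<close> is meaningful only up to null sets and continuous in norm, whereas
  integration against the square-integrable row \<open>K x\<close> is continuous for each single
  \<open>x\<close>. An almost everywhere convergent subsequence reconciles the two in
  \<open>kernel_domain_limit\<close>.\<close>

locale L2_kernel =
  fixes M :: "'a measure" and T :: "('a \<Rightarrow> complex) \<Rightarrow> ('a \<Rightarrow> complex)" and K :: "'a \<Rightarrow> 'a \<Rightarrow> real"
  assumes T_L2: "f \<in> L2 M \<Longrightarrow> T f \<in> L2 M"
    and T_contraction: "f \<in> L2 M \<Longrightarrow> L2_norm M (T f) \<le> L2_norm M f"
    and T_linear: "f \<in> L2 M \<Longrightarrow> g \<in> L2 M \<Longrightarrow> AE x in M. T (\<lambda>y. f y + c * g y) x = T f x + c * T g x"
    and K_L2: "(\<lambda>y. complex_of_real (K x y)) \<in> L2 M"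
begin

lemma integrable_kernel:
  assumes "f \<in> L2 M"
  shows "integrable M (\<lambda>y. of_real (K x y) * f y)"
proof (rule Bochner_Integration.integrable_bound)
  show "(\<lambda>y. of_real (K x y) * f y) \<in> borel_measurable M"
    by (intro borel_measurable_times L2_measurable[OF K_L2] L2_measurable[OF assms])
  show "integrable M (\<lambda>y. (cmod (complex_of_real (K x y)))\<^sup>2 + (cmod (f y))\<^sup>2)"
    using assms K_L2 by (intro Bochner_Integration.integrable_add L2_integrable)
  show "AE y in M. norm (of_real (K x y) * f y) \<le> norm ((cmod (complex_of_real (K x y)))\<^sup>2 + (cmod (f y))\<^sup>2)"
  proof (intro AE_I2)
    fix y
    define a b where "a = cmod (complex_of_real (K x y))" and "b = cmod (f y)"
    have "a * b \<ge> 0" by (simp add: a_def b_def)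
    hence "a * b \<le> a\<^sup>2 + b\<^sup>2" using sum_squares_bound[of a b] by linarith
    thus "norm (of_real (K x y) * f y) \<le> norm ((cmod (complex_of_real (K x y)))\<^sup>2 + (cmod (f y))\<^sup>2)"
      unfolding norm_mult a_def b_def by simp
  qed
qed

text \<open>The product of the row with the difference is split by the weighted inequality a b \<le>
  s a^2 / 2 + b^2 / (2 s). Choosing s small first and then k large makes both terms small.\<close>

lemma kernel_tendsto:
  assumes "\<And>k. u k \<in> L2 M" "f \<in> L2 M" "(\<lambda>k. L2_norm M (\<lambda>x. u k x - f x)) \<longlonglongrightarrow> 0"
  shows "(\<lambda>k. LINT y|M. of_real (K x y) * u k y) \<longlonglongrightarrow> (LINT y|M. of_real (K x y) * f y)"
proof -
  define A where "A = (LINT y|M. (cmod (complex_of_real (K x y)))\<^sup>2)"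
  have A: "A \<ge> 0" by (simp add: A_def)
  have bound: "cmod ((LINT y|M. of_real (K x y) * u k y) - (LINT y|M. of_real (K x y) * f y))
      \<le> s / 2 * A + (L2_norm M (\<lambda>y. u k y - f y))\<^sup>2 / (2 * s)" if s: "s > 0" for k s
  proof -
    have d: "(\<lambda>y. u k y - f y) \<in> L2 M" by (intro L2_diff assms)
    have "(LINT y|M. of_real (K x y) * u k y) - (LINT y|M. of_real (K x y) * f y)
        = (LINT y|M. of_real (K x y) * (u k y - f y))"
      using integrable_kernel assms by (simp add: right_diff_distrib)
    also have "cmod \<dots> \<le> (LINT y|M. cmod (of_real (K x y) * (u k y - f y)))"
      by (rule integral_norm_bound)
    also have "\<dots> \<le> (LINT y|M. s / 2 * (cmod (complex_of_real (K x y)))\<^sup>2 + (cmod (u k y - f y))\<^sup>2 / (2 * s))"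
    proof (rule integral_mono)
      show "integrable M (\<lambda>y. cmod (of_real (K x y) * (u k y - f y)))"
        by (intro integrable_norm integrable_kernel d)
      show "integrable M (\<lambda>y. s / 2 * (cmod (complex_of_real (K x y)))\<^sup>2 + (cmod (u k y - f y))\<^sup>2 / (2 * s))"
        by (intro Bochner_Integration.integrable_add integrable_mult_right integrable_divide L2_integrable d K_L2)
      fix y
      define a b where "a = cmod (complex_of_real (K x y))" and "b = cmod (u k y - f y)"
      have "0 \<le> (s * a - b)\<^sup>2 / (2 * s)" using s by simp
      also have "\<dots> = s / 2 * a\<^sup>2 + b\<^sup>2 / (2 * s) - a * b" using s by (simp add: field_simps power2_eq_square)
      finally show "cmod (of_real (K x y) * (u k y - f y)) \<le> s / 2 * (cmod (complex_of_real (K x y)))\<^sup>2 + (cmod (u k y - f y))\<^sup>2 / (2 * s)"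
        unfolding norm_mult a_def b_def by simp
    qed
    also have "\<dots> = s / 2 * A + (L2_norm M (\<lambda>y. u k y - f y))\<^sup>2 / (2 * s)"
      unfolding L2_norm_square A_def
      by (subst Bochner_Integration.integral_add) (auto intro!: integrable_mult_right integrable_divide L2_integrable d K_L2 simp del: norm_of_real)
    finally show ?thesis .
  qed
  show ?thesis
  proof (rule LIMSEQ_I)
    fix e :: real assume e: "e > 0"
    \<comment> \<open>This makes the term with \<open>A\<close> at most \<open>e / 2\<close>; the
      summand 1 covers \<open>A\<close> = 0.\<close>
    define s where "s = e / (A + 1)"
    have s: "s > 0" using e A by (simp add: s_def)
    have "(\<lambda>k. (L2_norm M (\<lambda>y. u k y - f y))\<^sup>2 / (2 * s)) \<longlonglongrightarrow> 0\<^sup>2 / (2 * s)"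
      using assms(3) s by (intro tendsto_intros) auto
    hence "\<forall>\<^sub>F k in sequentially. (L2_norm M (\<lambda>y. u k y - f y))\<^sup>2 / (2 * s) < e / 2"
      using e by (intro order_tendstoD(2)) auto
    then obtain k0 where k0: "\<And>k. k \<ge> k0 \<Longrightarrow> (L2_norm M (\<lambda>y. u k y - f y))\<^sup>2 / (2 * s) < e / 2"
      by (auto simp: eventually_sequentially)
    have "s / 2 * A \<le> e / 2" using e A by (simp add: s_def field_simps)
    thus "\<exists>no. \<forall>k\<ge>no. norm ((LINT y|M. of_real (K x y) * u k y) - (LINT y|M. of_real (K x y) * f y)) < e"
      using bound[OF s] k0 by (intro exI[of _ k0]) (smt (verit) field_sum_of_halves)
  qed
qed

text \<open>Linearity and contractivity carry norm convergence over to the images. The squared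
  differences then tend to 0 in L1, and L1 convergence yields almost everywhere convergence along a
  subsequence.\<close>

lemma T_tendsto_AE_subseq:
  assumes u: "\<And>k. u k \<in> L2 M" and f: "f \<in> L2 M" and lim: "(\<lambda>k. L2_norm M (\<lambda>x. u k x - f x)) \<longlonglongrightarrow> 0"
  obtains r :: "nat \<Rightarrow> nat" where "strict_mono r" "AE x in M. (\<lambda>k. T (u (r k)) x) \<longlonglongrightarrow> T f x"
proof -
  define v where "v k x = (cmod (T (u k) x - T f x))\<^sup>2" for k x
  have L2v: "(\<lambda>x. T (u k) x - T f x) \<in> L2 M" for k by (intro L2_diff T_L2 u f)
  have "L2_norm M (\<lambda>x. T (u k) x - T f x) \<le> L2_norm M (\<lambda>x. u k x - f x)" for k
  proof -
    have "AE x in M. T (u k) x - T f x = T (\<lambda>y. u k y + (- 1) * f y) x"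
      using T_linear[OF u[of k] f, of "- 1"] by auto
    hence "L2_norm M (\<lambda>x. T (u k) x - T f x) = L2_norm M (T (\<lambda>y. u k y + (- 1) * f y))"
      by (intro L2_norm_cong_AE L2_measurable L2v T_L2 L2_add L2_scale u f)
    thus ?thesis using T_contraction[OF L2_diff[OF u[of k] f]] by simp
  qed
  hence "(\<lambda>k. L2_norm M (\<lambda>x. T (u k) x - T f x)) \<longlonglongrightarrow> 0"
    by (intro tendsto_sandwich[OF _ _ tendsto_const lim]) auto
  hence "(\<lambda>k. (L2_norm M (\<lambda>x. T (u k) x - T f x))\<^sup>2) \<longlonglongrightarrow> 0\<^sup>2" by (intro tendsto_intros)
  hence "(\<lambda>k. LINT x|M. norm (v k x)) \<longlonglongrightarrow> 0" by (simp add: L2_norm_square v_def)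
  moreover have "integrable M (v k)" for k unfolding v_def by (intro L2_integrable L2v)
  ultimately obtain r :: "nat \<Rightarrow> nat" where r: "strict_mono r" "AE x in M. (\<lambda>k. v (r k) x) \<longlonglongrightarrow> 0"
    using tendsto_L1_AE_subseq[of M v] by blast
  from r(2) have "AE x in M. (\<lambda>k. T (u (r k)) x) \<longlonglongrightarrow> T f x"
  proof eventually_elim
    case (elim x)
    hence "(\<lambda>k. sqrt (v (r k) x)) \<longlonglongrightarrow> sqrt 0" by (rule tendsto_real_sqrt)
    hence "(\<lambda>k. T (u (r k)) x - T f x) \<longlonglongrightarrow> 0" by (simp add: v_def tendsto_norm_zero_iff)
    thus ?case by (simp add: LIM_zero_iff)
  qed
  thus ?thesis using that r(1) by blast
qed

lemma kernel_domain_limit: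
  assumes u: "\<And>k. u k \<in> kernel_domain M T K" and f: "f \<in> L2 M"
    and lim: "(\<lambda>k. L2_norm M (\<lambda>x. u k x - f x)) \<longlonglongrightarrow> 0"
  shows "f \<in> kernel_domain M T K"
proof -
  have uL2: "u k \<in> L2 M" for k using u by (simp add: kernel_domain_def)
  obtain r :: "nat \<Rightarrow> nat" where r: "strict_mono r" "AE x in M. (\<lambda>k. T (u (r k)) x) \<longlonglongrightarrow> T f x"
    by (rule T_tendsto_AE_subseq[OF uL2 f lim])
  have "AE x in M. \<forall>k. T (u k) x = (LINT y|M. of_real (K x y) * u k y)"
    using u by (simp add: kernel_domain_def AE_all_countable)
  with r(2) have "AE x in M. T f x = (LINT y|M. of_real (K x y) * f y)"
  proof eventually_elim
    case (elim x)
    have "(\<lambda>k. LINT y|M. of_real (K x y) * u (r k) y) \<longlonglongrightarrow> (LINT y|M. of_real (K x y) * f y)"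
      using LIMSEQ_subseq_LIMSEQ[OF kernel_tendsto[OF uL2 f lim, of x] r(1)] by (simp add: o_def)
    thus ?case using elim LIMSEQ_unique by simp
  qed
  thus ?thesis using f by (simp add: kernel_domain_def)
qed

lemma kernel_domain_add_scale:
  assumes f: "f \<in> kernel_domain M T K" and g: "g \<in> kernel_domain M T K"
  shows "(\<lambda>x. f x + c * g x) \<in> kernel_domain M T K"
proof -
  have L: "f \<in> L2 M" "g \<in> L2 M" using f g by (simp_all add: kernel_domain_def)
  have "AE x in M. T f x = (LINT y|M. of_real (K x y) * f y)" "AE x in M. T g x = (LINT y|M. of_real (K x y) * g y)"
    using f g by (simp_all add: kernel_domain_def)
  with T_linear[OF L, of c]
  have "AE x in M. T (\<lambda>y. f y + c * g y) x = (LINT y|M. of_real (K x y) * (f y + c * g y))"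
  proof eventually_elim
    case (elim x)
    have "(LINT y|M. of_real (K x y) * (f y + c * g y))
        = (LINT y|M. of_real (K x y) * f y + c * (of_real (K x y) * g y))"
      by (simp add: algebra_simps)
    also have "\<dots> = (LINT y|M. of_real (K x y) * f y) + c * (LINT y|M. of_real (K x y) * g y)"
      using integrable_kernel L by simp
    finally show ?case using elim by simp
  qed
  thus ?thesis using L by (auto simp: kernel_domain_def intro: L2_add L2_scale)
qed

lemma kernel_domain_zero: "(\<lambda>x. 0) \<in> kernel_domain M T K"
proof -
  have "AE x in M. T (\<lambda>y. 0) x = 0"
    \<comment> \<open>With both functions zero and c = 1, linearity reads T 0 = T 0 + T 0 almost
      everywhere.\<close>
    using T_linear[OF L2_zero L2_zero, of 1] by auto
  thus ?thesis by (simp add: kernel_domain_def L2_zero)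
qed

lemma kernel_domain_scale: "g \<in> kernel_domain M T K \<Longrightarrow> (\<lambda>x. c * g x) \<in> kernel_domain M T K"
  using kernel_domain_add_scale[OF kernel_domain_zero, of g c] by simp

lemma kernel_domain_add: "f \<in> kernel_domain M T K \<Longrightarrow> g \<in> kernel_domain M T K \<Longrightarrow> (\<lambda>x. f x + g x) \<in> kernel_domain M T K"
  using kernel_domain_add_scale[of f g 1] by simp

lemma kernel_domain_diff: "f \<in> kernel_domain M T K \<Longrightarrow> g \<in> kernel_domain M T K \<Longrightarrow> (\<lambda>x. f x - g x) \<in> kernel_domain M T K"
  using kernel_domain_add_scale[of f g "- 1"] by simp

lemma kernel_domain_sum:
  "(\<And>i. i \<in> I \<Longrightarrow> f i \<in> kernel_domain M T K) \<Longrightarrow> (\<lambda>x. \<Sum>i\<in>I. f i x) \<in> kernel_domain M T K"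
  by (induction I rule: infinite_finite_induct) (auto intro: kernel_domain_add kernel_domain_zero)

end


section \<open>The radial heat kernel\<close>

text \<open>The substitution s = u / t turns Euler's integral for Gamma into this form. It supplies
  the bound on the diagonal and, for v = 1, the integral over time.\<close>

lemma nn_integral_powr_exp:
  assumes "v > -1" "t > (0::real)"
  shows "(\<integral>\<^sup>+s. ennreal (indicator {0<..} s * (s powr v * exp (- t * s))) \<partial>lborel)
         = ennreal (Gamma (v + 1) * t powr (- v - 1))"
proof -
  let ?g = "\<lambda>s::real. ennreal (indicator {0<..} s * (s powr v * exp (- t * s)))"
  have "(\<integral>\<^sup>+s. ?g s \<partial>lborel) = ennreal \<bar>1 / t\<bar> * (\<integral>\<^sup>+u. ?g (0 + (1 / t) * u) \<partial>lborel)"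
    using assms by (intro nn_integral_real_affine) auto
  also have "(\<integral>\<^sup>+u. ?g (0 + (1 / t) * u) \<partial>lborel)
      = (\<integral>\<^sup>+u. ennreal (t powr (- v)) * ennreal (indicator {0..} u * u powr v / exp u) \<partial>lborel)"
  proof (intro nn_integral_cong_AE)
    have "AE u in lborel. u \<noteq> (0::real)" by (rule AE_lborel_singleton)
    thus "AE u in lborel. ?g (0 + (1 / t) * u) = ennreal (t powr (- v)) * ennreal (indicator {0..} u * u powr v / exp u)"
    proof eventually_elim
      case (elim u)
      show ?case
      proof (cases "u > 0")
        case True
        have "(u / t) powr v = t powr (- v) * u powr v"
          using True assms by (simp add: powr_divide powr_minus field_simps)
        thus ?thesis using True assms by (simp add: ennreal_mult' [symmetric] exp_minus field_simps)
      next
        case False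
        hence "u < 0" using elim by simp
        thus ?thesis using assms by (simp add: indicator_def field_simps)
      qed
    qed
  qed
  also have "\<dots> = ennreal (t powr (- v)) * ennreal (Gamma (v + 1))"
    using assms Gamma_conv_nn_integral_real[of "v + 1"] by (subst nn_integral_cmult) auto
  also have "ennreal \<bar>1 / t\<bar> * \<dots> = ennreal (Gamma (v + 1) * t powr (- v - 1))"
    using assms Gamma_real_pos[of "v + 1"]
    by (simp add: ennreal_mult' [symmetric] powr_diff field_simps)
  finally show ?thesis .
qed

text \<open>The one-variable calculus behind the kernel, free of p-adic notions: \<open>a\<close>
  plays the order of the operator, \<open>b\<close> the prime and \<open>n\<close> the dimension.
  The kernel depends on its points only through a distance r.\<close>

locale radial_heat =
  fixes a b :: real and n :: nat
  assumes a_pos: "a > 0" and b_gt1: "b > 1"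
begin

definition level :: "real \<Rightarrow> int" where
  "level s = \<lfloor>log b s / a\<rfloor>"

text \<open>Here \<open>b powi level s\<close> is the quantity \<open>N s\<close> of the introduction.\<close>

definition integrand :: "real \<Rightarrow> real \<Rightarrow> real \<Rightarrow> real" where
  "integrand t r s = indicator {0<..} s * (t * exp (- t * s)) * ((b powi level s) ^ n * indicator {..1} (r * b powi level s))"

definition heat :: "real \<Rightarrow> real \<Rightarrow> real" where
  "heat t r = (LINT s|lborel. integrand t r s)"

abbreviation ratio :: real where "ratio \<equiv> real n / a"

lemma ratio_nonneg: "ratio \<ge> 0"
  using a_pos by simp

lemma ratio_gt: "- 1 < ratio"
  using ratio_nonneg by linarith

lemma level_ge_iff: "s > 0 \<Longrightarrow> k \<le> level s \<longleftrightarrow> b powr (of_int k * a) \<le> s"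
  using a_pos b_gt1 by (simp add: level_def le_floor_iff pos_le_divide_eq le_log_iff)

lemma level_less_iff: "s > 0 \<Longrightarrow> level s < k \<longleftrightarrow> s < b powr (of_int k * a)"
  using level_ge_iff[of s k] by linarith

lemma powi_level_pos [simp]: "b powi level s > 0" "b powi level s \<ge> 0"
  using b_gt1 by simp_all

lemma powi_level_le:
  assumes "s > 0"
  shows "b powi level s \<le> s powr (1 / a)"
proof -
  have "b powr (of_int (level s) * a) \<le> s" using level_ge_iff[OF assms, of "level s"] by simp
  hence "(b powr (of_int (level s) * a)) powr (1 / a) \<le> s powr (1 / a)"
    using a_pos by (intro powr_mono2) auto
  thus ?thesis using a_pos b_gt1 by (simp add: powr_powr powr_real_of_int')
qed

lemma powi_level_ge:
  assumes "s > 0"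
  shows "s powr (1 / a) \<le> b * b powi level s"
proof -
  have "s \<le> b powr (of_int (level s + 1) * a)" using level_less_iff[OF assms, of "level s + 1"] by simp
  hence "s powr (1 / a) \<le> (b powr (of_int (level s + 1) * a)) powr (1 / a)"
    using a_pos assms by (intro powr_mono2) auto
  also have "\<dots> = b powr of_int (level s + 1)" using a_pos by (simp add: powr_powr)
  also have "\<dots> = b powi (level s + 1)" using b_gt1 by (intro powr_real_of_int') auto
  also have "\<dots> = b * b powi level s" using b_gt1 by (simp add: power_int_add)
  finally show ?thesis .
qed

lemma powi_level_power_le: "s > 0 \<Longrightarrow> (b powi level s) ^ n \<le> s powr ratio"
proof -
  assume s: "s > 0"
  have "(b powi level s) ^ n \<le> (s powr (1 / a)) ^ n"
    by (intro power_mono powi_level_le s) auto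
  also have "\<dots> = s powr ratio" using s by (simp add: powr_powr flip: powr_realpow)
  finally show ?thesis .
qed

lemma measurable_level [measurable]: "level \<in> borel \<rightarrow>\<^sub>M count_space UNIV"
proof -
  have "(\<lambda>s. \<lfloor>log b s / a\<rfloor>) \<in> borel \<rightarrow>\<^sub>M count_space UNIV" by measurable
  thus ?thesis unfolding level_def[abs_def] .
qed

lemma measurable_powi_level [measurable]: "(\<lambda>s. b powi level s) \<in> borel_measurable borel"
  by (rule measurable_compose[OF measurable_level]) simp

lemma measurable_integrand [measurable]: "(\<lambda>s. integrand t r s) \<in> borel_measurable borel"
  unfolding integrand_def by measurable

lemma integrand_nonneg: "t \<ge> 0 \<Longrightarrow> integrand t r s \<ge> 0"
  by (simp add: integrand_def)

lemma integrand_le: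
  assumes "t \<ge> 0"
  shows "integrand t r s \<le> t * (indicator {0<..} s * (s powr ratio * exp (- t * s)))"
proof (cases "s > 0")
  case True
  have "(b powi level s) ^ n * indicator {..1} (r * b powi level s) \<le> s powr ratio * 1"
    using powi_level_power_le[OF True] by (intro mult_mono) (auto simp: indicator_def)
  hence "(t * exp (- t * s)) * ((b powi level s) ^ n * indicator {..1} (r * b powi level s)) \<le> (t * exp (- t * s)) * s powr ratio"
    using assms by (intro mult_left_mono) auto
  thus ?thesis using True by (simp add: integrand_def mult_ac)
qed (simp add: integrand_def)

lemma integrable_powr_exp:
  assumes "t > 0"
  shows "integrable lborel (\<lambda>s::real. indicator {0<..} s * (s powr ratio * exp (- t * s)))"
proof (rule integrableI_nonneg)
  have "(-1::real) < ratio" by (rule ratio_gt)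
  thus "(\<integral>\<^sup>+s. ennreal (indicator {0<..} s * (s powr ratio * exp (- t * s))) \<partial>lborel) < \<infinity>"
    using assms by (subst nn_integral_powr_exp) auto
qed auto

lemma integrable_integrand:
  assumes "t > 0"
  shows "integrable lborel (integrand t r)"
proof (rule Bochner_Integration.integrable_bound)
  show "integrable lborel (\<lambda>s. t * (indicator {0<..} s * (s powr ratio * exp (- t * s))))"
    using integrable_powr_exp[OF assms] by simp
  show "AE s in lborel. norm (integrand t r s) \<le> norm (t * (indicator {0<..} s * (s powr ratio * exp (- t * s))))"
  proof (intro AE_I2)
    fix s
    have "0 \<le> integrand t r s" using assms by (intro integrand_nonneg) simp
    thus "norm (integrand t r s) \<le> norm (t * (indicator {0<..} s * (s powr ratio * exp (- t * s))))"
      using integrand_le[of t r s] assms by simp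
  qed
qed simp

section \<open>Upper and lower bounds for the radial kernel\<close>

lemma ennreal_heat: "t > 0 \<Longrightarrow> ennreal (heat t r) = (\<integral>\<^sup>+s. ennreal (integrand t r s) \<partial>lborel)"
  unfolding heat_def by (intro nn_integral_eq_integral[symmetric] integrable_integrand) (simp_all add: integrand_nonneg)

lemma heat_nonneg: "t \<ge> 0 \<Longrightarrow> heat t r \<ge> 0"
  unfolding heat_def by (intro integral_nonneg_AE) (simp add: integrand_nonneg)

text \<open>Dropping the restriction to balls and bounding \<open>N s\<close> by
  \<open>s powr (1 / a)\<close> leaves a Gamma integral.\<close>

lemma heat_le_diagonal:
  assumes "t > 0"
  shows "heat t r \<le> Gamma (ratio + 1) * t powr (- ratio)"
proof -
  have ratio: "(-1::real) < ratio" by (rule ratio_gt)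
  have G: "Gamma (ratio + 1) > 0" using ratio by (intro Gamma_real_pos) simp
  have "ennreal (heat t r) \<le> (\<integral>\<^sup>+s. ennreal t * ennreal (indicator {0<..} s * (s powr ratio * exp (- t * s))) \<partial>lborel)"
    unfolding ennreal_heat[OF assms] using assms integrand_le[of t r]
    by (intro nn_integral_mono) (simp flip: ennreal_mult')
  also have "\<dots> = ennreal t * ennreal (Gamma (ratio + 1) * t powr (- ratio - 1))"
    unfolding nn_integral_powr_exp[OF ratio assms, symmetric] by (rule nn_integral_cmult) simp
  also have "\<dots> = ennreal (Gamma (ratio + 1) * t powr (- ratio))"
    using assms G by (simp add: powr_diff flip: ennreal_mult')
  finally show ?thesis using G by (simp add: ennreal_le_iff)
qed

text \<open>Only s with r \<open>N s\<close> \<le> 1 contribute, and these satisfy s \<le> S =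
  \<open>(b / r) powr a\<close>. There the exponential is at most 1 and the density at most
  \<open>S powr ratio\<close>, so the interval of length S gives
  \<open>t * S powr (ratio + 1)\<close>.\<close>

lemma heat_le_off_diagonal:
  assumes t: "t > 0" and r: "r > 0"
  shows "heat t r \<le> t * (b / r) powr (real n + a)"
proof -
  define S where "S = (b / r) powr a"
  have S: "S > 0" using r b_gt1 by (simp add: S_def)
  have le: "integrand t r s \<le> t * S powr ratio * indicator {0<..S} s" for s
  proof (cases "s > 0 \<and> r * b powi level s \<le> 1")
    case True
    have "r * s powr (1 / a) \<le> r * (b * b powi level s)"
      using powi_level_ge[of s] True r by (intro mult_left_mono) auto
    also have "\<dots> = b * (r * b powi level s)" by simp
    also have "\<dots> \<le> b * 1" using True b_gt1 by (intro mult_left_mono) auto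
    finally have "s powr (1 / a) \<le> b / r" using r by (simp add: field_simps)
    hence "(s powr (1 / a)) powr a \<le> (b / r) powr a" using a_pos by (intro powr_mono2) auto
    hence sS: "s \<le> S" using True a_pos by (simp add: S_def powr_powr)
    have "exp (- t * s) * (b powi level s) ^ n \<le> 1 * s powr ratio"
      using True t powi_level_power_le[of s] by (intro mult_mono) auto
    also have "\<dots> \<le> S powr ratio" using sS True a_pos by (simp add: powr_mono2)
    finally have "t * (exp (- t * s) * (b powi level s) ^ n) \<le> t * S powr ratio"
      using t by (intro mult_left_mono) auto
    thus ?thesis using True sS by (simp add: integrand_def mult_ac)
  next
    case False
    hence "integrand t r s = 0" by (auto simp: integrand_def indicator_def)
    thus ?thesis using t by simp
  qed
  have "integrable lborel (indicator {0<..S} :: real \<Rightarrow> real)"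
    using S by (intro integrable_real_indicator) auto
  hence "heat t r \<le> (LINT s|lborel. t * S powr ratio * indicator {0<..S} s)"
    unfolding heat_def by (intro integral_mono integrable_integrand t le integrable_mult_right)
  also have "\<dots> = t * (S powr ratio * S powr 1)" using S by simp
  also have "\<dots> = t * S powr (ratio + 1)" by (simp only: powr_add)
  also have "S powr (ratio + 1) = (b / r) powr (a * (ratio + 1))" by (simp add: S_def powr_powr)
  also have "a * (ratio + 1) = real n + a" using a_pos by (simp add: field_simps)
  finally show ?thesis .
qed

lemma heat_upper_bound:
  "\<exists>C>0. \<forall>t>0. \<forall>r\<ge>0. heat t r \<le> C * (t / (t powr (1 / a) + r) powr (real n + a))"
proof -
  define G where "G = Gamma (ratio + 1)"
  define B where "B = b powr (real n + a)"
  define D where "D = 2 powr (real n + a)"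
  have "0 < ratio + 1" using ratio_gt by simp
  hence G: "G > 0" unfolding G_def by (rule Gamma_real_pos)
  have B: "B > 0" and D: "D > 0" using b_gt1 by (simp_all add: B_def D_def)
  have na: "real n + a > 0" using a_pos by simp
  have "heat t r \<le> (D * (G + B)) * (t / (t powr (1 / a) + r) powr (real n + a))" if t: "t > 0" and r: "r \<ge> 0" for t r
  proof -
    define u where "u = t powr (1 / a)"
    have u: "u > 0" using t by (simp add: u_def)
    \<comment> \<open>The larger of \<open>u\<close> and \<open>r\<close> is at least half of their
      sum. This costs the factor \<open>D\<close> and reduces the claim to the diagonal bound
      (constant \<open>G\<close>) and the off-diagonal bound (constant \<open>B\<close>).\<close>
    have large: "t / (D * v powr (real n + a)) \<le> t / (u + r) powr (real n + a)" if "v \<ge> u" "v \<ge> r" for v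
    proof -
      have "(u + r) powr (real n + a) \<le> (2 * v) powr (real n + a)"
        using that u r na by (intro powr_mono2) auto
      also have "\<dots> = D * v powr (real n + a)" using that u by (simp add: D_def powr_mult)
      finally show ?thesis using t u r D that by (intro divide_left_mono) auto
    qed
    show ?thesis
    proof (cases "r \<le> u")
      case True
      have eq: "u powr (real n + a) = t powr (ratio + 1)"
        using a_pos by (simp add: u_def powr_powr field_simps)
      have "heat t r \<le> G * t powr (- ratio)" unfolding G_def by (rule heat_le_diagonal[OF t])
      also have "\<dots> = D * G * (t / (D * u powr (real n + a)))"
        unfolding eq using t D by (simp add: powr_add powr_minus field_simps)
      also have "\<dots> \<le> D * G * (t / (u + r) powr (real n + a))"
        using D G True by (intro mult_left_mono large) auto
      also have "\<dots> \<le> (D * (G + B)) * (t / (u + r) powr (real n + a))"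
        using D G B t by (intro mult_right_mono) auto
      finally show ?thesis by (simp add: u_def)
    next
      case False
      hence r: "r > 0" using u by simp
      have "heat t r \<le> t * (b / r) powr (real n + a)" by (rule heat_le_off_diagonal[OF t r])
      also have "\<dots> = D * B * (t / (D * r powr (real n + a)))"
        using r b_gt1 D by (simp add: powr_divide B_def)
      also have "\<dots> \<le> D * B * (t / (u + r) powr (real n + a))"
        using D B False by (intro mult_left_mono large) auto
      also have "\<dots> \<le> (D * (G + B)) * (t / (u + r) powr (real n + a))"
        using D G B t by (intro mult_right_mono) auto
      finally show ?thesis by (simp add: u_def)
    qed
  qed
  moreover have "D * (G + B) > 0" using D G B by simp
  ultimately show ?thesis by blast
qed

text \<open>It suffices to keep s in [\<sigma> / 2, \<sigma>], where \<sigma> =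
  \<open>\<tau> powr (- a)\<close> and \<tau> = \<open>t powr (1 / a) + r\<close>. There t s \<le>
  1, so the exponential is bounded below, and \<open>N s\<close> \<le> 1 / \<tau>, so the ball
  around one point contains the other.\<close>

lemma heat_lower_bound:
  "\<exists>c>0. \<forall>t>0. \<forall>r\<ge>0. c * (t / (t powr (1 / a) + r) powr (real n + a)) \<le> heat t r"
proof -
  \<comment> \<open>The first factor bounds the exponential, the second comes from
    \<open>N s\<close> \<ge> \<open>s powr (1 / a) / b\<close>, the third from s \<ge> \<sigma> / 2
    together with the interval length \<sigma> / 2.\<close>
  define c where "c = exp (-1) * b powi (- int n) * (1 / 2) powr (ratio + 1)"
  have "c > 0" using b_gt1 by (simp add: c_def)
  moreover have "c * (t / (t powr (1 / a) + r) powr (real n + a)) \<le> heat t r" if t: "t > 0" and r: "r \<ge> 0" for t r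
  proof -
    define \<tau> where "\<tau> = t powr (1 / a) + r"
    define \<sigma> where "\<sigma> = \<tau> powr (- a)"
    have tau: "\<tau> > 0" using t r by (simp add: \<tau>_def add_pos_nonneg)
    have sigma: "\<sigma> > 0" using tau by (simp add: \<sigma>_def)
    have "(t powr (1 / a)) powr a \<le> \<tau> powr a" using a_pos r by (intro powr_mono2) (auto simp: \<tau>_def)
    hence "t \<le> \<tau> powr a" using a_pos t by (simp add: powr_powr)
    hence ts: "t * \<sigma> \<le> 1" using tau by (simp add: \<sigma>_def powr_minus field_simps)
    define L where "L = t * exp (-1) * (b powi (- int n) * (\<sigma> / 2) powr ratio)"
    have le: "L * indicator {\<sigma> / 2..\<sigma>} s \<le> integrand t r s" for s
    proof (cases "s \<in> {\<sigma> / 2..\<sigma>}")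
      case True
      hence s: "s > 0" using sigma by auto
      have "s powr (1 / a) \<le> \<sigma> powr (1 / a)" using True s a_pos by (intro powr_mono2) auto
      also have "\<dots> = inverse \<tau>"
        unfolding \<sigma>_def powr_powr using a_pos tau by (simp add: powr_minus)
      finally have "b powi level s \<le> inverse \<tau>" using powi_level_le[OF s] by simp
      hence "r * b powi level s \<le> \<tau> * inverse \<tau>"
        using r t tau by (intro mult_mono) (auto simp: \<tau>_def)
      hence ind: "r * b powi level s \<le> 1" using tau by simp
      have "t * s \<le> t * \<sigma>" using True t by (intro mult_left_mono) auto
      hence "t * s \<le> 1" using ts by simp
      hence e: "exp (-1) \<le> exp (- t * s)" by simp
      have "(\<sigma> / 2) powr ratio \<le> s powr ratio" using True sigma a_pos by (intro powr_mono2) auto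
      also have "s powr ratio = (s powr (1 / a)) ^ n" using s by (simp add: powr_powr flip: powr_realpow)
      also have "\<dots> \<le> (b * b powi level s) ^ n" by (intro power_mono powi_level_ge s) auto
      also have "\<dots> = b ^ n * (b powi level s) ^ n" by (simp add: power_mult_distrib)
      finally have "b powi (- int n) * (\<sigma> / 2) powr ratio \<le> (b powi level s) ^ n"
        using b_gt1 by (simp add: power_int_minus field_simps)
      hence "t * exp (-1) * (b powi (- int n) * (\<sigma> / 2) powr ratio) \<le> t * exp (- t * s) * (b powi level s) ^ n"
        using e t b_gt1 by (intro mult_mono) auto
      thus ?thesis using True s ind by (simp add: L_def integrand_def)
    next
      case False
      thus ?thesis using t integrand_nonneg[of t r s] by simp
    qed
    have "c * (t / \<tau> powr (real n + a)) = L * (\<sigma> / 2)"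
    proof -
      have "- a * (ratio + 1) = - (real n + a)" using a_pos by (simp add: field_simps)
      hence "\<sigma> powr (ratio + 1) = \<tau> powr (- (real n + a))"
        by (simp only: \<sigma>_def powr_powr)
      hence 1: "\<sigma> powr (ratio + 1) = 1 / \<tau> powr (real n + a)" by (simp only: powr_minus_divide)
      have "(\<sigma> / 2) powr ratio * (\<sigma> / 2) = (\<sigma> / 2) powr (ratio + 1)" using sigma by (simp add: powr_add)
      also have "\<dots> = (1 / 2) powr (ratio + 1) * \<sigma> powr (ratio + 1)"
        using sigma by (simp add: powr_divide)
      finally have 2: "(\<sigma> / 2) powr ratio * (\<sigma> / 2) = (1 / 2) powr (ratio + 1) * (1 / \<tau> powr (real n + a))"
        unfolding 1 .
      have "L * (\<sigma> / 2) = t * exp (-1) * b powi (- int n) * ((\<sigma> / 2) powr ratio * (\<sigma> / 2))"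
        by (simp only: L_def mult_ac)
      also have "\<dots> = c * (t / \<tau> powr (real n + a))"
        unfolding 2 c_def by (simp only: mult_ac divide_inverse mult_1_left)
      finally show ?thesis ..
    qed
    also have "\<dots> = (LINT s|lborel. L * indicator {\<sigma> / 2..\<sigma>} s)" using sigma by simp
    also have "\<dots> \<le> heat t r"
    proof -
      have "integrable lborel (indicator {\<sigma> / 2..\<sigma>} :: real \<Rightarrow> real)"
        using sigma by (intro integrable_real_indicator) auto
      thus ?thesis
        unfolding heat_def by (intro integral_mono integrable_integrand t le integrable_mult_right)
    qed
    finally show ?thesis by (simp add: \<tau>_def)
  qed
  ultimately show ?thesis by blast
qed

text \<open>The kernel is a step function of the distance, so convergence of distances would not
  suffice. The hypothesis asks instead that for each s the membership in the ball eventually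
  stabilises; dominated convergence does the rest.\<close>

lemma heat_tendsto:
  assumes t: "t > 0" and lim: "T \<longlonglongrightarrow> t"
    and R: "\<And>s. s > 0 \<Longrightarrow> \<forall>\<^sub>F k in sequentially. R k * b powi level s \<le> 1 \<longleftrightarrow> r * b powi level s \<le> 1"
  shows "(\<lambda>k. heat (T k) (R k)) \<longlonglongrightarrow> heat t r"
proof -
  \<comment> \<open>Trapping the times between t / 2 and 2 t yields one majorant: 2 t bounds the
    prefactor and t / 2 governs the exponential decay.\<close>
  have "\<forall>\<^sub>F k in sequentially. t / 2 < T k \<and> T k < 2 * t"
    using t by (intro eventually_conj order_tendstoD(1)[OF lim] order_tendstoD(2)[OF lim]) auto
  then obtain k0 where k0: "\<And>k. k \<ge> k0 \<Longrightarrow> t / 2 < T k \<and> T k < 2 * t"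
    by (auto simp: eventually_sequentially)
  have "(\<lambda>k. heat (T (k + k0)) (R (k + k0))) \<longlonglongrightarrow> heat t r"
    unfolding heat_def
  proof (rule integral_dominated_convergence)
    show "integrable lborel (\<lambda>s. 2 * t * (indicator {0<..} s * (s powr ratio * exp (- (t / 2) * s))))"
      using integrable_powr_exp[of "t / 2"] t by simp
    show "AE s in lborel. (\<lambda>k. integrand (T (k + k0)) (R (k + k0)) s) \<longlonglongrightarrow> integrand t r s"
    proof (intro AE_I2)
      fix s :: real
      show "(\<lambda>k. integrand (T (k + k0)) (R (k + k0)) s) \<longlonglongrightarrow> integrand t r s"
      proof (cases "s > 0")
        case True
        have "\<forall>\<^sub>F k in sequentially. indicator {..1} (R k * b powi level s) = (indicator {..1} (r * b powi level s) :: real)"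
          using R[OF True] by eventually_elim (simp add: indicator_def)
        hence "(\<lambda>k. indicator {..1} (R k * b powi level s) :: real) \<longlonglongrightarrow> indicator {..1} (r * b powi level s)"
          by (rule tendsto_eventually)
        hence "(\<lambda>k. integrand (T k) (R k) s) \<longlonglongrightarrow> integrand t r s"
          unfolding integrand_def by (intro tendsto_intros lim)
        thus ?thesis by (rule LIMSEQ_ignore_initial_segment)
      qed (simp add: integrand_def)
    qed
    fix k
    show "AE s in lborel. norm (integrand (T (k + k0)) (R (k + k0)) s)
        \<le> 2 * t * (indicator {0<..} s * (s powr ratio * exp (- (t / 2) * s)))"
    proof (intro AE_I2)
      fix s :: real
      have T: "t / 2 < T (k + k0)" "T (k + k0) < 2 * t" using k0[of "k + k0"] by auto
      have "norm (integrand (T (k + k0)) (R (k + k0)) s) = integrand (T (k + k0)) (R (k + k0)) s"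
        using T t by (simp add: integrand_nonneg)
      also have "\<dots> \<le> T (k + k0) * (indicator {0<..} s * (s powr ratio * exp (- T (k + k0) * s)))"
        using T t by (intro integrand_le) simp
      also have "\<dots> \<le> 2 * t * (indicator {0<..} s * (s powr ratio * exp (- (t / 2) * s)))"
      proof (cases "s > 0")
        case True
        thus ?thesis using T t mult_right_mono[of "t / 2" "T (k + k0)" s] by (intro mult_mono) auto
      qed simp
      finally show "norm (integrand (T (k + k0)) (R (k + k0)) s)
        \<le> 2 * t * (indicator {0<..} s * (s powr ratio * exp (- (t / 2) * s)))" .
    qed
  qed auto
  thus ?thesis by (rule LIMSEQ_offset)
qed

section \<open>The integral of the kernel over all times\<close>

lemma nn_integral_heat_time:
  "(\<integral>\<^sup>+t\<in>{0<..}. ennreal (heat t r) \<partial>lborel)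
    = (\<integral>\<^sup>+s. ennreal (indicator {0<..} s * s powr (-2) * ((b powi level s) ^ n * indicator {..1} (r * b powi level s))) \<partial>lborel)"
proof -
  let ?w = "\<lambda>s. (b powi level s) ^ n * indicator {..1} (r * b powi level s) :: real"
  have "(\<integral>\<^sup>+t\<in>{0<..}. ennreal (heat t r) \<partial>lborel)
      = (\<integral>\<^sup>+t. (\<integral>\<^sup>+s. ennreal (indicator {0<..} t * integrand t r s) \<partial>lborel) \<partial>lborel)"
    by (intro nn_integral_cong) (auto simp: ennreal_heat indicator_def)
  \<comment> \<open>By Tonelli the time integral comes first; it turns the weight t exp(-t s) into
    Gamma(2) / s^2.\<close>
  also have "\<dots> = (\<integral>\<^sup>+s. (\<integral>\<^sup>+t. ennreal (indicator {0<..} t * integrand t r s) \<partial>lborel) \<partial>lborel)"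
    unfolding integrand_def by (rule lborel_pair.Fubini'[symmetric]) measurable
  also have "\<dots> = (\<integral>\<^sup>+s. ennreal (indicator {0<..} s * s powr (-2) * ?w s) \<partial>lborel)"
  proof (intro nn_integral_cong)
    fix s :: real
    show "(\<integral>\<^sup>+t. ennreal (indicator {0<..} t * integrand t r s) \<partial>lborel) = ennreal (indicator {0<..} s * s powr (-2) * ?w s)"
    proof (cases "s > 0")
      case True
      have w: "?w s \<ge> 0" by simp
      have "(\<integral>\<^sup>+t. ennreal (indicator {0<..} t * integrand t r s) \<partial>lborel)
          = (\<integral>\<^sup>+t. ennreal (?w s) * ennreal (indicator {0<..} t * (t powr 1 * exp (- s * t))) \<partial>lborel)"
        using True by (intro nn_integral_cong) (auto simp: integrand_def indicator_def mult_ac simp flip: ennreal_mult')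
      also have "\<dots> = ennreal (?w s) * ennreal (Gamma (1 + 1) * s powr (- 1 - 1))"
        using True by (subst nn_integral_cmult, simp, subst nn_integral_powr_exp) auto
      also have "\<dots> = ennreal (indicator {0<..} s * s powr (-2) * ?w s)"
        using True w Gamma_fact[of 1, where 'a=real] by (simp add: mult_ac flip: ennreal_mult')
      finally show ?thesis .
    qed (simp add: integrand_def)
  qed
  finally show ?thesis .
qed

lemma nn_integral_inverse_square:
  assumes "0 < u" "u < v"
  shows "(\<integral>\<^sup>+s. ennreal (s powr (-2)) * indicator {u..<v} s \<partial>lborel) = ennreal (1 / u - 1 / v)"
proof -
  have "(\<integral>\<^sup>+s. ennreal (s powr (-2)) * indicator {u..<v} s \<partial>lborel)
      = (\<integral>\<^sup>+s. ennreal (s powr (-2)) * indicator {u..v} s \<partial>lborel)"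
    using AE_lborel_singleton[of v] by (intro nn_integral_cong_AE) (auto simp: indicator_def)
  also have "\<dots> = ennreal (- 1 / v - (- 1 / u))"
  proof (rule nn_integral_FTC_Icc)
    fix s assume s: "s \<in> {u..v}"
    show "((\<lambda>s. - 1 / s) has_real_derivative s powr (- 2)) (at s)"
      using s assms by (auto intro!: derivative_eq_intros simp: powr_minus power2_eq_square field_simps)
  qed (use assms in auto)
  finally show ?thesis by simp
qed

text \<open>On the set of level l the density is constant and the integral of 1 / s^2 is elementary,
  giving (1 - b^(-a)) b^(l (n - a)). Summing over l \<le> -k is a geometric series of ratio b^(a -
  n), which is below 1 exactly because a < n.\<close>

lemma nn_integral_heat_time_eq:
  assumes "a < real n"
  shows "(\<integral>\<^sup>+t\<in>{0<..}. ennreal (heat t (b powi k)) \<partial>lborel)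
    = ennreal ((1 - b powr (- a)) / (1 - b powr (a - real n)) * (1 / (b powi k) powr (real n - a)))"
proof -
  \<comment> \<open>\<open>I i\<close> is the set of positive s of level -k - i, so i counts how far
    the ball exceeds the smallest one joining points at distance b^k.\<close>
  define I where "I i = {b powr (of_int (- k - int i) * a)..<b powr (of_int (- k - int i + 1) * a)}" for i :: nat
  have level_I: "s > 0 \<and> level s = - k - int i \<longleftrightarrow> s \<in> I i" for s i
  proof
    assume "s > 0 \<and> level s = - k - int i"
    thus "s \<in> I i" using level_ge_iff[of s "- k - int i"] level_less_iff[of s "- k - int i + 1"] by (auto simp: I_def)
  next
    assume s: "s \<in> I i"
    moreover have "b powr (of_int (- k - int i) * a) > 0" using b_gt1 by simp
    ultimately have "s > 0" unfolding I_def by (metis atLeastLessThan_iff less_le_trans)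
    thus "s > 0 \<and> level s = - k - int i"
      using s level_ge_iff[of s "- k - int i"] level_less_iff[of s "- k - int i + 1"] by (auto simp: I_def)
  qed
  let ?g = "\<lambda>i s. ennreal ((b powi (- k - int i)) ^ n) * (ennreal (s powr (-2)) * indicator (I i) s)"
  have le_iff: "b powi k * b powi l \<le> 1 \<longleftrightarrow> l \<le> - k" for l
  proof -
    have "b powi k * b powi l = b powi (k + l)" using b_gt1 by (simp add: power_int_add)
    moreover have "b powi (k + l) \<le> b powi 0 \<longleftrightarrow> k + l \<le> 0"
      using b_gt1 power_int_strict_increasing[of 0 "k + l" b] power_int_increasing[of "k + l" 0 b] by (metis less_imp_le linorder_not_less)
    ultimately show ?thesis by auto
  qed
  have "(\<integral>\<^sup>+t\<in>{0<..}. ennreal (heat t (b powi k)) \<partial>lborel) = (\<integral>\<^sup>+s. (\<Sum>i. ?g i s) \<partial>lborel)"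
    unfolding nn_integral_heat_time
  proof (intro nn_integral_cong)
    fix s :: real
    show "ennreal (indicator {0<..} s * s powr (-2) * ((b powi level s) ^ n * indicator {..1} (b powi k * b powi level s))) = (\<Sum>i. ?g i s)"
    proof (cases "s > 0 \<and> level s \<le> - k")
      case True
      define j where "j = nat (- k - level s)"
      have lev: "level s = - k - int j" using True by (simp add: j_def)
      have "?g i s = (if i = j then ennreal (s powr (-2) * (b powi level s) ^ n) else 0)" for i
        using level_I[of s i] True lev by (auto simp: indicator_def mult_ac simp flip: ennreal_mult')
      hence "(\<Sum>i. ?g i s) = ennreal (s powr (-2) * (b powi level s) ^ n)"
        using sums_unique[OF sums_single[of j "\<lambda>_. ennreal (s powr (-2) * (b powi level s) ^ n)"]] by simp
      thus ?thesis using True le_iff[of "level s"] by simp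
    next
      case False
      hence "?g i s = 0" for i using level_I[of s i] by (auto simp: indicator_def)
      moreover have "indicator {0<..} s * s powr (-2) * ((b powi level s) ^ n * indicator {..1} (b powi k * b powi level s)) = 0"
        using False le_iff[of "level s"] by (auto simp: indicator_def)
      ultimately show ?thesis by (simp only: suminf_zero ennreal_0)
    qed
  qed
  also have "\<dots> = (\<Sum>i. \<integral>\<^sup>+s. ?g i s \<partial>lborel)"
    by (rule nn_integral_suminf) (auto simp: I_def)
  also have "\<dots> = (\<Sum>i. ennreal (((1 - b powr (- a)) * (b powi k) powr (a - real n)) * (b powr (a - real n)) ^ i))"
  proof (intro suminf_cong)
    fix i :: nat
    define l where "l = - k - int i"
    have I: "I i = {b powr (of_int l * a)..<b powr (of_int (l + 1) * a)}" by (simp add: I_def l_def)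
    have "(\<integral>\<^sup>+s. ?g i s \<partial>lborel) = ennreal ((b powi l) ^ n) * ennreal (1 / b powr (of_int l * a) - 1 / b powr (of_int (l + 1) * a))"
      unfolding I l_def[symmetric] using b_gt1 a_pos
      by (subst nn_integral_cmult) (auto intro!: arg_cong2[of _ _ _ _ "(*)"] nn_integral_inverse_square)
    also have "\<dots> = ennreal ((b powi l) ^ n * (1 / b powr (of_int l * a) - 1 / b powr (of_int (l + 1) * a)))"
      using b_gt1 by (simp flip: ennreal_mult')
    also have "(b powi l) ^ n * (1 / b powr (of_int l * a) - 1 / b powr (of_int (l + 1) * a))
        = b powr (of_int l * real n) * (b powr (- of_int l * a) - b powr (- of_int (l + 1) * a))"
    proof -
      have "(b powi l) ^ n = b powr (of_int l * real n)"
        using b_gt1 by (simp add: powr_powr flip: powr_real_of_int' powr_realpow)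
      moreover have "1 / b powr x = b powr (- x)" for x by (simp add: powr_minus_divide)
      ultimately show ?thesis by (simp only: minus_mult_left)
    qed
    also have "\<dots> = (1 - b powr (- a)) * b powr (of_int l * (real n - a))"
      by (simp add: algebra_simps flip: powr_add)
    also have "b powr (of_int l * (real n - a)) = (b powi k) powr (a - real n) * (b powr (a - real n)) ^ i"
    proof -
      have "(b powi k) powr (a - real n) = b powr (of_int k * (a - real n))"
        using b_gt1 by (simp add: powr_powr flip: powr_real_of_int')
      moreover have "(b powr (a - real n)) ^ i = b powr (real i * (a - real n))"
        using b_gt1 by (simp add: powr_powr mult.commute flip: powr_realpow)
      ultimately show ?thesis by (simp add: l_def algebra_simps flip: powr_add)
    qed
    finally show "(\<integral>\<^sup>+s. ?g i s \<partial>lborel) = ennreal (((1 - b powr (- a)) * (b powi k) powr (a - real n)) * (b powr (a - real n)) ^ i)"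
      by (simp add: mult.assoc)
  qed
  also have "\<dots> = ennreal (((1 - b powr (- a)) * (b powi k) powr (a - real n)) * (1 / (1 - b powr (a - real n))))"
  proof (rule suminf_ennreal_eq)
    have "b powr (a - real n) < 1" using b_gt1 assms powr_less_cancel_iff[of b "a - real n" 0] by simp
    thus "(\<lambda>i. ((1 - b powr (- a)) * (b powi k) powr (a - real n)) * (b powr (a - real n)) ^ i)
        sums (((1 - b powr (- a)) * (b powi k) powr (a - real n)) * (1 / (1 - b powr (a - real n))))"
      by (intro sums_mult geometric_sums) simp
    have "1 - b powr (- a) \<ge> 0" using b_gt1 a_pos powr_less_cancel_iff[of b "- a" 0] by simp
    thus "0 \<le> ((1 - b powr (- a)) * (b powi k) powr (a - real n)) * (b powr (a - real n)) ^ i" for i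
      by simp
  qed
  also have "((1 - b powr (- a)) * (b powi k) powr (a - real n)) * (1 / (1 - b powr (a - real n)))
      = (1 - b powr (- a)) / (1 - b powr (a - real n)) * (1 / (b powi k) powr (real n - a))"
    using powr_minus_divide[of "b powi k" "real n - a"] by simp
  finally show ?thesis .
qed

text \<open>With \<open>c\<close> an eigenvalue this is the multiplier of a wavelet; with
  \<open>c\<close> = 0 it says that the mixture weights have total mass 1.\<close>

lemma integral_exponential_tail:
  fixes t c :: real
  assumes "t > 0" "c \<ge> 0"
  shows "integrable lborel (\<lambda>s. indicator {c..} s * (t * exp (- t * s)))"
    and "(LINT s|lborel. indicator {c..} s * (t * exp (- t * s))) = exp (- t * c)"
proof -
  have "(\<integral>\<^sup>+s. ennreal (t * exp (- t * s)) * indicator {c..} s \<partial>lborel) = ennreal (0 - (- exp (- t * c)))"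
  proof (rule nn_integral_FTC_atLeast)
    show "((\<lambda>s. - exp (- t * s)) has_real_derivative t * exp (- t * s)) (at s)" for s
      by (auto intro!: derivative_eq_intros)
    have "filterlim (\<lambda>s. t * s) at_top at_top"
      using assms by (intro filterlim_tendsto_pos_mult_at_top[OF tendsto_const]) (auto simp: filterlim_ident)
    hence "((\<lambda>s. exp (- (t * s))) \<longlongrightarrow> 0) at_top"
      by (intro filterlim_compose[OF exp_at_bot] filterlim_compose[OF filterlim_uminus_at_bot_at_top])
    thus "((\<lambda>s. - exp (- t * s)) \<longlongrightarrow> 0) at_top"
      using tendsto_minus by fastforce
  qed (use assms in auto)
  moreover have "ennreal (t * exp (- t * s)) * indicator {c..} s = ennreal (indicator {c..} s * (t * exp (- t * s)))" for s
    by (simp add: indicator_def)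
  ultimately have nn: "(\<integral>\<^sup>+s. ennreal (indicator {c..} s * (t * exp (- t * s))) \<partial>lborel) = ennreal (exp (- t * c))"
    by simp
  show int: "integrable lborel (\<lambda>s. indicator {c..} s * (t * exp (- t * s)))"
    using assms nn by (intro integrableI_nonneg) auto
  show "(LINT s|lborel. indicator {c..} s * (t * exp (- t * s))) = exp (- t * c)"
    using nn assms by (subst integral_eq_nn_integral) auto
qed

end


section \<open>The Taibleson semigroup\<close>

lemma wavelet_L2: "wavelet c k \<in> L2 haarn"
  unfolding wavelet_def of_real_diff by (intro L2_diff ball_avg_L2)

lemma taibleson_wavelet:
  fixes c :: "'n::finite \<Rightarrow> 'p::prime_card padic"
  shows "(wavelet c k, \<lambda>x. of_real (real CARD('p) powr (- of_int k * \<alpha>)) * wavelet c k x) \<in> taibleson \<alpha>"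
  unfolding taibleson_def
proof (intro CollectI case_prodI conjI allI)
  let ?l = "real CARD('p) powr (- of_int k * \<alpha>)"
  fix \<zeta> :: "'n \<Rightarrow> 'p padic"
  have "fourier (\<lambda>x. of_real ?l * wavelet c k x) \<zeta> = (LINT x|haarn. of_real ?l * (pairing x \<zeta> * wavelet c k x))"
    unfolding fourier_def by (simp add: mult_ac)
  also have "\<dots> = of_real ?l * fourier (wavelet c k) \<zeta>" by (simp add: fourier_def)
  also have "\<dots> = of_real (vnorm \<zeta> powr \<alpha>) * fourier (wavelet c k) \<zeta>"
  proof (cases "vnorm \<zeta> = real CARD('p) powi (- k)")
    case True
    hence "vnorm \<zeta> = real CARD('p) powr (of_int (- k))"
      using padic_card_gt1[where 'p='p] by (subst powr_real_of_int') auto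
    thus ?thesis by (simp add: powr_powr)
  qed (simp add: fourier_wavelet)
  finally show "fourier (\<lambda>x. of_real ?l * wavelet c k x) \<zeta> = of_real (vnorm \<zeta> powr \<alpha>) * fourier (wavelet c k) \<zeta>" .
qed (simp_all add: wavelet_test_function wavelet_L2 L2_scale)

lemma closure_op_superset:
  assumes "(f, g) \<in> T" "f \<in> L2 M" "g \<in> L2 M"
  shows "(f, g) \<in> closure_op M T"
  unfolding closure_op_def
  by (intro CollectI case_prodI conjI assms(2,3) exI[of _ "\<lambda>_. f"] exI[of _ "\<lambda>_. g"])
     (use assms(1) in \<open>simp_all add: L2_norm_def\<close>)

lemma exp_semigroup_wavelet:
  fixes c :: "'n::finite \<Rightarrow> 'p::prime_card padic"
  assumes "is_exp_semigroup haarn (taibleson \<alpha>) P" "t > 0"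
  shows "AE x in haarn. P t (wavelet c k) x = of_real (exp (- (real CARD('p) powr (- of_int k * \<alpha>)) * t)) * wavelet c k x"
proof (rule semigroup_eigenfunction)
  let ?g = "\<lambda>x. complex_of_real (real CARD('p) powr (- of_int k * \<alpha>)) * wavelet c k x"
  have "(wavelet c k, ?g) \<in> closure_op haarn (taibleson \<alpha>)"
    by (intro closure_op_superset taibleson_wavelet wavelet_L2 L2_scale)
  hence "(wavelet c k, \<lambda>x. - ?g x) \<in> {(f, \<lambda>x. - g x) |f g. (f, g) \<in> closure_op haarn (taibleson \<alpha>)}"
    unfolding mem_Collect_eq by (intro exI[of _ "wavelet c k"] exI[of _ ?g] conjI refl)
  thus "(wavelet c k, \<lambda>x. - ?g x) \<in> generator haarn P"
    using assms(1) unfolding is_exp_semigroup_def by simp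
  show "contraction_semigroup haarn P" using assms(1) unfolding is_exp_semigroup_def by blast
qed (simp_all add: wavelet_L2 assms(2))

text \<open>The norm fails to be locally constant only at 0. Truncating it from below at p^(-m)
  removes this defect, and the truncations converge to the norm.\<close>

lemma measurable_vnorm_diff [measurable]:
  "(\<lambda>y. vnorm (x - y)) \<in> borel_measurable (borel :: ('n::finite \<Rightarrow> 'p::prime_card padic) measure)"
proof (rule borel_measurable_LIMSEQ_real)
  let ?p = "real CARD('p)"
  fix m :: nat
  show "(\<lambda>y. max (vnorm (x - y)) (?p powi (- int m))) \<in> borel_measurable borel"
  proof (intro borel_measurable_continuous_onI vec.continuous_locally_constant exI allI impI)
    fix y y' :: "'n \<Rightarrow> 'p padic" assume *: "vnorm (y' - y) \<le> ?p powi (- int m)"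
    show "max (vnorm (x - y')) (?p powi (- int m)) = max (vnorm (x - y)) (?p powi (- int m))"
      using vec.N_ultra[of "x - y" "y - y'"] vec.N_ultra[of "x - y'" "y' - y"] * vec.N_commute[of y y'] by simp
  qed
next
  let ?p = "real CARD('p)"
  have p1: "?p > 1" by (rule padic_card_gt1)
  fix y :: "'n \<Rightarrow> 'p padic"
  have "(\<lambda>m. ?p powi (- int m)) \<longlonglongrightarrow> 0"
    using LIMSEQ_inverse_realpow_zero[OF p1] by (simp add: power_int_minus)
  hence "(\<lambda>m. max (vnorm (x - y)) (?p powi (- int m))) \<longlonglongrightarrow> max (vnorm (x - y)) 0"
    by (intro tendsto_intros)
  thus "(\<lambda>m. max (vnorm (x - y)) (?p powi (- int m))) \<longlonglongrightarrow> vnorm (x - y)"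
    using vec.N_nonneg[of "x - y"] by (simp add: max_absorb1)
qed

section \<open>Mixtures of ball averages and their action on wavelets\<close>

lemma nn_integral_ball_avg: "(\<integral>\<^sup>+y. ennreal (ball_avg c k y) \<partial>haarn) = 1"
  by (subst nn_integral_eq_integral) (auto simp: ball_avg_def indicator_def)

lemma ball_avg_nonneg [simp]: "ball_avg c k y \<ge> 0"
  by (simp add: ball_avg_def)

text \<open>The wavelet is constant on balls of radius at most p^k. A ball of radius at least p^(k +
  1) either misses its support or contains it, and then the mean value 0 decides. Ball averages
  therefore act on wavelets as projections.\<close>

lemma integral_ball_avg_wavelet:
  fixes x c :: "'n::finite \<Rightarrow> 'p::prime_card padic"
  shows "(LINT y|haarn. of_real (ball_avg x j y) * wavelet c k y) = (if j \<le> k then wavelet c k x else 0)"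
proof (cases "j \<le> k")
  case True
  have "of_real (ball_avg x j y) * wavelet c k y = of_real (ball_avg x j y) * wavelet c k x" for y
  proof (cases "y \<in> vball x j")
    case y: True
    hence "vnorm (y - x) \<le> real CARD('p) powi k" using vec.uball_mono[OF True, of x] by (auto simp: vec.mem_uball)
    thus ?thesis by (simp add: wavelet_locally_constant)
  qed (simp add: ball_avg_def)
  hence "(LINT y|haarn. of_real (ball_avg x j y) * wavelet c k y) = (LINT y|haarn. of_real (ball_avg x j y) * wavelet c k x)"
    by (intro Bochner_Integration.integral_cong refl)
  thus ?thesis using True by simp
next
  case False
  hence "k + 1 \<le> j" by simp
  from vec.uball_nested[OF this, of c x] show ?thesis
  proof
    assume "vball c (k + 1) \<inter> vball x j = {}"
    hence "of_real (ball_avg x j y) * wavelet c k y = 0" for y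
      using wavelet_outside[of y c k] by (cases "y \<in> vball x j") (auto simp: ball_avg_def)
    hence "(LINT y|haarn. of_real (ball_avg x j y) * wavelet c k y) = 0"
      by (intro integral_eq_zero_AE AE_I2)
    thus ?thesis using False by simp
  next
    assume "vball c (k + 1) \<subseteq> vball x j"
    hence "of_real (ball_avg x j y) * wavelet c k y = of_real (1 / (real CARD('p) powi j) ^ CARD('n)) * wavelet c k y" for y
      using wavelet_outside[of y c k] by (cases "y \<in> vball x j") (auto simp: ball_avg_def)
    hence "(LINT y|haarn. of_real (ball_avg x j y) * wavelet c k y)
        = (LINT y|haarn. of_real (1 / (real CARD('p) powi j) ^ CARD('n)) * wavelet c k y)"
      by (intro Bochner_Integration.integral_cong refl)
    also have "\<dots> = of_real (1 / (real CARD('p) powi j) ^ CARD('n)) * (LINT y|haarn. wavelet c k y)"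
      by (rule integral_mult_right_zero)
    finally show ?thesis using False by simp
  qed
qed

lemma cmod_wavelet_le:
  fixes c :: "'n::finite \<Rightarrow> 'p::prime_card padic"
  shows "cmod (wavelet c k x) \<le> 1 / (real CARD('p) powi k) ^ CARD('n) + 1 / (real CARD('p) powi (k + 1)) ^ CARD('n)"
proof -
  have "ball_avg c l x \<le> 1 / (real CARD('p) powi l) ^ CARD('n)" for l
    by (simp add: ball_avg_def indicator_def)
  thus ?thesis
    unfolding wavelet_def norm_of_real using ball_avg_nonneg[of c k x] ball_avg_nonneg[of c "k + 1" x]
    by (smt (verit))
qed

text \<open>The \<open>itself\<close> parameter carries the index type and the prime, which the real
  number \<alpha> does not determine.\<close>

locale taibleson_heat =
  fixes \<alpha> :: real and X :: "('n::finite \<Rightarrow> 'p::prime_card padic) itself"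
  assumes alpha_pos: "\<alpha> > 0"
begin

sublocale radial_heat \<alpha> "real CARD('p)" "CARD('n)"
  by unfold_locales (rule alpha_pos, rule padic_card_gt1)

definition kernel :: "real \<Rightarrow> ('n \<Rightarrow> 'p padic) \<Rightarrow> ('n \<Rightarrow> 'p padic) \<Rightarrow> real" where
  "kernel t x y = heat t (vnorm (x - y))"

lemma integrand_eq_ball_avg:
  fixes x y :: "'n \<Rightarrow> 'p padic"
  shows "integrand t (vnorm (x - y)) s = indicator {0<..} s * (t * exp (- t * s)) * ball_avg x (- level s) y"
proof -
  have pos: "real CARD('p) powi level s > 0" by simp
  have "vnorm (x - y) * real CARD('p) powi level s \<le> 1 \<longleftrightarrow> y \<in> vball x (- level s)"
    using pos by (simp add: vec.mem_uball vec.N_commute[of y x] power_int_minus field_simps)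
  thus ?thesis
    by (simp add: integrand_def ball_avg_def indicator_def power_int_minus power_inverse divide_inverse)
qed

lemma measurable_integrand_pair [measurable]:
  "(\<lambda>z. integrand t (vnorm (x - snd z)) (fst z)) \<in> borel_measurable (lborel \<Otimes>\<^sub>M (haarn :: ('n \<Rightarrow> 'p padic) measure))"
  unfolding integrand_def by measurable

lemma pair_sigma_finite_haarn: "pair_sigma_finite lborel (haarn :: ('n \<Rightarrow> 'p padic) measure)"
  by (simp add: pair_sigma_finite_def sigma_finite_lborel sigma_finite_haarn)

lemma measurable_kernel [measurable]: "kernel t x \<in> borel_measurable borel"
proof -
  have "(\<lambda>z. integrand t (vnorm (x - fst z)) (snd z)) \<in> borel_measurable ((borel :: ('n \<Rightarrow> 'p padic) measure) \<Otimes>\<^sub>M lborel)"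
    unfolding integrand_def by measurable
  thus ?thesis
    unfolding kernel_def[abs_def] heat_def
    by (intro lborel.borel_measurable_lebesgue_integral) (simp add: case_prod_beta)
qed

lemma kernel_nonneg: "t \<ge> 0 \<Longrightarrow> kernel t x y \<ge> 0"
  by (simp add: kernel_def heat_nonneg)

text \<open>Tonelli: each ball density has mass 1, and so do the exponential weights. The semigroup
  is thus conservative, which bounds it at small times in the proof of transience.\<close>

lemma nn_integral_kernel:
  assumes "t > 0"
  shows "(\<integral>\<^sup>+y. ennreal (kernel t x y) \<partial>haarn) = 1"
proof -
  interpret pair_sigma_finite lborel "haarn :: ('n \<Rightarrow> 'p padic) measure" by (rule pair_sigma_finite_haarn)
  have "(\<integral>\<^sup>+y. ennreal (kernel t x y) \<partial>haarn) = (\<integral>\<^sup>+y. (\<integral>\<^sup>+s. ennreal (integrand t (vnorm (x - y)) s) \<partial>lborel) \<partial>haarn)"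
    unfolding kernel_def ennreal_heat[OF assms] ..
  also have "\<dots> = (\<integral>\<^sup>+s. (\<integral>\<^sup>+y. ennreal (integrand t (vnorm (x - y)) s) \<partial>haarn) \<partial>lborel)"
    by (rule Fubini') (simp add: case_prod_beta)
  also have "\<dots> = (\<integral>\<^sup>+s. ennreal (indicator {0..} s * (t * exp (- t * s))) \<partial>lborel)"
  proof (intro nn_integral_cong_AE)
    \<comment> \<open>The two half-lines differ at s = 0, where only the closed one carries a
      nonzero weight.\<close>
    have "AE s in lborel. s \<noteq> (0::real)" by (rule AE_lborel_singleton)
    thus "AE s in lborel. (\<integral>\<^sup>+y. ennreal (integrand t (vnorm (x - y)) s) \<partial>haarn) = ennreal (indicator {0..} s * (t * exp (- t * s)))"
    proof eventually_elim
      case (elim s)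
      have "(\<integral>\<^sup>+y. ennreal (integrand t (vnorm (x - y)) s) \<partial>haarn)
          = (\<integral>\<^sup>+y. ennreal (indicator {0<..} s * (t * exp (- t * s))) * ennreal (ball_avg x (- level s) y) \<partial>haarn)"
        unfolding integrand_eq_ball_avg using assms by (intro nn_integral_cong) (simp add: ennreal_mult')
      also have "\<dots> = ennreal (indicator {0<..} s * (t * exp (- t * s)))"
        by (subst nn_integral_cmult) (simp_all add: nn_integral_ball_avg)
      finally show ?case using elim by (simp add: indicator_def)
    qed
  qed
  also have "\<dots> = ennreal (LINT s|lborel. indicator {0..} s * (t * exp (- t * s)))"
    using integral_exponential_tail(1)[OF assms, of 0] assms by (intro nn_integral_eq_integral) auto
  also have "\<dots> = 1" using integral_exponential_tail(2)[OF assms, of 0] by simp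
  finally show ?thesis .
qed

lemma integrable_kernel [simp]: "t > 0 \<Longrightarrow> integrable haarn (kernel t x)"
  by (rule integrableI_nonneg) (auto simp: kernel_nonneg nn_integral_kernel)

lemma integral_kernel: "t > 0 \<Longrightarrow> (LINT y|haarn. kernel t x y) = 1"
  by (subst integral_eq_nn_integral) (auto simp: kernel_nonneg nn_integral_kernel)

lemma kernel_le: "t > 0 \<Longrightarrow> kernel t x y \<le> Gamma (ratio + 1) * t powr (- ratio)"
  unfolding kernel_def by (rule heat_le_diagonal)

text \<open>A bounded integrable function is square-integrable.\<close>

lemma kernel_L2:
  assumes "t > 0"
  shows "(\<lambda>y. complex_of_real (kernel t x y)) \<in> L2 haarn"
proof -
  have "integrable haarn (\<lambda>y. (kernel t x y)\<^sup>2)"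
  proof (rule Bochner_Integration.integrable_bound)
    show "integrable haarn (\<lambda>y. (Gamma (ratio + 1) * t powr (- ratio)) * kernel t x y)"
      using assms by (intro integrable_mult_right integrable_kernel)
    show "AE y in haarn. norm ((kernel t x y)\<^sup>2) \<le> norm ((Gamma (ratio + 1) * t powr (- ratio)) * kernel t x y)"
    proof (intro AE_I2)
      fix y
      have k0: "0 \<le> kernel t x y" using assms by (intro kernel_nonneg) simp
      have "(kernel t x y)\<^sup>2 \<le> (Gamma (ratio + 1) * t powr (- ratio)) * kernel t x y"
        unfolding power2_eq_square using assms by (intro mult_right_mono kernel_le k0)
      thus "norm ((kernel t x y)\<^sup>2) \<le> norm ((Gamma (ratio + 1) * t powr (- ratio)) * kernel t x y)"
        by simp
    qed
  qed measurable
  thus ?thesis by (simp add: L2_def)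
qed

text \<open>By Fubini each weight is multiplied by a ball average of the wavelet. The average
  reproduces the wavelet when -level s \<le> k, which means s \<ge> \<open>l\<close>, and is 0
  otherwise, leaving the exponential tail from the eigenvalue on.\<close>

lemma kernel_wavelet:
  assumes t: "t > 0"
  shows "(LINT y|haarn. of_real (kernel t x y) * wavelet c k y)
       = of_real (exp (- (real CARD('p) powr (- of_int k * \<alpha>)) * t)) * wavelet c k (x :: 'n \<Rightarrow> 'p padic)"
proof -
  interpret pair_sigma_finite lborel "haarn :: ('n \<Rightarrow> 'p padic) measure" by (rule pair_sigma_finite_haarn)
  define l where "l = real CARD('p) powr (- of_int k * \<alpha>)"
  have l: "l > 0" using padic_card_gt1[where 'p='p] by (simp add: l_def)
  define C where "C = 1 / (real CARD('p) powi k) ^ CARD('n) + 1 / (real CARD('p) powi (k + 1)) ^ CARD('n)"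
  define e where "e s = indicator {0<..} s * (t * exp (- t * s))" for s :: real
  define g where "g s y = complex_of_real (integrand t (vnorm (x - y)) s) * wavelet c k y" for s y
  have e0: "e s \<ge> 0" for s using t by (simp add: e_def)
  have g_eq: "g s y = of_real (e s) * (of_real (ball_avg x (- level s) y) * wavelet c k y)" for s y
    by (simp add: g_def integrand_eq_ball_avg e_def)
  have g_meas [measurable]: "(\<lambda>z. g (fst z) (snd z)) \<in> borel_measurable (lborel \<Otimes>\<^sub>M haarn)"
    unfolding g_def by measurable
  have e_int: "integrable lborel e"
  proof (rule Bochner_Integration.integrable_bound[OF integral_exponential_tail(1)[OF t order_refl]])
    show "AE s in lborel. norm (e s) \<le> norm (indicator {0..} s * (t * exp (- t * s)))"
      using t by (intro AE_I2) (simp add: e_def indicator_def)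
  qed (simp add: e_def[abs_def])
  \<comment> \<open>The supremum \<open>C\<close> of the wavelet is paired with a density of mass 1,
    so the majorant has integral \<open>C * e s\<close> over y, integrable in s.\<close>
  have g_norm: "norm (g s y) \<le> e s * (C * ball_avg x (- level s) y)" for s y
  proof -
    have "cmod (wavelet c k y) * ball_avg x (- level s) y \<le> C * ball_avg x (- level s) y"
      unfolding C_def by (intro mult_right_mono cmod_wavelet_le ball_avg_nonneg)
    hence "e s * (cmod (wavelet c k y) * ball_avg x (- level s) y) \<le> e s * (C * ball_avg x (- level s) y)"
      using e0 by (intro mult_left_mono)
    moreover have "norm (g s y) = e s * (cmod (wavelet c k y) * ball_avg x (- level s) y)"
      unfolding g_eq norm_mult norm_of_real using e0[of s] by simp
    ultimately show ?thesis by simp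
  qed
  have g_int: "integrable haarn (g s)" for s
  proof (rule Bochner_Integration.integrable_bound)
    show "integrable haarn (\<lambda>y. e s * (C * ball_avg x (- level s) y))" by simp
    show "AE y in haarn. norm (g s y) \<le> norm (e s * (C * ball_avg x (- level s) y))"
      using g_norm by (intro AE_I2) (auto intro: order_trans[OF _ abs_ge_self])
    show "g s \<in> borel_measurable haarn" unfolding g_def[abs_def] integrand_eq_ball_avg by measurable
  qed
  have pair: "integrable (lborel \<Otimes>\<^sub>M haarn) (case_prod g)"
  proof (rule Fubini_integrable)
    show "case_prod g \<in> borel_measurable (lborel \<Otimes>\<^sub>M haarn)" using g_meas by (simp add: case_prod_beta')
    show "AE s in lborel. integrable haarn (\<lambda>y. case_prod g (s, y))" using g_int by simp
    show "integrable lborel (\<lambda>s. LINT y|haarn. norm (case_prod g (s, y)))"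
    proof (rule Bochner_Integration.integrable_bound)
      show "integrable lborel (\<lambda>s. C * e s)" using e_int by simp
      have "(\<lambda>z. norm (case_prod g z)) \<in> borel_measurable (lborel \<Otimes>\<^sub>M haarn)"
        using g_meas by (simp add: case_prod_beta')
      thus "(\<lambda>s. LINT y|haarn. norm (case_prod g (s, y))) \<in> borel_measurable lborel"
        by (intro M2.borel_measurable_lebesgue_integral) (simp add: case_prod_beta')
      show "AE s in lborel. norm (LINT y|haarn. norm (case_prod g (s, y))) \<le> norm (C * e s)"
      proof (intro AE_I2)
        fix s :: real
        have "(LINT y|haarn. norm (g s y)) \<le> (LINT y|haarn. e s * (C * ball_avg x (- level s) y))"
          by (intro integral_mono integrable_norm g_int g_norm) simp
        also have "\<dots> = C * e s" by simp
        finally show "norm (LINT y|haarn. norm (case_prod g (s, y))) \<le> norm (C * e s)"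
          using integral_nonneg_AE[of "\<lambda>y. norm (g s y)" haarn] by simp
      qed
    qed
  qed
  have "(LINT y|haarn. of_real (kernel t x y) * wavelet c k y) = (LINT y|haarn. (LINT s|lborel. g s y))"
    unfolding g_def kernel_def heat_def by simp
  also have "\<dots> = (LINT s|lborel. (LINT y|haarn. g s y))" by (rule Fubini_integral[OF pair])
  also have "\<dots> = (LINT s|lborel. of_real (indicator {l..} s * (t * exp (- t * s))) * wavelet c k x)"
  proof (intro Bochner_Integration.integral_cong refl)
    fix s :: real
    have "(LINT y|haarn. g s y) = of_real (e s) * (if - level s \<le> k then wavelet c k x else 0)"
      unfolding g_eq by (simp only: integral_mult_right_zero integral_ball_avg_wavelet)
    moreover have "- level s \<le> k \<longleftrightarrow> l \<le> s" if "s > 0"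
      using level_ge_iff[OF that, of "- k"] by (auto simp: l_def)
    ultimately show "(LINT y|haarn. g s y) = of_real (indicator {l..} s * (t * exp (- t * s))) * wavelet c k x"
      using l by (auto simp: e_def indicator_def)
  qed
  also have "\<dots> = of_real (LINT s|lborel. indicator {l..} s * (t * exp (- t * s))) * wavelet c k x"
    by (simp only: integral_mult_left_zero integral_complex_of_real)
  also have "\<dots> = of_real (exp (- t * l)) * wavelet c k x"
    using integral_exponential_tail(2)[OF t less_imp_le[OF l]] by simp
  finally show ?thesis by (simp add: l_def mult.commute)
qed

text \<open>Away from the diagonal the distance is eventually constant by
  \<open>vec.N_eq_of_close\<close>; on the diagonal it eventually drops below any given radius. In
  both cases membership in each ball stabilises, as \<open>heat_tendsto\<close> requires.\<close>

lemma continuous_kernel: "continuous_kernel kernel"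
  unfolding continuous_kernel_def
proof (rule continuous_on_sequentiallyI, clarsimp simp: case_prod_beta)
  fix u :: "nat \<Rightarrow> real \<times> ('n \<Rightarrow> 'p padic) \<times> ('n \<Rightarrow> 'p padic)" and t x y
  assume t: "t > 0" and lim: "u \<longlonglongrightarrow> (t, x, y)"
  define D where "D k = fst (snd (u k)) - snd (snd (u k))" for k
  have limt: "(\<lambda>k. fst (u k)) \<longlonglongrightarrow> t" using tendsto_fst[OF lim] by simp
  have limx: "(\<lambda>k. fst (snd (u k))) \<longlonglongrightarrow> x" using tendsto_fst[OF tendsto_snd[OF lim]] by simp
  have limy: "(\<lambda>k. snd (snd (u k))) \<longlonglongrightarrow> y" using tendsto_snd[OF tendsto_snd[OF lim]] by simp
  have close: "\<forall>\<^sub>F k in sequentially. vnorm (D k - (x - y)) \<le> real CARD('p) powi m" for m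
  proof -
    have "\<forall>\<^sub>F k in sequentially. fst (snd (u k)) \<in> vball x m"
      using topological_tendstoD[OF limx vec.open_uball vec.centre_in_uball] .
    moreover have "\<forall>\<^sub>F k in sequentially. snd (snd (u k)) \<in> vball y m"
      using topological_tendstoD[OF limy vec.open_uball vec.centre_in_uball] .
    ultimately show ?thesis
    proof eventually_elim
      case (elim k)
      have eq: "D k - (x - y) = (fst (snd (u k)) - x) - (snd (snd (u k)) - y)" by (simp add: D_def algebra_simps)
      have "vnorm (D k - (x - y)) \<le> max (vnorm (fst (snd (u k)) - x)) (vnorm (snd (snd (u k)) - y))"
        unfolding eq by (rule vec.N_diff_ultra)
      thus ?case using elim by (simp add: vec.mem_uball)
    qed
  qed
  have "\<forall>\<^sub>F k in sequentially. vnorm (D k) * real CARD('p) powi level s \<le> 1 \<longleftrightarrow> vnorm (x - y) * real CARD('p) powi level s \<le> 1" for s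
  proof (cases "x = y")
    case True
    have "\<forall>\<^sub>F k in sequentially. vnorm (D k) \<le> real CARD('p) powi (- level s)"
      using close[of "- level s"] True by simp
    thus ?thesis
    proof eventually_elim
      case (elim k)
      hence "vnorm (D k) * real CARD('p) powi level s \<le> 1" by (simp add: power_int_minus field_simps)
      thus ?case using True by (simp add: vec.N_zero)
    qed
  next
    case False
    then obtain l where l: "vnorm (x - y) = real CARD('p) powi l" using vec.N_value[of "x - y"] by auto
    from close[of "l - 1"] show ?thesis
    proof eventually_elim
      case (elim k)
      hence "vnorm (D k - (x - y)) < vnorm (x - y)" unfolding l using vec.N_less_iff[of "D k - (x - y)" "l - 1"] by simp
      thus ?case using vec.N_eq_of_close by metis
    qed
  qed
  from heat_tendsto[OF t limt this] show "(\<lambda>k. kernel (fst (u k)) (fst (snd (u k))) (snd (snd (u k)))) \<longlonglongrightarrow> kernel t x y"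
    by (simp add: kernel_def D_def)
qed

end


section \<open>From wavelets to all square-integrable functions\<close>

lemma indicator_finite_L2:
  assumes "A \<in> sets M" "emeasure M A < \<infinity>"
  shows "(\<lambda>x. complex_of_real (indicator A x)) \<in> L2 M"
proof -
  have "(\<lambda>x. (cmod (complex_of_real (indicator A x)))\<^sup>2) = (indicator A :: _ \<Rightarrow> real)"
    by (auto simp: indicator_def)
  moreover have "integrable M (indicator A :: _ \<Rightarrow> real)" using assms by simp
  ultimately show ?thesis using assms by (simp add: L2_def)
qed

text \<open>Wavelets with a common centre and consecutive radii telescope to the difference of two
  ball densities. The remainder lives on the larger ball and has squared norm 1 over its measure,
  which tends to 0.\<close>

lemma ball_avg_in_kernel_domain:
  fixes c :: "'n::finite \<Rightarrow> 'p::prime_card padic"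
  assumes "L2_kernel haarn T K"
    and wav: "\<And>c k. wavelet (c :: 'n \<Rightarrow> 'p padic) k \<in> kernel_domain haarn T K"
  shows "(\<lambda>x. complex_of_real (ball_avg c k x)) \<in> kernel_domain haarn T K"
proof -
  interpret L2_kernel haarn T K by fact
  let ?p = "real CARD('p)"
  have p1: "?p > 1" by (rule padic_card_gt1)
  define u where "u m x = (\<Sum>i<m. wavelet c (k + int i) x)" for m :: nat and x
  have u_eq: "u m x = of_real (ball_avg c k x - ball_avg c (k + int m) x)" for m x
    by (induction m) (simp_all add: u_def wavelet_def add_ac)
  show ?thesis
  proof (rule kernel_domain_limit)
    show "u m \<in> kernel_domain haarn T K" for m
      unfolding u_def by (intro kernel_domain_sum wav)
    show "(\<lambda>x. complex_of_real (ball_avg c k x)) \<in> L2 haarn" by (rule ball_avg_L2)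
    have "L2_norm haarn (\<lambda>x. u m x - of_real (ball_avg c k x)) = sqrt (inverse (?p powi k) ^ CARD('n) * inverse (?p ^ CARD('n)) ^ m)" for m
    proof -
      have "L2_norm haarn (\<lambda>x. u m x - of_real (ball_avg c k x)) = L2_norm haarn (\<lambda>x. (- 1) * complex_of_real (ball_avg c (k + int m) x))"
        by (simp add: u_eq)
      also have "\<dots> = sqrt (1 / (?p powi (k + int m)) ^ CARD('n))"
        unfolding L2_norm_scale L2_norm_ball_avg by simp
      also have "1 / (?p powi (k + int m)) ^ CARD('n) = inverse (?p powi k) ^ CARD('n) * inverse (?p ^ CARD('n)) ^ m"
        using p1 by (simp add: power_int_add power_mult_distrib divide_inverse power_inverse power_mult[symmetric] mult.commute)
      finally show ?thesis .
    qed
    moreover have "(\<lambda>m. sqrt (inverse (?p powi k) ^ CARD('n) * inverse (?p ^ CARD('n)) ^ m)) \<longlonglongrightarrow> sqrt (inverse (?p powi k) ^ CARD('n) * 0)"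
    proof (intro tendsto_intros LIMSEQ_power_zero)
      have "1 < ?p ^ CARD('n)" using p1 by (intro one_less_power) auto
      thus "norm (inverse (?p ^ CARD('n))) < 1" by (simp add: inverse_less_1_iff del: of_nat_power)
    qed
    ultimately show "(\<lambda>m. L2_norm haarn (\<lambda>x. u m x - of_real (ball_avg c k x))) \<longlonglongrightarrow> 0" by simp
  qed
qed

lemma emeasure_haarn_Int_vball_finite: "emeasure haarn (A \<inter> vball c k) < \<infinity>"
proof -
  have "emeasure haarn (A \<inter> vball c k) \<le> emeasure haarn (vball c k)"
    by (intro emeasure_mono) auto
  also have "\<dots> < \<infinity>" by (simp add: emeasure_haarn_vball)
  finally show ?thesis .
qed

text \<open>Induction over the Dynkin system generated by balls. Intersecting with a fixed ball
  keeps every indicator in L2, in particular that of a complement, which is taken relative to the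
  ball.\<close>

lemma indicator_in_kernel_domain:
  fixes c :: "'n::finite \<Rightarrow> 'p::prime_card padic"
  assumes "L2_kernel haarn T K"
    and wav: "\<And>c k. wavelet (c :: 'n \<Rightarrow> 'p padic) k \<in> kernel_domain haarn T K"
    and "A \<in> sets borel"
  shows "(\<lambda>x. complex_of_real (indicator (A \<inter> vball c R) x)) \<in> kernel_domain haarn T K"
proof -
  interpret L2_kernel haarn T K by fact
  have ball: "(\<lambda>x. complex_of_real (indicator (vball c k) x)) \<in> kernel_domain haarn T K" for c k
  proof -
    have "(\<lambda>x. complex_of_real ((real CARD('p) powi k) ^ CARD('n)) * complex_of_real (ball_avg c k x)) \<in> kernel_domain haarn T K"
      by (intro kernel_domain_scale ball_avg_in_kernel_domain assms(1) wav)
    moreover have "complex_of_real ((real CARD('p) powi k) ^ CARD('n)) * complex_of_real (ball_avg c k x)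
        = complex_of_real (indicator (vball c k) x)" for x
      unfolding of_real_mult[symmetric] ball_avg_def by simp
    ultimately show ?thesis by simp
  qed
  have fin: "(\<lambda>x. complex_of_real (indicator (A \<inter> vball c R) x)) \<in> L2 haarn" if "A \<in> sets borel" for A
    using that by (intro indicator_finite_L2 emeasure_haarn_Int_vball_finite) auto
  have A: "A \<in> sigma_sets UNIV vec.balls" using assms(3) by (simp add: vec.sets_borel_balls)
  have pow: "vec.balls \<subseteq> Pow (UNIV :: ('n \<Rightarrow> 'p padic) set)" by simp
  from vec.Int_stable_balls pow A show ?thesis
  proof (induction rule: sigma_sets_induct_disjoint)
    case (basic A)
    then consider "A = {}" | d k where "A = vball d k" by (auto simp: vec.balls_def)
    thus ?case
    proof cases
      case 2
      from vec.uball_Int[of d k c R] consider "A \<inter> vball c R = {}" | e l where "A \<inter> vball c R = vball e l"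
        unfolding 2 by auto
      thus ?thesis by cases (simp_all add: ball kernel_domain_zero)
    qed (simp add: kernel_domain_zero)
  next
    case empty
    show ?case by (simp add: kernel_domain_zero)
  next
    case (compl A)
    have "complex_of_real (indicator ((UNIV - A) \<inter> vball c R) x)
        = complex_of_real (indicator (vball c R) x) - complex_of_real (indicator (A \<inter> vball c R) x)" for x
      by (auto simp: indicator_def)
    thus ?case using kernel_domain_diff[OF ball[of c R] compl(2)] by simp
  next
    case (union A)
    have A: "A i \<in> sets borel" for i using union(2) by (auto simp: vec.sets_borel_balls)
    have disj: "disjoint_family_on (\<lambda>i. A i \<inter> vball c R) {..<m}" for m
      using union(1) by (auto simp: disjoint_family_on_def)
    have Int: "(\<Union>i. A i) \<inter> vball c R = (\<Union>i. A i \<inter> vball c R)" by auto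
    let ?u = "\<lambda>m x. complex_of_real (indicator (\<Union>i<m. A i \<inter> vball c R) x)"
    have meas: "(\<lambda>x. ?u m x) \<in> borel_measurable haarn" for m
      using A by measurable
    have lim: "(\<lambda>m. ?u m x) \<longlonglongrightarrow> complex_of_real (indicator ((\<Union>i. A i) \<inter> vball c R) x)" for x
      unfolding Int by (intro tendsto_of_real LIMSEQ_indicator_UN)
    have bound: "cmod (?u m x) \<le> 1 * cmod (complex_of_real (indicator ((\<Union>i. A i) \<inter> vball c R) x))" for m x
      by (auto simp: indicator_def)
    have L2: "(\<lambda>x. complex_of_real (indicator ((\<Union>i. A i) \<inter> vball c R) x)) \<in> L2 haarn"
      using A by (intro fin) auto
    show ?case
    proof (rule kernel_domain_limit[OF _ L2 L2_norm_dominated_convergence(2)[OF meas L2 lim bound]])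
      fix m
      have "?u m x = (\<Sum>i<m. complex_of_real (indicator (A i \<inter> vball c R) x))" for x
        by (subst indicator_UN_disjoint[OF _ disj]) auto
      thus "(\<lambda>x. ?u m x) \<in> kernel_domain haarn T K"
        using kernel_domain_sum[of "{..<m}" "\<lambda>i x. complex_of_real (indicator (A i \<inter> vball c R) x)"] union(3) by simp
    qed simp
  qed
qed

text \<open>Simple functions converging to \<open>f\<close> are cut off to growing balls. The cutoff
  makes all level sets finite in measure, and the domination by 2 |f| gives convergence in
  L2.\<close>

lemma L2_in_kernel_domain:
  fixes f :: "('n::finite \<Rightarrow> 'p::prime_card padic) \<Rightarrow> complex"
  assumes "L2_kernel haarn T K"
    and wav: "\<And>c k. wavelet (c :: 'n \<Rightarrow> 'p padic) k \<in> kernel_domain haarn T K"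
    and f: "f \<in> L2 haarn"
  shows "f \<in> kernel_domain haarn T K"
proof -
  interpret L2_kernel haarn T K by fact
  obtain F where F: "\<And>i. simple_function haarn (F i)" "\<And>x. (\<lambda>i. F i x) \<longlonglongrightarrow> f x"
      "\<And>i x. dist (F i x) 0 \<le> 2 * dist (f x) 0"
    using borel_measurable_implies_sequence_metric[OF L2_measurable[OF f], of 0] by auto
  define u where "u i x = complex_of_real (indicator (vball 0 (int i)) x) * F i x" for i x
  have F_meas [measurable]: "F i \<in> borel_measurable haarn" for i
    by (rule borel_measurable_simple_function[OF F(1)])
  have "u i \<in> borel_measurable haarn" for i unfolding u_def by measurable
  moreover have "(\<lambda>i. u i x) \<longlonglongrightarrow> f x" for x
  proof -
    obtain i0 :: nat where i0: "vnorm x < real CARD('p) ^ i0"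
      using real_arch_pow[OF padic_card_gt1[where 'p='p]] by blast
    have "\<forall>\<^sub>F i in sequentially. F i x = u i x"
      using eventually_ge_at_top[of i0]
    proof eventually_elim
      case (elim i)
      have "real CARD('p) ^ i0 \<le> real CARD('p) ^ i"
        using elim padic_card_gt1[where 'p='p] by (intro power_increasing) auto
      thus ?case using i0 by (simp add: u_def vec.mem_uball indicator_def)
    qed
    thus ?thesis using F(2)[of x] by (rule Lim_transform_eventually[rotated])
  qed
  moreover have "cmod (u i x) \<le> 2 * cmod (f x)" for i x
    using F(3)[of i x] by (auto simp: u_def indicator_def)
  ultimately have lim: "(\<lambda>i. L2_norm haarn (\<lambda>x. u i x - f x)) \<longlonglongrightarrow> 0"
    using f by (intro L2_norm_dominated_convergence(2)[of u haarn f 2]) auto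
  have "u i \<in> kernel_domain haarn T K" for i
  proof -
    have fin: "finite (range (F i))" using simple_functionD(1)[OF F(1)[of i]] by simp
    have sets: "F i -` {v} \<in> sets borel" for v
      using simple_functionD(2)[OF F(1)[of i], of "{v}"] by simp
    have "u i x = (\<Sum>v\<in>range (F i). v * complex_of_real (indicator (F i -` {v} \<inter> vball 0 (int i)) x))" for x
    proof -
      have "(\<Sum>v\<in>range (F i). v * complex_of_real (indicator (F i -` {v} \<inter> vball 0 (int i)) x))
          = (\<Sum>v\<in>range (F i). if v = F i x then u i x else 0)"
        by (intro sum.cong refl) (auto simp: u_def indicator_def)
      thus ?thesis using fin by simp
    qed
    hence "u i = (\<lambda>x. \<Sum>v\<in>range (F i). v * complex_of_real (indicator (F i -` {v} \<inter> vball 0 (int i)) x))" by auto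
    also have "\<dots> \<in> kernel_domain haarn T K"
      by (intro kernel_domain_sum kernel_domain_scale indicator_in_kernel_domain assms(1) wav sets)
    finally show ?thesis .
  qed
  thus ?thesis by (rule kernel_domain_limit[OF _ f lim])
qed

section \<open>Transience and the Green function\<close>

lemma nn_integral_powr_at_top_finite:
  assumes "e > (1::real)"
  shows "(\<integral>\<^sup>+t. ennreal (t powr (- e)) * indicator {1..} t \<partial>lborel) < \<infinity>"
proof -
  have "(\<integral>\<^sup>+t. ennreal (t powr (- e)) * indicator {1..} t \<partial>lborel) = ennreal (0 - 1 powr (1 - e) / (1 - e))"
  proof (rule nn_integral_FTC_atLeast[where F = "\<lambda>t. t powr (1 - e) / (1 - e)"])
    show "((\<lambda>t. t powr (1 - e) / (1 - e)) has_real_derivative t powr (- e)) (at t)" if "1 \<le> t" for t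
      using that assms by (auto intro!: derivative_eq_intros)
    have "((\<lambda>t. t powr (1 - e) / (1 - e)) \<longlongrightarrow> 0 / (1 - e)) at_top"
      using assms by (intro tendsto_intros tendsto_neg_powr filterlim_ident) auto
    thus "((\<lambda>t. t powr (1 - e) / (1 - e)) \<longlongrightarrow> 0) at_top" by simp
  qed auto
  thus ?thesis by simp
qed

lemma nn_integral_inverse_at_top_unbounded:
  assumes "c > (0::real)"
  shows "\<not> (\<integral>\<^sup>+t. ennreal (c / t) * indicator {1..} t \<partial>lborel) \<le> ennreal C"
proof
  assume le: "(\<integral>\<^sup>+t. ennreal (c / t) * indicator {1..} t \<partial>lborel) \<le> ennreal C"
  \<comment> \<open>Chosen so that \<open>c * ln T\<close> equals \<open>max C 0 + 1\<close>, which
    exceeds the bound; the maximum accounts for a negative \<open>C\<close>.\<close>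
  define T where "T = exp ((max C 0 + 1) / c)"
  have T: "T \<ge> 1" using assms by (simp add: T_def)
  have "ennreal (c * ln T - c * ln 1) = (\<integral>\<^sup>+t. ennreal (c / t) * indicator {1..T} t \<partial>lborel)"
    using T assms by (intro nn_integral_FTC_Icc[symmetric]) (auto intro!: derivative_eq_intros)
  also have "\<dots> \<le> (\<integral>\<^sup>+t. ennreal (c / t) * indicator {1..} t \<partial>lborel)"
    by (intro nn_integral_mono) (auto simp: indicator_def)
  also have "\<dots> \<le> ennreal (max C 0)" by (intro order_trans[OF le] ennreal_leI) simp
  finally have "c * ln T \<le> max C 0" by (simp add: ennreal_le_iff)
  thus False using assms by (simp add: T_def)
qed

context taibleson_heat
begin

lemma kernel_bounds:
  "\<exists>c>0. \<exists>C>0. \<forall>t>0. \<forall>x y.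
      c * (t / (t powr (1 / \<alpha>) + vnorm (x - y)) powr (real CARD('n) + \<alpha>)) \<le> kernel t x y
      \<and> kernel t x y \<le> C * (t / (t powr (1 / \<alpha>) + vnorm (x - y)) powr (real CARD('n) + \<alpha>))"
  unfolding kernel_def using heat_lower_bound heat_upper_bound vec.N_nonneg by meson

lemma heat_kernel_kernel:
  assumes "is_exp_semigroup haarn (taibleson \<alpha>) P"
  shows "heat_kernel haarn P kernel"
  unfolding heat_kernel_def
proof (intro allI impI ballI)
  fix t :: real and f :: "('n \<Rightarrow> 'p padic) \<Rightarrow> complex"
  assume t: "t > 0" and f: "f \<in> L2 haarn"
  have S: "contraction_semigroup haarn P" using assms by (simp add: is_exp_semigroup_def)
  have contr: "\<forall>t\<ge>0. \<forall>f\<in>L2 haarn. P t f \<in> L2 haarn \<and> L2_norm haarn (P t f) \<le> L2_norm haarn f"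
    using S unfolding contraction_semigroup_def by (elim conjE)
  have lin: "\<forall>t\<ge>0. \<forall>f\<in>L2 haarn. \<forall>g\<in>L2 haarn. \<forall>c. AE x in haarn. P t (\<lambda>y. f y + c * g y) x = P t f x + c * P t g x"
    using S unfolding contraction_semigroup_def by (elim conjE)
  interpret L2_kernel haarn "P t" "kernel t"
  proof
    fix f g :: "('n \<Rightarrow> 'p padic) \<Rightarrow> complex" and c
    assume fg: "f \<in> L2 haarn"
    show "P t f \<in> L2 haarn" "L2_norm haarn (P t f) \<le> L2_norm haarn f"
      using contr t fg by simp_all
    assume "g \<in> L2 haarn"
    thus "AE x in haarn. P t (\<lambda>y. f y + c * g y) x = P t f x + c * P t g x"
      using lin t fg by simp
  qed (rule kernel_L2[OF t])
  have wav: "wavelet c k \<in> kernel_domain haarn (P t) (kernel t)" for c :: "'n \<Rightarrow> 'p padic" and k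
    using exp_semigroup_wavelet[OF assms t, of c k]
    by (simp add: kernel_domain_def wavelet_L2 kernel_wavelet[OF t])
  have "f \<in> kernel_domain haarn (P t) (kernel t)"
    by (rule L2_in_kernel_domain[OF L2_kernel_axioms wav f])
  thus "AE x in haarn. integrable haarn (\<lambda>y. of_real (kernel t x y) * f y) \<and> P t f x = (LINT y|haarn. of_real (kernel t x y) * f y)"
    using L2_kernel.integrable_kernel[OF L2_kernel_axioms f] by (simp add: kernel_domain_def)
qed

lemma green_kernel:
  assumes "\<alpha> < real CARD('n)" "x \<noteq> y"
  shows "green kernel x y
    = ennreal ((1 - real CARD('p) powr (- \<alpha>)) / (1 - real CARD('p) powr (\<alpha> - real CARD('n)))
               * (1 / vnorm (x - y) powr (real CARD('n) - \<alpha>)))"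
proof -
  obtain k where "vnorm (x - y) = real CARD('p) powi k" using vec.N_value[of "x - y"] assms(2) by auto
  thus ?thesis using nn_integral_heat_time_eq[OF assms(1), of k] by (simp add: green_def kernel_def)
qed

text \<open>Before time 1 conservativeness bounds the semigroup by the supremum of \<open>f\<close>.
  From time 1 on, the bound by a multiple of \<open>t powr (- ratio)\<close> times the measure of a
  cover of the support is integrable, since ratio > 1.\<close>

lemma transient_kernel:
  assumes "\<alpha> < real CARD('n)"
  shows "transient haarn kernel"
  unfolding transient_def
proof (intro allI impI, elim conjE)
  fix f :: "('n \<Rightarrow> 'p padic) \<Rightarrow> real"
  assume f_meas [measurable]: "f \<in> borel_measurable borel" and f0: "\<forall>x. 0 \<le> f x"
    and "bounded (range f)" and cpt: "compact (closure {x. f x \<noteq> 0})"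
  then obtain B where B: "\<And>x. f x \<le> B" "B > 0"
    unfolding bounded_pos by (metis UNIV_I abs_le_D1 image_eqI real_norm_def)
  have cover: "closure {x. f x \<noteq> 0} \<subseteq> (\<Union>c\<in>UNIV. vball c 0)"
    using vec.centre_in_uball by blast
  obtain S where "S \<subseteq> UNIV" and S: "finite S" "closure {x. f x \<noteq> 0} \<subseteq> (\<Union>c\<in>S. vball c 0)"
    by (rule compactE_image[OF cpt vec.open_uball cover])
  \<comment> \<open>A finite union of unit balls has finite measure, so \<open>B\<close> times its
    indicator is an integrable majorant of \<open>f\<close>.\<close>
  define V where "V = (\<Union>c\<in>S. vball c 0)"
  have V [measurable]: "V \<in> sets borel" using S(1) by (auto simp: V_def)
  have V_fin: "emeasure haarn V < \<infinity>"
  proof -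
    have "emeasure haarn V \<le> (\<Sum>c\<in>S. emeasure haarn (vball c 0))"
      unfolding V_def using S(1) by (intro emeasure_subadditive_finite) auto
    also have "\<dots> < \<infinity>" by (simp add: emeasure_haarn_vball ennreal_of_nat_eq_real_of_nat)
    finally show ?thesis .
  qed
  have supp: "f y \<le> B * indicator V y" for y
    using S(2) closure_subset[of "{x. f x \<noteq> 0}"] B by (cases "f y = 0") (auto simp: V_def indicator_def)
  define G where "G = Gamma (ratio + 1)"
  have G: "G > 0" unfolding G_def using ratio_gt by (intro Gamma_real_pos) simp
  have int: "integrable haarn (\<lambda>y. kernel t x y * f y)" if t: "t > 0" for t x
  proof (rule Bochner_Integration.integrable_bound)
    show "integrable haarn (\<lambda>y. B * kernel t x y)" using t by simp
    show "AE y in haarn. norm (kernel t x y * f y) \<le> norm (B * kernel t x y)"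
      using B f0 t kernel_nonneg[of t x] by (intro AE_I2) (simp add: abs_mult mult.commute mult_right_mono)
  qed measurable
  have near: "(LINT y|haarn. kernel t x y * f y) \<le> B" if t: "t > 0" for t x
  proof -
    have "(LINT y|haarn. kernel t x y * f y) \<le> (LINT y|haarn. B * kernel t x y)"
      using int t B(1) by (intro integral_mono) (auto simp: mult.commute kernel_nonneg intro!: mult_right_mono)
    thus ?thesis using t by (simp add: integral_kernel)
  qed
  define m where "m = measure haarn V"
  have far: "(LINT y|haarn. kernel t x y * f y) \<le> G * B * m * t powr (- ratio)" if t: "t > 0" for t x
  proof -
    have "(LINT y|haarn. kernel t x y * f y) \<le> (LINT y|haarn. (G * t powr (- ratio)) * (B * indicator V y))"
      using t B G f0 V_fin
      by (intro integral_mono int mult_mono supp kernel_le[folded G_def] integrable_mult_right) auto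
    also have "\<dots> = G * B * m * t powr (- ratio)" by (simp add: m_def)
    finally show ?thesis .
  qed
  let ?I = "\<integral>\<^sup>+t. ennreal (t powr (- ratio)) * indicator {1..} t \<partial>lborel"
  have "?I < \<infinity>" using assms alpha_pos by (intro nn_integral_powr_at_top_finite) (simp add: field_simps)
  hence fin: "ennreal B + ennreal (G * B * m) * ?I < \<infinity>" by (simp add: ennreal_mult_less_top)
  have "(\<integral>\<^sup>+t\<in>{0<..}. ennreal (LINT y|haarn. kernel t x y * f y) \<partial>lborel) \<le> ennreal B + ennreal (G * B * m) * ?I" for x
  proof -
    have "(\<integral>\<^sup>+t\<in>{0<..}. ennreal (LINT y|haarn. kernel t x y * f y) \<partial>lborel)
        \<le> (\<integral>\<^sup>+t. ennreal B * indicator {0..1} t + ennreal (G * B * m) * (ennreal (t powr (- ratio)) * indicator {1..} t) \<partial>lborel)"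
    proof (intro nn_integral_mono)
      fix t :: real
      have m: "m \<ge> 0" by (simp add: m_def)
      show "ennreal (LINT y|haarn. kernel t x y * f y) * indicator {0<..} t
          \<le> ennreal B * indicator {0..1} t + ennreal (G * B * m) * (ennreal (t powr (- ratio)) * indicator {1..} t)"
      proof (cases "t > 0")
        case t: True
        show ?thesis
        proof (cases "t < 1")
          case True
          thus ?thesis using t near[OF t, of x] by (simp add: ennreal_leI)
        next
          case False
          have "ennreal (LINT y|haarn. kernel t x y * f y) \<le> ennreal (G * B * m) * ennreal (t powr (- ratio))"
            using far[OF t, of x] G B m by (simp add: ennreal_leI flip: ennreal_mult')
          hence "ennreal (LINT y|haarn. kernel t x y * f y)
              \<le> ennreal B * indicator {0..1} t + ennreal (G * B * m) * ennreal (t powr (- ratio))"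
            by (intro add_increasing) auto
          thus ?thesis using t False by simp
        qed
      qed simp
    qed
    also have "\<dots> = ennreal B + ennreal (G * B * m) * ?I"
      by (simp add: nn_integral_add nn_integral_cmult nn_integral_cmult_indicator)
    finally show ?thesis .
  qed
  moreover obtain C where "ennreal B + ennreal (G * B * m) * ?I = ennreal C"
    using fin by (metis ennreal_enn2real infinity_ennreal_def)
  ultimately show "\<exists>C. \<forall>x. (\<integral>\<^sup>+t\<in>{0<..}. ennreal (LINT y|haarn. kernel t x y * f y) \<partial>lborel) \<le> ennreal C"
    by (intro exI[of _ C]) simp
qed

text \<open>The unit ball is the test set and the origin the starting point. For t \<ge> 1 the lower
  estimate is at least a constant over t there, and the time integral diverges
  logarithmically.\<close>

lemma not_transient_kernel:
  assumes "real CARD('n) \<le> \<alpha>"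
  shows "\<not> transient haarn kernel"
proof
  assume trans: "transient haarn kernel"
  let ?V = "vball (0 :: 'n \<Rightarrow> 'p padic) 0"
  have "closure {x. indicator ?V x \<noteq> (0::real)} \<subseteq> ?V"
    by (intro closure_minimal vec.closed_uball) (auto simp: indicator_def)
  hence "compact (closure {x. indicator ?V x \<noteq> (0::real)})"
    using compact_vball closed_closure by (metis compact_Int_closed inf.absorb_iff2)
  moreover have "bounded (range (indicator ?V :: _ \<Rightarrow> real))"
    unfolding bounded_iff by (intro exI[of _ 1]) (auto simp: indicator_def)
  ultimately obtain C where C: "\<And>x. (\<integral>\<^sup>+t\<in>{0<..}. ennreal (LINT y|haarn. kernel t x y * indicator ?V y) \<partial>lborel) \<le> ennreal C"
    using trans[unfolded transient_def, rule_format, of "indicator ?V"] by auto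
  obtain c where c: "c > 0" and low: "\<And>t x y. t > 0 \<Longrightarrow> c * (t / (t powr (1 / \<alpha>) + vnorm (x - y)) powr (real CARD('n) + \<alpha>)) \<le> kernel t x y"
    using kernel_bounds by blast
  \<comment> \<open>For t \<ge> 1 the distance is at most 1 \<le> u, so u plus the distance is at
    most 2 u; the factor 2 enters with exponent n + \<alpha>.\<close>
  define c' where "c' = c / 2 powr (real CARD('n) + \<alpha>)"
  have c': "c' > 0" using c by (simp add: c'_def)
  have kernel_ge: "c' / t \<le> kernel t 0 y" if t: "t \<ge> 1" and y: "y \<in> ?V" for t y
  proof -
    define u where "u = t powr (1 / \<alpha>)"
    have "t powr 0 \<le> u" unfolding u_def using t alpha_pos by (intro powr_mono) auto
    hence u: "u \<ge> 1" using t by simp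
    have "vnorm (0 - y) \<le> 1" using y vec.N_commute[of 0 y] by (simp add: vec.mem_uball)
    hence "(u + vnorm (0 - y)) powr (real CARD('n) + \<alpha>) \<le> (2 * u) powr (real CARD('n) + \<alpha>)"
      using u alpha_pos vec.N_nonneg[of "0 - y"] by (intro powr_mono2) auto
    also have "\<dots> = 2 powr (real CARD('n) + \<alpha>) * t powr ((real CARD('n) + \<alpha>) / \<alpha>)"
      using u by (simp add: powr_mult u_def powr_powr)
    \<comment> \<open>Here n \<le> \<alpha> enters: it makes the exponent (n + \<alpha>) / \<alpha>
      at most 2.\<close>
    also have "\<dots> \<le> 2 powr (real CARD('n) + \<alpha>) * t powr 2"
      using t assms alpha_pos by (intro mult_left_mono powr_mono) (auto simp: field_simps)
    finally have le: "(u + vnorm (0 - y)) powr (real CARD('n) + \<alpha>) \<le> 2 powr (real CARD('n) + \<alpha>) * t powr 2" .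
    have pos: "(u + vnorm (0 - y)) powr (real CARD('n) + \<alpha>) > 0"
      using u vec.N_nonneg[of "0 - y"] by simp
    have "c' / t = c * (t / (2 powr (real CARD('n) + \<alpha>) * t powr 2))"
      using t by (simp add: c'_def power2_eq_square field_simps)
    also have "\<dots> \<le> c * (t / (u + vnorm (0 - y)) powr (real CARD('n) + \<alpha>))"
      using c t le pos by (intro mult_left_mono divide_left_mono) auto
    also have "\<dots> \<le> kernel t 0 y" unfolding u_def using t by (intro low) simp
    finally show ?thesis .
  qed
  have "(\<integral>\<^sup>+t. ennreal (c' / t) * indicator {1..} t \<partial>lborel)
      \<le> (\<integral>\<^sup>+t\<in>{0<..}. ennreal (LINT y|haarn. kernel t 0 y * indicator ?V y) \<partial>lborel)"
  proof (intro nn_integral_mono)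
    fix t :: real
    show "ennreal (c' / t) * indicator {1..} t \<le> ennreal (LINT y|haarn. kernel t 0 y * indicator ?V y) * indicator {0<..} t"
    proof (cases "t \<ge> 1")
      case True
      have "(LINT y|haarn. (c' / t) * indicator ?V y) \<le> (LINT y|haarn. kernel t 0 y * indicator ?V y)"
      proof (rule integral_mono)
        show "integrable haarn (\<lambda>y. kernel t 0 y * indicator ?V y)"
          using True by (intro integrable_real_mult_indicator integrable_kernel) auto
        show "c' / t * indicator ?V y \<le> kernel t 0 y * indicator ?V y" for y
          using kernel_ge[OF True, of y] by (auto simp: indicator_def)
      qed (intro integrable_mult_right integrable_indicator_vball)
      hence "c' / t \<le> (LINT y|haarn. kernel t 0 y * indicator ?V y)"
        by (simp add: measure_haarn_vball)
      thus ?thesis using True by (simp add: ennreal_leI)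
    qed simp
  qed
  also have "\<dots> \<le> ennreal C" by (rule C)
  finally show False using nn_integral_inverse_at_top_unbounded[OF c'] by blast
qed

end

theorem theorem5p17:
  fixes \<alpha> :: real
    and P :: "real \<Rightarrow> (('n::finite \<Rightarrow> 'p::prime_card padic) \<Rightarrow> complex)
                \<Rightarrow> (('n \<Rightarrow> 'p padic) \<Rightarrow> complex)"
  assumes "\<alpha> > 0"
    and "is_exp_semigroup haarn (taibleson \<alpha>) P"
  shows "\<exists>q :: real \<Rightarrow> ('n \<Rightarrow> 'p padic) \<Rightarrow> ('n \<Rightarrow> 'p padic) \<Rightarrow> real.
           heat_kernel haarn P q \<and> continuous_kernel q
         \<and> (\<exists>c>0. \<exists>C>0. \<forall>t>0. \<forall>x y.
              c * (t / (t powr (1 / \<alpha>) + vnorm (x - y)) powr (real CARD('n) + \<alpha>)) \<le> q t x y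
              \<and> q t x y \<le> C * (t / (t powr (1 / \<alpha>) + vnorm (x - y)) powr (real CARD('n) + \<alpha>)))
         \<and> (transient haarn q \<longleftrightarrow> \<alpha> < real CARD('n))
         \<and> (transient haarn q \<longrightarrow>
              (\<forall>x y. x \<noteq> y \<longrightarrow>
                 green q x y
                   = ennreal ((1 - real CARD('p) powr (- \<alpha>)) / (1 - real CARD('p) powr (\<alpha> - real CARD('n)))
                              * (1 / vnorm (x - y) powr (real CARD('n) - \<alpha>)))))"
proof -
  interpret taibleson_heat \<alpha> "TYPE('n \<Rightarrow> 'p padic)" by unfold_locales fact
  have trans: "transient haarn kernel \<longleftrightarrow> \<alpha> < real CARD('n)"
    using transient_kernel not_transient_kernel by (meson not_le)
  show ?thesis
    by (intro exI[of _ kernel] conjI heat_kernel_kernel[OF assms(2)] continuous_kernel kernel_bounds trans impI allI green_kernel)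
       (use trans in auto)
qed

end
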